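(* Assume that $\mathbb P(X_1<0)>0$ and $\mathbb P(X_1'>0)>0$. Then $Y$ is topologically irreducible on the set $\operatorname{supp}\mu$, which is absorbing for $Y$. Moreover, $$\operatorname{supp}\mu=\Big(\operatorname{supp}\nu_\alpha^++\mathbf 1\big(\mathbb P(X_1>0)\ne0\big)\,\mathcal Z_h^+\Big)\cup\Big(\operatorname{supp}\nu_\alpha^-+\mathbf 1\big(\mathbb P(X_1'<0)\neq0\big)\,\mathcal Z_{h'}^-\Big),$$ where $+$ stands for the Minkowski sum (and $0\cdot E=\{0\}$, $1\cdot E=E$ for a non-empty set $E$). If $\liminf_{n\to\infty}S_n=-\infty$ a.s. and $\limsup_{n\to\infty}S_n'=+\infty$ a.s., then $Y$ hits $\operatorname{supp}\mu$ with probability $1$ provided that $Y_0\in\mathcal Z$.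
   Context: Setting. $X_1,X_1'$ are non-zero real random variables and $\alpha\in[0,1]$. $(X_n)_{n\ge1}$ and $(X_n')_{n\ge1}$ are sequences of i.i.d. random variables, jointly independent; $S_n:=X_1+\dots+X_n$, $S_n':=X_1'+\dots+X_n'$. The conditions $\liminf_n S_n=-\infty$ a.s. and $\limsup_n S_n'=+\infty$ a.s. are not assumed except where stated. The switching random walk $Y=(Y_n)_{n\ge0}$ is the time-homogeneous real-valued Markov chain with transition kernel $P$: $P(x,dy)=\mathbb P(x+X_1\in dy)$ if $x>0$; $P(x,dy)=\mathbb P(x+X_1'\in dy)$ if $x<0$; $P(0,dy)=\alpha\,\mathbb P(X_1\in dy)+(1-\alpha)\,\mathbb P(X_1'\in dy)$. $\mathbb P_x$ means $Y_0=x$. State space. $\mathcal Z_0:=\mathbb R$, $\mathcal Z_u:=u\mathbb Z$ for $u>0$; $\mathcal Z_u^+:=\mathcal Z_u\cap[0,\infty)$, $\mathcal Z_u^-:=\mathcal Z_u\cap(-\infty,0]$. The spans are $h:=\max\{u\ge0:\mathbb P(X_1\in\mathcal Z_u)=1\}$, $h':=\max\{u\ge0:\mathbb P(X_1'\in\mathcal Z_u)=1\}$, and $d:=\max\{u\ge0:\mathbb P(X_1\in\mathcal Z_u)\,\mathbb P(X_1'\in\mathcal Z_u)=1\}$; $\mathcal Z:=\mathcal Z_d$ is the state space of $Y$. $\lambda$ is the Haar measure on $\mathcal Z$ normalized so that $\lambda([0,x)\cap\mathcal Z)=x$ for every positive $x\in\mathcal Z$. Measures are Borel; $\operatorname{supp}$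 is the topological support; $*$ is convolution. Ladder heights. $D:=S_{\gamma_-}$ with $\gamma_-:=\inf\{k\ge1:S_k\le0\}$, on $\{\gamma_-<\infty\}$; $A':=S'_{\gamma_+'}$ with $\gamma_+':=\inf\{k\ge1:S_k'\ge0\}$, on $\{\gamma_+'<\infty\}$; $A_s$ is the value of $S$ at the first $k\ge1$ with $S_k>0$ (if any), $D_s'$ is the value of $S'$ at the first $k\ge1$ with $S_k'<0$ (if any); these random variables may be defective. $\mathcal L(\cdot)$ denotes the (sub-probability) distribution on $\mathcal Z$ of a possibly defective random variable. $U_+:=\delta_0+\sum_{n\ge1}\mathcal L(A_s)^{*n}$, $U_-':=\delta_0+\sum_{n\ge1}\mathcal L(D_s')^{*n}$. For a measure $\varphi$ on $\mathcal Z$: $\varphi_\alpha^+(dx):=[\mathbf 1(x>0)+\alpha\mathbf 1(x=0)]\varphi(dx)$, $\varphi_\alpha^-(dx):=[\mathbf 1(x<0)+(1-\alpha)\mathbf 1(x=0)]\varphi(dx)$. With $p:=\mathbb P(D<0)$, $p':=\mathbb P(A'>0)$, $a:=\frac{p\alpha}{p\alpha+p'(1-\alpha)}$, $$\nu(dx):=\big[\mathbb P(D<x)+\mathbb P(A'>x)-1+a\,\mathbb P(D=x)+(1-a)\,\mathbb P(A'=x)\big]\lambda(dx),\qquad \mu:=U_+*\nu_\alpha^++U_-'*\nu_\alpha^-.$$ A Borel set $E\subset\mathcal Z$ is absorbing for $Y$ if $\mathbb P_x(Y_1\in E)=1$ for every $x\in E$. $Y$ is topologically irreducible on an absorbing set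 $E$ if for every $x\in E$ and every open set $G$ that intersects $E$ we have $\mathbb P_x(Y_n\in G)>0$ for some $n\ge1$.
   Formalization: In the definition of ν, the ladder heights D and A' are set equal to 0 where their ladder epochs are infinite; with defective probabilities the displayed density would be negative near +∞ or −∞, so ν would not be a measure. *)

theory Defs
  imports "HOL-Probability.Probability"
begin

section \<open>Measures on the line\<close>

definition add_measure :: "real measure \<Rightarrow> real measure \<Rightarrow> real measure" where
  "add_measure \<mu> \<nu> = measure_of UNIV (sets borel) (\<lambda>B. emeasure \<mu> B + emeasure \<nu> B)"

primrec conv_power :: "real measure \<Rightarrow> nat \<Rightarrow> real measure" where
  "conv_power F 0 = return borel 0"
| "conv_power F (Suc n) = convolution F (conv_power F n)"

definition renewal_measure :: "real measure \<Rightarrow> real measure" where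
  "renewal_measure F = measure_of UNIV (sets borel) (\<lambda>B. \<Sum>n. emeasure (conv_power F n) B)"

text \<open>A measure on a closed subset of the line is represented by its extension by zero to the
  line; this does not change its topological support.\<close>

definition msupp :: "real measure \<Rightarrow> real set" where
  "msupp \<mu> = {x. \<forall>G. open G \<longrightarrow> x \<in> G \<longrightarrow> emeasure \<mu> G > 0}"

section \<open>Spans, the state space and its Haar measure\<close>

definition lattice :: "real \<Rightarrow> real set" where
  "lattice u = (if u = 0 then UNIV else range (\<lambda>k::int. u * of_int k))"

definition lattice_pos :: "real \<Rightarrow> real set" where
  "lattice_pos u = lattice u \<inter> {0..}"

definition lattice_neg :: "real \<Rightarrow> real set" where
  "lattice_neg u = lattice u \<inter> {..0}"

text \<open>\<open>F\<close> and \<open>F'\<close> stand for the laws of the increments. The maxima exist unless the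
  increments vanish almost surely.\<close>

definition span_of :: "real measure \<Rightarrow> real" where
  "span_of F = (GREATEST u. 0 \<le> u \<and> measure F (lattice u) = 1)"

definition joint_span :: "real measure \<Rightarrow> real measure \<Rightarrow> real" where
  "joint_span F F' = (GREATEST u. 0 \<le> u \<and> measure F (lattice u) * measure F' (lattice u) = 1)"

definition state_space :: "real measure \<Rightarrow> real measure \<Rightarrow> real set" where
  "state_space F F' = lattice (joint_span F F')"

definition haar :: "real \<Rightarrow> real measure" where
  "haar d = (if d = 0 then lborel
     else scale_measure (ennreal d) (distr (count_space (UNIV :: int set)) borel (\<lambda>k. d * of_int k)))"

section \<open>The switching random walk\<close>

definition switching_kernel :: "real \<Rightarrow> real measure \<Rightarrow> real measure \<Rightarrow> real \<Rightarrow> real measure" where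
  "switching_kernel \<alpha> F F' x =
     (if x > 0 then distr F borel (\<lambda>y. x + y)
      else if x < 0 then distr F' borel (\<lambda>y. x + y)
      else add_measure (scale_measure (ennreal \<alpha>) F) (scale_measure (ennreal (1 - \<alpha>)) F'))"

text \<open>The law on the path space of the time-homogeneous Markov chain with transition kernel \<open>K\<close>
  and initial law \<open>\<eta>\<close>; the chain is the coordinate process.\<close>

definition chain_step :: "(real \<Rightarrow> real measure) \<Rightarrow> real measure \<Rightarrow> nat \<Rightarrow> (nat \<Rightarrow> real) \<Rightarrow> real measure" where
  "chain_step K \<eta> n \<omega> = (if n = 0 then \<eta> else K (\<omega> (n - 1)))"

definition chain_law :: "(real \<Rightarrow> real measure) \<Rightarrow> real measure \<Rightarrow> (nat \<Rightarrow> real) measure" where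
  "chain_law K \<eta> =
     projective_family.lim UNIV (Ionescu_Tulcea.CI (chain_step K \<eta>) (\<lambda>_. borel)) (\<lambda>_. borel)"

abbreviation chain_from :: "(real \<Rightarrow> real measure) \<Rightarrow> real \<Rightarrow> (nat \<Rightarrow> real) measure" where
  "chain_from K x \<equiv> chain_law K (return borel x)"

definition absorbing :: "(real \<Rightarrow> real measure) \<Rightarrow> real set \<Rightarrow> real set \<Rightarrow> bool" where
  "absorbing K Z E \<longleftrightarrow> E \<in> sets borel \<and> E \<subseteq> Z \<and>
     (\<forall>x\<in>E. \<P>(\<omega> in chain_from K x. \<omega> 1 \<in> E) = 1)"

definition topologically_irreducible_on :: "(real \<Rightarrow> real measure) \<Rightarrow> real set \<Rightarrow> real set \<Rightarrow> bool" where
  "topologically_irreducible_on K Z E \<longleftrightarrow>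
     (\<forall>x\<in>E. \<forall>G. openin (top_of_set Z) G \<longrightarrow> G \<inter> E \<noteq> {} \<longrightarrow>
        (\<exists>n\<ge>1. \<P>(\<omega> in chain_from K x. \<omega> n \<in> G) > 0))"

section \<open>Ladder heights and the measure \<open>\<mu>\<close>\<close>

text \<open>Sequences are indexed from \<open>0\<close>, so \<open>X 0\<close> is the first increment.\<close>

definition walk :: "(nat \<Rightarrow> 'a \<Rightarrow> real) \<Rightarrow> nat \<Rightarrow> 'a \<Rightarrow> real" where
  "walk X n \<omega> = (\<Sum>k<n. X k \<omega>)"

definition enters :: "(nat \<Rightarrow> 'a \<Rightarrow> real) \<Rightarrow> real set \<Rightarrow> 'a \<Rightarrow> bool" where
  "enters X B \<omega> \<longleftrightarrow> (\<exists>k\<ge>1. walk X k \<omega> \<in> B)"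

definition entrance :: "(nat \<Rightarrow> 'a \<Rightarrow> real) \<Rightarrow> real set \<Rightarrow> 'a \<Rightarrow> real" where
  "entrance X B \<omega> = (if enters X B \<omega> then walk X (LEAST k. k \<ge> 1 \<and> walk X k \<omega> \<in> B) \<omega> else 0)"

definition defective_law :: "'a measure \<Rightarrow> (nat \<Rightarrow> 'a \<Rightarrow> real) \<Rightarrow> real set \<Rightarrow> real measure" where
  "defective_law M X B =
     distr (restrict_space M {\<omega> \<in> space M. enters X B \<omega>}) borel (entrance X B)"

definition U_plus :: "'a measure \<Rightarrow> (nat \<Rightarrow> 'a \<Rightarrow> real) \<Rightarrow> real measure" where
  "U_plus M X = renewal_measure (defective_law M X {0<..})"

definition U_minus :: "'a measure \<Rightarrow> (nat \<Rightarrow> 'a \<Rightarrow> real) \<Rightarrow> real measure" where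
  "U_minus M X' = renewal_measure (defective_law M X' {..<0})"

text \<open>The weak ladder heights \<open>D\<close> and \<open>A'\<close> enter the density of \<open>\<nu>\<close> through the following
  everywhere defined versions, equal to \<open>0\<close> where the ladder epoch is infinite. If both epochs are
  almost surely finite, this convention plays no role. Otherwise it keeps the density nonnegative;
  if the probability of an infinite epoch were just dropped, the density would be negative near
  \<open>\<infinity>\<close> or near \<open>-\<infinity>\<close>. The numbers \<open>p\<close> and \<open>p'\<close> are not affected.\<close>

definition D_height :: "(nat \<Rightarrow> 'a \<Rightarrow> real) \<Rightarrow> 'a \<Rightarrow> real" where
  "D_height X = entrance X {..0}"

definition A_height :: "(nat \<Rightarrow> 'a \<Rightarrow> real) \<Rightarrow> 'a \<Rightarrow> real" where
  "A_height X' = entrance X' {0..}"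

definition nu_coeff :: "'a measure \<Rightarrow> real \<Rightarrow> (nat \<Rightarrow> 'a \<Rightarrow> real) \<Rightarrow> (nat \<Rightarrow> 'a \<Rightarrow> real) \<Rightarrow> real" where
  "nu_coeff M \<alpha> X X' =
     (let p = \<P>(\<omega> in M. D_height X \<omega> < 0); p' = \<P>(\<omega> in M. A_height X' \<omega> > 0)
      in p * \<alpha> / (p * \<alpha> + p' * (1 - \<alpha>)))"

definition nu_density :: "'a measure \<Rightarrow> real \<Rightarrow> (nat \<Rightarrow> 'a \<Rightarrow> real) \<Rightarrow> (nat \<Rightarrow> 'a \<Rightarrow> real) \<Rightarrow> real \<Rightarrow> real" where
  "nu_density M \<alpha> X X' x =
     \<P>(\<omega> in M. D_height X \<omega> < x) + \<P>(\<omega> in M. A_height X' \<omega> > x) - 1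
     + nu_coeff M \<alpha> X X' * \<P>(\<omega> in M. D_height X \<omega> = x)
     + (1 - nu_coeff M \<alpha> X X') * \<P>(\<omega> in M. A_height X' \<omega> = x)"

definition nu :: "'a measure \<Rightarrow> real \<Rightarrow> (nat \<Rightarrow> 'a \<Rightarrow> real) \<Rightarrow> (nat \<Rightarrow> 'a \<Rightarrow> real) \<Rightarrow> real measure" where
  "nu M \<alpha> X X' =
     density (haar (joint_span (distr M borel (X 0)) (distr M borel (X' 0))))
       (\<lambda>x. ennreal (nu_density M \<alpha> X X' x))"

definition plus_part :: "real \<Rightarrow> real measure \<Rightarrow> real measure" where
  "plus_part \<alpha> \<phi> = density \<phi> (\<lambda>x. indicator {0<..} x + ennreal \<alpha> * indicator {0} x)"

definition minus_part :: "real \<Rightarrow> real measure \<Rightarrow> real measure" where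
  "minus_part \<alpha> \<phi> = density \<phi> (\<lambda>x. indicator {..<0} x + ennreal (1 - \<alpha>) * indicator {0} x)"

definition mu :: "'a measure \<Rightarrow> real \<Rightarrow> (nat \<Rightarrow> 'a \<Rightarrow> real) \<Rightarrow> (nat \<Rightarrow> 'a \<Rightarrow> real) \<Rightarrow> real measure" where
  "mu M \<alpha> X X' =
     add_measure (convolution (U_plus M X) (plus_part \<alpha> (nu M \<alpha> X X')))
                 (convolution (U_minus M X') (minus_part \<alpha> (nu M \<alpha> X X')))"

section \<open>Consistency checks\<close>

lemma sets_add_measure [simp, measurable_cong]: "sets (add_measure \<mu> \<nu>) = sets borel"
  using sets.sigma_sets_eq[of "borel :: real measure"]
  by (simp add: add_measure_def)

lemma space_add_measure [simp]: "space (add_measure \<mu> \<nu>) = UNIV"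
  by (simp add: add_measure_def)

lemma emeasure_add_measure:
  assumes "sets \<mu> = sets borel" "sets \<nu> = sets borel" "B \<in> sets borel"
  shows "emeasure (add_measure \<mu> \<nu>) B = emeasure \<mu> B + emeasure \<nu> B"
proof (rule emeasure_measure_of[OF add_measure_def])
  show "countably_additive (sets (add_measure \<mu> \<nu>)) (\<lambda>B. emeasure \<mu> B + emeasure \<nu> B)"
  proof (rule countably_additiveI)
    fix A :: "nat \<Rightarrow> real set"
    assume "range A \<subseteq> sets (add_measure \<mu> \<nu>)" "disjoint_family A"
    with assms show "(\<Sum>i. emeasure \<mu> (A i) + emeasure \<nu> (A i)) = emeasure \<mu> (\<Union>i. A i) + emeasure \<nu> (\<Union>i. A i)"
      by (subst suminf_add[symmetric]) (auto simp: suminf_emeasure)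
  qed
qed (use assms in \<open>auto simp: positive_def\<close>)

lemma sets_conv_power [simp]: "sets (conv_power F n) = sets borel"
  by (cases n) auto

lemma sets_renewal_measure [simp, measurable_cong]: "sets (renewal_measure F) = sets borel"
  using sets.sigma_sets_eq[of "borel :: real measure"]
  by (simp add: renewal_measure_def)

lemma emeasure_renewal_measure:
  assumes "B \<in> sets borel"
  shows "emeasure (renewal_measure F) B = (\<Sum>n. emeasure (conv_power F n) B)"
proof (rule emeasure_measure_of[OF renewal_measure_def])
  show "countably_additive (sets (renewal_measure F)) (\<lambda>B. \<Sum>n. emeasure (conv_power F n) B)"
  proof (rule countably_additiveI)
    fix A :: "nat \<Rightarrow> real set"
    assume A: "range A \<subseteq> sets (renewal_measure F)" "disjoint_family A"
    have "(\<Sum>i. \<Sum>n. emeasure (conv_power F n) (A i)) = (\<Sum>n. \<Sum>i. emeasure (conv_power F n) (A i))"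
      using nn_integral_suminf[of "\<lambda>n i. emeasure (conv_power F n) (A i)" "count_space UNIV"]
      by (simp add: nn_integral_count_space_nat)
    also have "\<dots> = (\<Sum>n. emeasure (conv_power F n) (\<Union>i. A i))"
      using A by (intro suminf_cong suminf_emeasure) auto
    finally show "(\<Sum>i. \<Sum>n. emeasure (conv_power F n) (A i)) = (\<Sum>n. emeasure (conv_power F n) (\<Union>i. A i))" .
  qed
qed (use assms in \<open>auto simp: positive_def\<close>)

lemma haar_normalized:
  assumes "0 \<le> d" "x \<in> lattice d" "0 < x"
  shows "emeasure (haar d) ({0..<x} \<inter> lattice d) = ennreal x"
proof (cases "d = 0")
  case True
  with assms show ?thesis by (simp add: haar_def lattice_def)
next
  case False
  with assms have d: "d > 0" by simp
  obtain k :: int where k: "x = d * of_int k"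
    using assms False by (auto simp: lattice_def)
  have k0: "k > 0" using assms d by (simp add: k zero_less_mult_iff)
  have ran: "range (\<lambda>k::int. d * of_int k) \<in> sets borel"
    by (rule sets.countable) (simp_all add: countable_image)
  have eq: "(\<lambda>j::int. d * of_int j) -` ({0..<x} \<inter> lattice d) = {0..<k}"
    using d by (auto simp: k lattice_def zero_le_mult_iff)
  have "{0..<x} \<inter> lattice d \<in> sets borel"
    using ran d by (simp add: lattice_def)
  then have "emeasure (haar d) ({0..<x} \<inter> lattice d) = ennreal d * emeasure (count_space UNIV) {0..<k}"
    using d by (simp add: haar_def emeasure_distr eq del: vimage_Int)
  also have "\<dots> = ennreal d * ennreal (of_int k)"
    using k0 by (simp add: ennreal_of_nat_eq_real_of_nat)
  also have "\<dots> = ennreal x"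
    using d by (simp add: k ennreal_mult')
  finally show ?thesis .
qed

lemma prob_kernel_switching_kernel:
  assumes "prob_space F" "prob_space F'" "sets F = sets borel" "sets F' = sets borel" "0 \<le> \<alpha>" "\<alpha> \<le> 1"
  shows "switching_kernel \<alpha> F F' \<in> borel \<rightarrow>\<^sub>M prob_algebra borel"
proof -
  interpret F: prob_space F by fact
  interpret F': prob_space F' by fact
  have shift: "(\<lambda>x::real. distr G borel (\<lambda>y. x + y)) \<in> borel \<rightarrow>\<^sub>M prob_algebra borel"
    if "prob_space G" and [measurable_cong]: "sets G = sets borel" for G :: "real measure"
  proof -
    interpret G: prob_space G by fact
    have G: "G \<in> space (prob_algebra borel)" using that by (simp add: space_prob_algebra)
    show ?thesis
      by (rule measurable_distr_prob_space2[where M=borel]) (use G in auto)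
  qed
  have "prob_space (add_measure (scale_measure (ennreal \<alpha>) F) (scale_measure (ennreal (1 - \<alpha>)) F'))"
    using assms F.emeasure_space_1 F'.emeasure_space_1
      sets_eq_imp_space_eq[OF assms(3)] sets_eq_imp_space_eq[OF assms(4)]
    by (intro prob_spaceI) (simp add: emeasure_add_measure ennreal_plus[symmetric] del: ennreal_plus)
  then have "add_measure (scale_measure (ennreal \<alpha>) F) (scale_measure (ennreal (1 - \<alpha>)) F')
      \<in> space (prob_algebra borel)"
    by (simp add: space_prob_algebra)
  with shift[OF assms(1,3)] shift[OF assms(2,4)] show ?thesis
    unfolding switching_kernel_def[abs_def] by measurable
qed

lemma Ionescu_Tulcea_chain_step:
  assumes K: "K \<in> borel \<rightarrow>\<^sub>M prob_algebra borel" and \<eta>: "prob_space \<eta>" "sets \<eta> = sets borel"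
  shows "Ionescu_Tulcea (chain_step K \<eta>) (\<lambda>_. borel)"
proof (rule Ionescu_Tulcea.intro)
  fix i :: nat
  have "\<eta> \<in> space (subprob_algebra borel)"
    using \<eta> by (simp add: space_subprob_algebra prob_space_imp_subprob_space)
  moreover have "(\<lambda>\<omega>. K (\<omega> (i - 1))) \<in> PiM {0..<i} (\<lambda>_. borel) \<rightarrow>\<^sub>M subprob_algebra borel" if "i \<noteq> 0"
  proof (rule measurable_compose[where N=borel])
    show "(\<lambda>\<omega>. \<omega> (i - 1)) \<in> PiM {0..<i} (\<lambda>_. borel) \<rightarrow>\<^sub>M (borel :: real measure)"
      using that by (intro measurable_component_singleton) auto
  qed (rule measurable_prob_algebraD[OF K])
  ultimately show "chain_step K \<eta> i \<in> PiM {0..<i} (\<lambda>_. borel) \<rightarrow>\<^sub>M subprob_algebra borel"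
    unfolding chain_step_def[abs_def] by (cases "i = 0") auto
  fix x
  show "prob_space (chain_step K \<eta> i x)"
    using \<eta> measurable_space[OF K] by (auto simp: chain_step_def space_prob_algebra)
qed

lemma prob_space_chain_law:
  assumes "K \<in> borel \<rightarrow>\<^sub>M prob_algebra borel" "prob_space \<eta>" "sets \<eta> = sets borel"
  shows "prob_space (chain_law K \<eta>)" "sets (chain_law K \<eta>) = sets (PiM UNIV (\<lambda>_. borel))"
proof -
  interpret Ionescu_Tulcea "chain_step K \<eta>" "\<lambda>_. borel"
    by (rule Ionescu_Tulcea_chain_step) fact+
  show "sets (chain_law K \<eta>) = sets (PiM UNIV (\<lambda>_. borel))"
    by (simp add: chain_law_def)
  interpret CI0: prob_space "CI {}"
    by (rule PF.prob_space_P) auto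
  have "emeasure PF.lim (PF.emb UNIV {} (space (PiM {} (\<lambda>_. borel)))) = emeasure (CI {}) (space (PiM {} (\<lambda>_. borel)))"
    by (rule lim) auto
  also have "\<dots> = 1"
    using CI0.emeasure_space_1 by (simp add: CI_def)
  also have "PF.emb UNIV {} (space (PiM {} (\<lambda>_. borel))) = space PF.lim"
    by (auto simp: prod_emb_def space_PiM PF.space_lim)
  finally show "prob_space (chain_law K \<eta>)"
    unfolding chain_law_def by (rule prob_spaceI)
qed

text \<open>The coordinate process is a Markov chain with kernel \<open>K\<close> and initial law \<open>\<eta>\<close>
  (the latter is the case \<open>n = 0\<close>).\<close>

lemma chain_law_Markov:
  fixes K :: "real \<Rightarrow> real measure"
  assumes "K \<in> borel \<rightarrow>\<^sub>M prob_algebra borel" "prob_space \<eta>" "sets \<eta> = sets borel"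
    and A: "A \<in> sets (PiM {0..<n} (\<lambda>_. borel))" and B: "B \<in> sets borel"
  shows "emeasure (chain_law K \<eta>) {\<omega>. restrict \<omega> {0..<n} \<in> A \<and> \<omega> n \<in> B} =
    (\<integral>\<^sup>+\<omega>. indicator A (restrict \<omega> {0..<n}) * emeasure (chain_step K \<eta> n \<omega>) B \<partial>chain_law K \<eta>)"
proof -
  interpret Ionescu_Tulcea "chain_step K \<eta>" "\<lambda>_. borel"
    by (rule Ionescu_Tulcea_chain_step) fact+
  let ?u = "\<lambda>_::nat. undefined :: real"
  let ?P = "\<lambda>m. PiM {0..<m} (\<lambda>_. borel :: real measure)"
  have lim_C: "emeasure PF.lim (PF.emb UNIV {0..<m} S) = emeasure (C 0 m ?u) S" if "S \<in> sets (?P m)" for m S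
  proof -
    have "PF.emb {0..<m} {0..<m} S = S"
      using sets.sets_into_space[OF that] by (intro prod_emb_id) (simp add: space_PiM)
    with that show ?thesis
      by (simp add: lim emeasure_CI[of _ m])
  qed
  have emb: "PF.emb UNIV {0..<m} S = (\<lambda>\<omega>. restrict \<omega> {0..<m}) -` S" for m S
    by (auto simp: prod_emb_def space_PiM)
  have sets_C0: "sets (C 0 m ?u) = sets (?P m)" for m
    using sets_C[of ?u 0 m] by simp
  have C_distr: "C 0 n ?u = distr PF.lim (?P n) (\<lambda>\<omega>. restrict \<omega> {0..<n})"
  proof (rule measure_eqI)
    fix S assume "S \<in> sets (C 0 n ?u)"
    then have S: "S \<in> sets (?P n)" by (simp add: sets_C0)
    show "emeasure (C 0 n ?u) S = emeasure (distr PF.lim (?P n) (\<lambda>\<omega>. restrict \<omega> {0..<n})) S"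
      using S by (subst emeasure_distr)
        (auto simp: lim_C[OF S, symmetric] emb PF.space_lim measurable_cong_sets[OF PF.sets_lim refl]
          space_PiM intro!: measurable_restrict_subset)
  qed (simp add: sets_C0)
  define S where "S = {\<omega> \<in> space (?P (Suc n)). restrict \<omega> {0..<n} \<in> A \<and> \<omega> n \<in> B}"
  have S: "S \<in> sets (?P (Suc n))"
  proof -
    have [measurable]: "(\<lambda>\<omega>. restrict \<omega> {0..<n}) \<in> ?P (Suc n) \<rightarrow>\<^sub>M ?P n"
      by (intro measurable_restrict_subset) auto
    have [measurable]: "(\<lambda>\<omega>. \<omega> n) \<in> ?P (Suc n) \<rightarrow>\<^sub>M borel"
      by (intro measurable_component_singleton) auto
    show ?thesis unfolding S_def using A B by measurable
  qed
  have "emeasure PF.lim {\<omega>. restrict \<omega> {0..<n} \<in> A \<and> \<omega> n \<in> B} = emeasure PF.lim (PF.emb UNIV {0..<Suc n} S)"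
    by (rule arg_cong[where f="emeasure PF.lim"])
      (auto simp: emb S_def space_PiM Int_absorb1 restrict_restrict)
  also have "\<dots> = emeasure (C 0 (Suc n) ?u) S"
    by (rule lim_C[OF S])
  also have "\<dots> = (\<integral>\<^sup>+\<omega>. emeasure (eP n \<omega>) S \<partial>C 0 n ?u)"
    using S by (simp add: emeasure_bind[where N="?P (Suc n)"] space_C measurable_cong_sets[OF sets_C0 refl])
  also have "\<dots> = (\<integral>\<^sup>+\<omega>. indicator A \<omega> * emeasure (chain_step K \<eta> n \<omega>) B \<partial>C 0 n ?u)"
  proof (rule nn_integral_cong)
    fix \<omega> assume "\<omega> \<in> space (C 0 n ?u)"
    then have \<omega>: "\<omega> \<in> space (?P n)" by (simp add: space_C)
    have r: "restrict (fun_upd \<omega> n x) {0..<n} = \<omega>" for x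
      using \<omega> by (auto simp: space_PiM PiE_def extensional_def restrict_def fun_eq_iff)
    have "(\<lambda>x. fun_upd \<omega> n x) -` S \<inter> UNIV = (if \<omega> \<in> A then B else {})"
      using \<omega> by (auto simp: S_def r space_PiM PiE_def extensional_def)
    then show "emeasure (eP n \<omega>) S = indicator A \<omega> * emeasure (chain_step K \<eta> n \<omega>) B"
      using emeasure_eP[OF \<omega> S] by simp
  qed
  also have "\<dots> = (\<integral>\<^sup>+\<omega>. indicator A (restrict \<omega> {0..<n}) *
      emeasure (chain_step K \<eta> n (restrict \<omega> {0..<n})) B \<partial>PF.lim)"
    unfolding C_distr
  proof (rule nn_integral_distr)
    show "(\<lambda>\<omega>. restrict \<omega> {0..<n}) \<in> PF.lim \<rightarrow>\<^sub>M ?P n"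
      by (auto simp: measurable_cong_sets[OF PF.sets_lim refl] intro!: measurable_restrict_subset)
    show "(\<lambda>\<omega>. indicator A \<omega> * emeasure (chain_step K \<eta> n \<omega>) B) \<in> borel_measurable
        (distr PF.lim (?P n) (\<lambda>\<omega>. restrict \<omega> {0..<n}))"
      using A B P[of n] by measurable
  qed
  also have "\<dots> = (\<integral>\<^sup>+\<omega>. indicator A (restrict \<omega> {0..<n}) * emeasure (chain_step K \<eta> n \<omega>) B \<partial>PF.lim)"
    by (intro nn_integral_cong) (simp add: chain_step_def)
  finally show ?thesis
    unfolding chain_law_def .
qed

lemma entrance_mem: "enters X B \<omega> \<Longrightarrow> entrance X B \<omega> \<in> B"
  unfolding entrance_def enters_def
  by (auto intro: LeastI2_ex[where Q="\<lambda>k. walk X k \<omega> \<in> B"])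

lemma measurable_entrance:
  assumes [measurable]: "\<And>n. X n \<in> borel_measurable M" "B \<in> sets borel"
  shows "entrance X B \<in> borel_measurable M"
proof -
  have [measurable]: "walk X n \<in> borel_measurable M" for n
    unfolding walk_def[abs_def] by measurable
  show ?thesis
    unfolding entrance_def[abs_def] enters_def by measurable
qed

lemma nu_density_nonneg:
  assumes "prob_space M" "0 \<le> \<alpha>" "\<alpha> \<le> 1"
    and [measurable]: "\<And>n. X n \<in> borel_measurable M" "\<And>n. X' n \<in> borel_measurable M"
  shows "0 \<le> nu_density M \<alpha> X X' x"
proof -
  interpret prob_space M by fact
  have [measurable]: "D_height X \<in> borel_measurable M" "A_height X' \<in> borel_measurable M"
    unfolding D_height_def A_height_def by (auto intro!: measurable_entrance)
  have D: "D_height X \<omega> \<le> 0" for \<omega>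
    using entrance_mem[of X "{..0}" \<omega>] by (cases "enters X {..0} \<omega>") (auto simp: D_height_def entrance_def)
  have A: "A_height X' \<omega> \<ge> 0" for \<omega>
    using entrance_mem[of X' "{0..}" \<omega>] by (cases "enters X' {0..} \<omega>") (auto simp: A_height_def entrance_def)
  define a where "a = nu_coeff M \<alpha> X X'"
  have a: "0 \<le> a" "a \<le> 1"
  proof -
    define p where "p = \<P>(\<omega> in M. D_height X \<omega> < 0) * \<alpha>"
    define p' where "p' = \<P>(\<omega> in M. A_height X' \<omega> > 0) * (1 - \<alpha>)"
    have "0 \<le> p" "0 \<le> p'" "a = p / (p + p')"
      using assms(2,3) by (simp_all add: p_def p'_def a_def nu_coeff_def Let_def)
    then show "0 \<le> a" "a \<le> 1"
      by (auto simp: divide_le_eq_1)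
  qed
  have arith: "p + p' - 1 + c * (1 - p) + (1 - c) * (1 - p') = (1 - c) * p + c * p'" for p p' c :: real
    by (simp add: algebra_simps)
  consider "x > 0" | "x < 0" | "x = 0" by linarith
  then show ?thesis
  proof cases
    case 1
    then have "{\<omega> \<in> space M. D_height X \<omega> < x} = space M"
      using D by (auto intro: le_less_trans)
    then show ?thesis
      using a by (simp add: nu_density_def prob_space flip: a_def)
  next
    case 2
    then have "{\<omega> \<in> space M. x < A_height X' \<omega>} = space M"
      using A by (auto intro: less_le_trans)
    then show ?thesis
      using a by (simp add: nu_density_def prob_space flip: a_def)
  next
    case 3
    have "{\<omega> \<in> space M. D_height X \<omega> = 0} = space M - {\<omega> \<in> space M. D_height X \<omega> < 0}"
      using D by (auto simp: not_less intro: antisym)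
    then have pD: "\<P>(\<omega> in M. D_height X \<omega> = 0) = 1 - \<P>(\<omega> in M. D_height X \<omega> < 0)"
      by (simp add: prob_compl)
    have "{\<omega> \<in> space M. A_height X' \<omega> = 0} = space M - {\<omega> \<in> space M. A_height X' \<omega> > 0}"
      using A by (auto simp: not_less intro: antisym)
    then have pA: "\<P>(\<omega> in M. A_height X' \<omega> = 0) = 1 - \<P>(\<omega> in M. A_height X' \<omega> > 0)"
      by (simp add: prob_compl)
    have "nu_density M \<alpha> X X' x =
        (1 - a) * \<P>(\<omega> in M. D_height X \<omega> < 0) + a * \<P>(\<omega> in M. A_height X' \<omega> > 0)"
      unfolding nu_density_def \<open>x = 0\<close> pD pA a_def by (rule arith)
    then show ?thesis
      using a by simp
  qed
qed

end

theory Submission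
  imports Defs "HOL-Analysis.Kronecker_Approximation_Theorem"
begin

text \<open>Everything is expressed through the topological supports \<open>A\<close> and \<open>A'\<close> of the two increment laws.
  A closed additive submonoid of the line with elements of both signs is a lattice \<open>\<Z>\<^sub>u\<close>; hence
  \<open>A\<close> generates \<open>\<Z>\<^sub>h\<close> and \<open>A \<union> A'\<close> generates the state space. Performing the negative increments before the
  positive ones shows that ladder heights of \<open>S\<close> come arbitrarily close to \<open>h\<close>, which gives the support
  of \<open>U\<^sub>+\<close>; the support of \<open>\<nu>\<close> is read off from its density.

  For irreducibility fix \<open>- m \<in> A\<close> and \<open>q \<in> A'\<close> with \<open>m, q > 0\<close>. The default move (\<open>- m\<close> upwards of \<open>0\<close>, \<open>q\<close>
  downwards of \<open>0\<close>) is the rotation by \<open>- m\<close> modulo \<open>m + q\<close> on either side of \<open>0\<close>. It is recurrent, it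
  brings the walk back to the window \<open>(- m, q)\<close>, and the other increments act on the circle as translations
  generating a dense subgroup of the image of the state space, so every point of the window is approached
  from everywhere.

  Under the last assumption the walk leaves each half-line almost surely, and the first point beyond
  \<open>0\<close> lies in the support.\<close>

section \<open>Closed additive submonoids of the line\<close>

text \<open>The obstacle is the switch at 0. The acting law changes there, so a path of support
  increments from x to y does not by itself show that neighbourhoods of y are charged from x:
  arbitrarily small errors may put the walk on the other side. This is why \<open>hit\<close>
  demands that a whole neighbourhood of each landing point leads on, and why hitting is propagated
  backwards from the target. What propagates is \<open>class_hits\<close>, a property of residues
  modulo m + q, for which the switch is invisible; as it is an open condition, one tolerance
  survives arbitrarily many inexact steps. A residue is turned back into a point only inside the
  window, whose length m + q leaves one representative per class. This part of the argument sees
  only \<alpha>, d and the two supports. \<open>full_range\<close> describes the support of \<mu> in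
  these terms; that it is reached and never left is proved before any measure appears. The
  reflection x -> - x, which exchanges \<open>A\<close> with \<open>- A'\<close> and \<alpha> with 1
  - \<alpha>, gives most statements about the lower half-line for free.\<close>

definition additive_hull :: "'a::monoid_add set \<Rightarrow> 'a set" where
  "additive_hull A = {sum_list ys | ys. set ys \<subseteq> A}"

text \<open>Recurrence of the rotation by \<open>x\<close> on a circle of length \<open>s\<close>,
  with return times as late as desired: a Dirichlet return repeated \<open>N'\<close> times is still
  a return if its error was small enough at the outset.\<close>

lemma Dirichlet_multiple:
  fixes x s :: real
  assumes "s > 0" "\<epsilon> > 0"
  obtains n :: nat and k :: int where "n \<ge> N" "n > 0" "\<bar>real n * x - of_int k * s\<bar> < \<epsilon>"
proof -
  define N' where "N' = Suc N"
  \<comment> \<open>One return has error below \<open>s / L\<close>, and \<open>N'\<close>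
    repetitions multiply it by \<open>N'\<close>.\<close>
  obtain L :: nat where L: "real L > s * N' / \<epsilon>" "L > 0"
    using reals_Archimedean2[of "max 0 (s * N' / \<epsilon>)"] by auto
  obtain h k :: int where hk: "0 < k" "\<bar>of_int k * (x / s) - of_int h\<bar> < 1 / L"
    using Dirichlet_approx[OF L(2)] by metis
  have "\<bar>real (N' * nat k) * x - of_int (int N' * h) * s\<bar> = real N' * (s * \<bar>of_int k * (x / s) - of_int h\<bar>)"
  proof -
    have "real (N' * nat k) * x - of_int (int N' * h) * s = real N' * (s * (of_int k * (x / s) - of_int h))"
      using assms(1) hk(1) by (simp add: field_simps)
    then show ?thesis using assms(1) by (simp add: abs_mult)
  qed
  also have "\<dots> < real N' * (s * (1 / L))"
    using hk(2) assms(1) by (intro mult_strict_left_mono) (auto simp: N'_def)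
  also have "\<dots> < \<epsilon>"
    using L assms by (simp add: field_simps)
  finally have "\<bar>real (N' * nat k) * x - of_int (int N' * h) * s\<bar> < \<epsilon>" .
  moreover have "N' * 1 \<le> N' * nat k" using hk(1) by (intro mult_le_mono2) auto
  moreover have "N' > 0" "N' > N" by (auto simp: N'_def)
  ultimately show ?thesis
    by (intro that[of "N' * nat k" "int N' * h"]) linarith+
qed

lemma zero_in_additive_hull [simp]: "0 \<in> additive_hull A"
  unfolding additive_hull_def by (force intro: exI[of _ "[]"])

lemma additive_hull_superset: "A \<subseteq> additive_hull A"
proof
  fix x assume "x \<in> A"
  then show "x \<in> additive_hull A" unfolding additive_hull_def by (force intro: exI[of _ "[x]"])
qed

lemma additive_hull_add: "x \<in> additive_hull A \<Longrightarrow> y \<in> additive_hull A \<Longrightarrow> x + y \<in> additive_hull A"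
proof -
  assume "x \<in> additive_hull A" "y \<in> additive_hull A"
  then obtain xs ys where "x = sum_list xs" "set xs \<subseteq> A" "y = sum_list ys" "set ys \<subseteq> A"
    unfolding additive_hull_def by blast
  then have "x + y = sum_list (xs @ ys)" "set (xs @ ys) \<subseteq> A" by auto
  then show "x + y \<in> additive_hull A" unfolding additive_hull_def by blast
qed

lemma closure_additive_hull_add:
  fixes A :: "'a::real_normed_vector set"
  assumes "x \<in> closure (additive_hull A)" "y \<in> closure (additive_hull A)"
  shows "x + y \<in> closure (additive_hull A)"
proof -
  have "x + y \<in> closure (additive_hull A + additive_hull A)"
    using closure_sum[of "additive_hull A" "additive_hull A"] assms by (auto intro: set_plus_intro)
  moreover have "additive_hull A + additive_hull A \<subseteq> additive_hull A"
    by (auto elim!: set_plus_elim intro: additive_hull_add)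
  ultimately show ?thesis using closure_mono by blast
qed

lemma additive_hull_minimal:
  assumes "A \<subseteq> C" "0 \<in> C" "\<And>x y. x \<in> C \<Longrightarrow> y \<in> C \<Longrightarrow> x + y \<in> C"
  shows "additive_hull A \<subseteq> C"
proof -
  have "sum_list ys \<in> C" if "set ys \<subseteq> A" for ys
    using that by (induction ys) (use assms in auto)
  then show ?thesis unfolding additive_hull_def by auto
qed

lemma lattice_zero [simp]: "0 \<in> lattice u"
  unfolding lattice_def by (auto intro: image_eqI[of _ _ 0])

lemma lattice_add: "x \<in> lattice u \<Longrightarrow> y \<in> lattice u \<Longrightarrow> x + y \<in> lattice u"
  unfolding lattice_def by (auto simp: distrib_left[symmetric] of_int_add[symmetric] simp del: of_int_add)

lemma lattice_uminus: "x \<in> lattice u \<Longrightarrow> - x \<in> lattice u"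
  unfolding lattice_def by (auto simp: mult_minus_right[symmetric] of_int_minus[symmetric] simp del: of_int_minus mult_minus_right)

lemma lattice_uminus_iff [simp]: "- x \<in> lattice u \<longleftrightarrow> x \<in> lattice u"
  using lattice_uminus[of x u] lattice_uminus[of "-x" u] by auto

lemma lattice_diff: "x \<in> lattice u \<Longrightarrow> y \<in> lattice u \<Longrightarrow> x - y \<in> lattice u"
  using lattice_add[of x u "-y"] by simp

lemma lattice_discrete:
  assumes "u > 0" "x \<in> lattice u" "y \<in> lattice u" "\<bar>x - y\<bar> < u"
  shows "x = y"
proof -
  obtain i j :: int where ij: "x = u * of_int i" "y = u * of_int j"
    using assms by (auto simp: lattice_def)
  have "\<bar>x - y\<bar> = u * of_int \<bar>i - j\<bar>"
    using assms(1) by (simp add: ij abs_mult flip: right_diff_distrib)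
  then have "of_int \<bar>i - j\<bar> < (1::real)" using assms(1,4) by simp
  then have "i = j" by linarith
  then show ?thesis by (simp add: ij)
qed

lemma closed_lattice [simp]:
  assumes "u \<ge> 0"
  shows "closed (lattice u)"
proof (cases "u = 0")
  case False
  then have u: "u > 0" using assms by simp
  show ?thesis
  proof (rule discrete_imp_closed[of u])
    show "\<forall>x\<in>lattice u. \<forall>y\<in>lattice u. dist y x < u \<longrightarrow> y = x"
      using lattice_discrete[OF u] by (auto simp: dist_real_def)
  qed (use u in auto)
qed (simp add: lattice_def)

lemma lattice_least_pos:
  assumes "u > 0" "x \<in> lattice u" "x > 0"
  shows "u \<le> x"
  using lattice_discrete[OF assms(1,2), of 0] assms(3) by fastforce

lemma lattice_subset_imp_le:
  assumes "u \<ge> 0" "v \<ge> 0" "lattice u \<subseteq> lattice v"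
  shows "v \<le> u"
proof (rule ccontr)
  assume "\<not> v \<le> u"
  then have v: "v > 0" "v > u" using assms by auto
  \<comment> \<open>\<open>lattice 0\<close> is the whole line and has no least positive element, so
    for \<open>u = 0\<close> some point of (0, v) has to be picked.\<close>
  define x where "x = (if u = 0 then v / 2 else u)"
  have "x \<in> lattice u" unfolding x_def lattice_def by (auto intro: image_eqI[of _ _ 1])
  then have "x \<in> lattice v" using assms by auto
  moreover have "x > 0" "x < v" using v assms by (auto simp: x_def)
  ultimately show False using lattice_least_pos[OF v(1)] by fastforce
qed

text \<open>Closedness supplies the inverses. Rotation by \<open>x\<close> modulo an element
  \<open>e\<close> of opposite sign returns close to 0, so \<open>n x + j e\<close> is small for
  some positive \<open>n\<close>, \<open>j\<close>, and \<open>(n - 1) x + j e\<close> approximates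
  \<open>- x\<close>. For the resulting group the infimum \<open>g\<close> of the positive elements
  decides between a dense set and multiples of \<open>g\<close>.\<close>

lemma closed_additive_submonoid_is_lattice:
  fixes C :: "real set"
  assumes "closed C" and zero: "0 \<in> C" and add: "\<And>x y. x \<in> C \<Longrightarrow> y \<in> C \<Longrightarrow> x + y \<in> C"
    and p: "p \<in> C" "p > 0" and m: "m \<in> C" "m < 0"
  obtains u where "u \<ge> 0" "C = lattice u"
proof -
  have mult: "real n * x \<in> C" if "x \<in> C" for n x
    by (induction n) (use zero add that in \<open>auto simp: distrib_right\<close>)
  have neg: "- x \<in> C" if x: "x \<in> C" for x
  proof (cases "x = 0")
    case False
    define e where "e = (if x > 0 then m else p)"
    have e: "e \<in> C" "e \<noteq> 0" "e * x < 0"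
      using p m False by (auto simp: e_def mult_neg_pos mult_pos_neg)
    have "- x \<in> closure C"
      unfolding closure_approachable
    proof (intro allI impI)
      fix \<epsilon> :: real assume "\<epsilon> > 0"
      \<comment> \<open>The bound \<epsilon> is for the approximation. The bound by the modulus of
        \<open>x\<close> forces \<open>j > 0\<close>: otherwise \<open>j * e\<close> does not point
        against \<open>x\<close>, and \<open>n * x + j * e\<close> is at least as large as
        \<open>x\<close> in modulus.\<close>
      then obtain n :: nat and k :: int where n: "n > 0" and k: "\<bar>real n * x - of_int k * \<bar>e\<bar>\<bar> < min \<epsilon> \<bar>x\<bar>"
        using Dirichlet_multiple[of "\<bar>e\<bar>" "min \<epsilon> \<bar>x\<bar>" 0 x] e(2) False by (metis zero_less_abs_iff min_less_iff_conj)
      define j where "j = (if e > 0 then -k else k)"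
      have k': "\<bar>real n * x + of_int j * e\<bar> < min \<epsilon> \<bar>x\<bar>"
        using k e(2) by (auto simp: j_def abs_if split: if_splits)
      have "j > 0"
      proof (rule ccontr)
        assume "\<not> j > 0"
        then have "0 \<le> of_int j * e * x" using e(3)
          by (metis linorder_not_less mult.assoc mult_nonpos_nonpos of_int_le_0_iff order_less_imp_le)
        moreover have "real n * x * x \<ge> 1 * (x * x)" using n
          by (metis One_nat_def Suc_leI mult.assoc mult_right_mono of_nat_1 of_nat_le_iff zero_le_square)
        ultimately have "x * x \<le> (real n * x + of_int j * e) * x" by (simp add: algebra_simps)
        also have "\<dots> \<le> \<bar>real n * x + of_int j * e\<bar> * \<bar>x\<bar>" by (metis abs_ge_self abs_mult)
        also have "\<dots> < \<bar>x\<bar> * \<bar>x\<bar>" using k' False by (intro mult_strict_right_mono) auto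
        finally show False by (simp add: abs_mult_self)
      qed
      have "real (n - 1) * x + real (nat j) * e \<in> C" by (intro add mult x e)
      moreover have "real (n - 1) * x + real (nat j) * e = - x + (real n * x + of_int j * e)"
        using n \<open>j > 0\<close> by (simp add: of_nat_diff algebra_simps)
      ultimately show "\<exists>y\<in>C. dist y (- x) < \<epsilon>"
        using k' by (intro bexI[of _ "real (n - 1) * x + real (nat j) * e"]) (auto simp: dist_real_def)
    qed
    then show ?thesis using \<open>closed C\<close> by simp
  qed (use zero in simp)
  have int_mult: "of_int k * x \<in> C" if "x \<in> C" for k x
    using mult[OF that, of "nat k"] mult[OF neg[OF that], of "nat (- k)"] by (cases "k \<ge> 0") auto
  define P where "P = {x \<in> C. x > 0}"
  define g where "g = Inf P"
  have P: "P \<noteq> {}" "bdd_below P" using p by (auto simp: P_def intro: bdd_belowI[of _ 0])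
  have g: "g \<ge> 0" unfolding g_def using P by (intro cInf_greatest) (auto simp: P_def)
  show ?thesis
  proof (cases "g = 0")
    case True
    have "x \<in> closure C" for x
      unfolding closure_approachable
    proof (intro allI impI)
      fix \<epsilon> :: real assume "\<epsilon> > 0"
      then obtain y where y: "y \<in> P" "y < \<epsilon>"
        using cInf_lessD[of P \<epsilon>] P True by (auto simp: g_def)
      have "\<bar>of_int \<lfloor>x / y\<rfloor> * y - x\<bar> < y"
      proof -
        have "y > 0" using y by (simp add: P_def)
        have "of_int \<lfloor>x / y\<rfloor> * y \<le> x" "x < (of_int \<lfloor>x / y\<rfloor> + 1) * y"
          using \<open>y > 0\<close> floor_divide_lower floor_divide_upper by auto
        then show ?thesis by (simp add: algebra_simps)
      qed
      then show "\<exists>z\<in>C. dist z x < \<epsilon>"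
        using int_mult[of y "\<lfloor>x / y\<rfloor>"] y by (intro bexI[of _ "of_int \<lfloor>x / y\<rfloor> * y"]) (auto simp: P_def dist_real_def)
    qed
    then have "C = lattice 0" using \<open>closed C\<close> by (auto simp: lattice_def)
    then show ?thesis using that[of 0] by simp
  next
    case False
    then have gpos: "g > 0" using g by simp
    have "g \<in> closure P" unfolding g_def by (rule closure_contains_Inf) fact+
    moreover have "closure P \<subseteq> C" using \<open>closed C\<close> by (intro closure_minimal) (auto simp: P_def)
    ultimately have gC: "g \<in> C" by auto
    have "x \<in> lattice g" if "x \<in> C" for x
    proof -
      define r where "r = x - of_int \<lfloor>x / g\<rfloor> * g"
      have "of_int \<lfloor>x / g\<rfloor> * g \<le> x" "x < (of_int \<lfloor>x / g\<rfloor> + 1) * g"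
        using gpos floor_divide_lower floor_divide_upper by auto
      then have r: "r \<ge> 0" "r < g" by (auto simp: r_def algebra_simps)
      have "r \<in> C" using add[OF that int_mult[OF gC, of "- \<lfloor>x / g\<rfloor>"]] by (simp add: r_def)
      have "r = 0"
      proof (rule ccontr)
        assume "r \<noteq> 0"
        then have "r \<in> P" using r \<open>r \<in> C\<close> by (auto simp: P_def)
        then have "g \<le> r" unfolding g_def using P by (intro cInf_lower)
        then show False using r by simp
      qed
      then have "x = g * of_int \<lfloor>x / g\<rfloor>" by (simp add: r_def mult.commute)
      then show ?thesis using gpos unfolding lattice_def by auto
    qed
    moreover have "lattice g \<subseteq> C" using int_mult[OF gC] gpos by (auto simp: lattice_def mult.commute)
    ultimately have "C = lattice g" by auto
    then show ?thesis using that[of g] g by simp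
  qed
qed

lemma closure_additive_hull_lattice:
  fixes A :: "real set"
  assumes "p \<in> A" "p > 0" "m \<in> A" "m < 0"
  obtains u where "u \<ge> 0" "closure (additive_hull A) = lattice u"
proof (rule closed_additive_submonoid_is_lattice[of "closure (additive_hull A)" p m])
  have *: "A \<subseteq> closure (additive_hull A)"
    using additive_hull_superset closure_subset by blast
  then show "p \<in> closure (additive_hull A)" "m \<in> closure (additive_hull A)" using assms by auto
  show "0 \<in> closure (additive_hull A)" using closure_subset zero_in_additive_hull by blast
qed (use assms closure_additive_hull_add that in auto)

text \<open>Covers \<open>span_of\<close> and \<open>joint_span\<close> at once, with
  \<open>Q\<close> the condition that is maximised. A lattice containing \<open>A\<close> is closed
  under sums and limits, so it contains the generated lattice, and a larger lattice has a smaller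
  span.\<close>

lemma lattice_greatest:
  fixes A :: "real set"
  assumes u: "u \<ge> 0" "closure (additive_hull A) = lattice u" and Q: "\<And>v. v \<ge> 0 \<Longrightarrow> Q v \<longleftrightarrow> A \<subseteq> lattice v"
  shows "(GREATEST v. 0 \<le> v \<and> Q v) = u"
proof (rule Greatest_equality)
  have "A \<subseteq> lattice u"
    using additive_hull_superset[of A] closure_subset[of "additive_hull A"] u by blast
  then show "0 \<le> u \<and> Q u" using u Q by auto
next
  fix v assume v: "0 \<le> v \<and> Q v"
  then have "A \<subseteq> lattice v" using Q by auto
  then have "additive_hull A \<subseteq> lattice v"
    by (intro additive_hull_minimal) (auto intro: lattice_add)
  then have "lattice u \<subseteq> lattice v" using v u closure_minimal[of "additive_hull A" "lattice v"] by auto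
  then show "v \<le> u" using lattice_subset_imp_le u v by auto
qed

section \<open>Topological reachability\<close>

text \<open>\<open>hit \<alpha> A A' Z G x\<close>: the walk with increment supports \<open>A\<close>, \<open>A'\<close> reaches \<open>G\<close> from \<open>x\<close>. Since only
  neighbourhoods are charged, a step to \<open>x + y\<close> may land at any nearby point of \<open>Z\<close>.\<close>

inductive hit :: "real \<Rightarrow> real set \<Rightarrow> real set \<Rightarrow> real set \<Rightarrow> real set \<Rightarrow> real \<Rightarrow> bool"
  for \<alpha> A A' Z G where
  start: "x \<in> G \<Longrightarrow> hit \<alpha> A A' Z G x"
| up: "x > 0 \<or> x = 0 \<and> \<alpha> > 0 \<Longrightarrow> y \<in> A \<Longrightarrow> \<epsilon> > 0 \<Longrightarrow>
    (\<And>z. z \<in> Z \<Longrightarrow> \<bar>z - (x + y)\<bar> < \<epsilon> \<Longrightarrow> hit \<alpha> A A' Z G z) \<Longrightarrow> hit \<alpha> A A' Z G x"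
| down: "x < 0 \<or> x = 0 \<and> \<alpha> < 1 \<Longrightarrow> y \<in> A' \<Longrightarrow> \<epsilon> > 0 \<Longrightarrow>
    (\<And>z. z \<in> Z \<Longrightarrow> \<bar>z - (x + y)\<bar> < \<epsilon> \<Longrightarrow> hit \<alpha> A A' Z G z) \<Longrightarrow> hit \<alpha> A A' Z G x"

text \<open>Reflection at 0 exchanges the two laws and replaces \<alpha> by 1 - \<alpha>, so
  reachability results for the upper half-line yield those for the lower one.\<close>

lemma hit_reflect:
  assumes "hit \<alpha> A A' Z G x"
  shows "hit (1 - \<alpha>) (uminus ` A') (uminus ` A) (uminus ` Z) (uminus ` G) (- x)"
  using assms
proof induction
  case (start x)
  then show ?case by (intro hit.start) auto
next
  case (up x y \<epsilon>)
  show ?case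
  proof (rule hit.down[of _ _ "- y" _ \<epsilon>])
    fix z assume "z \<in> uminus ` Z" "\<bar>z - (- x + - y)\<bar> < \<epsilon>"
    then have "- z \<in> Z" "\<bar>- z - (x + y)\<bar> < \<epsilon>" by (auto simp: abs_if split: if_splits)
    from up(5)[OF this] show "hit (1 - \<alpha>) (uminus ` A') (uminus ` A) (uminus ` Z) (uminus ` G) z" by simp
  qed (use up in auto)
next
  case (down x y \<epsilon>)
  show ?case
  proof (rule hit.up[of _ _ "- y" _ \<epsilon>])
    fix z assume "z \<in> uminus ` Z" "\<bar>z - (- x + - y)\<bar> < \<epsilon>"
    then have "- z \<in> Z" "\<bar>- z - (x + y)\<bar> < \<epsilon>" by (auto simp: abs_if split: if_splits)
    from down(5)[OF this] show "hit (1 - \<alpha>) (uminus ` A') (uminus ` A) (uminus ` Z) (uminus ` G) z" by simp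
  qed (use down in auto)
qed

locale switching_supports =
  fixes \<alpha> d :: real and A A' :: "real set"
  assumes \<alpha>: "0 \<le> \<alpha>" "\<alpha> \<le> 1" and d: "0 \<le> d"
    and hull: "closure (additive_hull (A \<union> A')) = lattice d"
    and neg: "\<exists>y\<in>A. y < 0" and pos: "\<exists>y\<in>A'. y > 0"
begin

lemma supports_subset: "A \<union> A' \<subseteq> lattice d"
  using additive_hull_superset[of "A \<union> A'"] closure_subset[of "additive_hull (A \<union> A')"] hull by auto

lemma closure_hull_subset: "closure (additive_hull A) \<subseteq> lattice d"
  using supports_subset d by (intro closure_minimal additive_hull_minimal) (auto intro: lattice_add)

abbreviation hits where "hits G \<equiv> hit \<alpha> A A' (lattice d) G"

text \<open>With the increments in decreasing order the path first rises and then falls. A positive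
  final value therefore keeps all intermediate values positive, and the law with support
  \<open>A\<close> acts throughout.\<close>

lemma hits_up_list:
  assumes "x \<in> lattice d" "x > 0 \<or> x = 0 \<and> \<alpha> > 0" "set ys \<subseteq> A" "sorted_wrt (\<ge>) ys"
    "x + sum_list ys > 0 \<or> ys = []" "\<epsilon> > 0"
    "\<And>z. z \<in> lattice d \<Longrightarrow> \<bar>z - (x + sum_list ys)\<bar> < \<epsilon> \<Longrightarrow> hits G z"
  shows "hits G x"
  using assms
proof (induction ys arbitrary: x \<epsilon>)
  case Nil
  then show ?case by simp
next
  case (Cons y ys)
  have "x + y > 0"
  proof (cases "y > 0")
    case True
    then show ?thesis using Cons.prems(2) by auto
  next
    case False
    then have "sum_list ys \<le> 0"
      using Cons.prems(4) by (intro sum_list_nonpos) fastforce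
    then show ?thesis using Cons.prems(5) by simp
  qed
  \<comment> \<open>Half of \<epsilon> is kept for the remaining increments; the other two terms
    keep the perturbed landing point and the perturbed final value positive.\<close>
  define \<delta> where "\<delta> = min (\<epsilon> / 2) (min (x + y) (x + y + sum_list ys))"
  have \<delta>: "\<delta> > 0" "\<delta> \<le> \<epsilon> / 2" "\<delta> \<le> x + y" "\<delta> \<le> x + y + sum_list ys"
    using \<open>x + y > 0\<close> Cons.prems(5,6) unfolding \<delta>_def by (auto simp: min_def)
  show ?case
  proof (rule hit.up[of _ _ y _ \<delta>])
    fix z assume z: "z \<in> lattice d" "\<bar>z - (x + y)\<bar> < \<delta>"
    show "hits G z"
    proof (rule Cons.IH[of _ "\<epsilon> / 2"])
      fix u assume "u \<in> lattice d" "\<bar>u - (z + sum_list ys)\<bar> < \<epsilon> / 2"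
      then have "\<bar>u - (x + (y + sum_list ys))\<bar> < \<epsilon>" using z \<delta> by linarith
      then show "hits G u" using \<open>u \<in> lattice d\<close> by (intro Cons.prems(7)) auto
    qed (use z \<delta> Cons.prems in auto)
  qed (use \<delta> Cons.prems in auto)
qed

end

lemma uminus_image_lattice [simp]: "uminus ` lattice d = lattice d"
proof -
  have "x \<in> uminus ` lattice d" if "x \<in> lattice d" for x
    using that by (intro image_eqI[of _ _ "-x"]) auto
  then show ?thesis by auto
qed

lemma uminus_image_eqI:
  fixes A B :: "'a::group_add set"
  assumes "uminus ` A \<subseteq> B" "uminus ` B \<subseteq> A"
  shows "B = uminus ` A"
proof
  show "B \<subseteq> uminus ` A"
  proof
    fix b assume "b \<in> B"
    then have "- b \<in> A" using assms(2) by blast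
    then show "b \<in> uminus ` A" by (metis imageI minus_minus)
  qed
qed fact

lemma additive_hull_uminus:
  fixes A :: "'a::ab_group_add set"
  shows "additive_hull (uminus ` A) = uminus ` additive_hull A"
proof -
  have *: "uminus ` additive_hull B \<subseteq> additive_hull (uminus ` B)" for B :: "'a set"
  proof
    fix x assume "x \<in> uminus ` additive_hull B"
    then obtain ys where ys: "set ys \<subseteq> B" "x = - sum_list ys" by (auto simp: additive_hull_def)
    then have "x = sum_list (map uminus ys)" using uminus_sum_list_map[of id ys] by simp
    with ys show "x \<in> additive_hull (uminus ` B)" by (fastforce simp: additive_hull_def intro!: exI[of _ "map uminus ys"])
  qed
  show ?thesis using *[of A] *[of "uminus ` A"] by (intro uminus_image_eqI) (simp_all add: image_image)
qed

lemma closure_additive_hull_uminus: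
  fixes A :: "real set"
  shows "closure (additive_hull (uminus ` A)) = uminus ` closure (additive_hull A)"
  using closure_injective_linear_image[of uminus "additive_hull A"]
  by (simp add: additive_hull_uminus linear_uminus)

lemma uminus_image_plus: "uminus ` (A + B) = uminus ` A + uminus ` (B :: 'a::ab_group_add set)"
proof
  show "uminus ` (A + B) \<subseteq> uminus ` A + uminus ` B"
  proof
    fix x assume "x \<in> uminus ` (A + B)"
    then obtain a b where "a \<in> A" "b \<in> B" "x = - a + - b" by (auto elim!: set_plus_elim)
    then show "x \<in> uminus ` A + uminus ` B" by (auto simp only: intro!: set_plus_intro imageI)
  qed
  show "uminus ` A + uminus ` B \<subseteq> uminus ` (A + B)"
  proof
    fix x assume "x \<in> uminus ` A + uminus ` B"
    then obtain a b where "a \<in> A" "b \<in> B" "x = - a + - b" by (auto elim!: set_plus_elim)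
    then show "x \<in> uminus ` (A + B)" by (intro image_eqI[of _ _ "a + b"]) auto
  qed
qed

lemma switching_supports_reflect:
  assumes "switching_supports \<alpha> d A A'"
  shows "switching_supports (1 - \<alpha>) d (uminus ` A') (uminus ` A)"
proof -
  interpret switching_supports \<alpha> d A A' by fact
  have "closure (additive_hull (uminus ` A' \<union> uminus ` A)) = lattice d"
    by (simp add: image_Un[symmetric] Un_commute closure_additive_hull_uminus hull)
  then show ?thesis using \<alpha> d neg pos by unfold_locales auto
qed

section \<open>Rotation modulo m + q\<close>

locale switching_cycle = switching_supports +
  fixes m q :: real and G :: "real set"
  assumes mq: "m > 0" "q > 0" "- m \<in> A" "q \<in> A'"
begin

text \<open>Modulo \<open>m + q\<close> the steps \<open>- m\<close> (upwards of \<open>0\<close>) and \<open>q\<close> (downwards of \<open>0\<close>) are the same rotation, so the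
  discontinuity of the kernel at \<open>0\<close> disappears.\<close>

definition near :: "real \<Rightarrow> real \<Rightarrow> real \<Rightarrow> bool" where
  "near c \<epsilon> u \<longleftrightarrow> (\<exists>k::int. \<bar>u - c - of_int k * (m + q)\<bar> < \<epsilon>)"

text \<open>The height of \<open>u\<close> is left free: every state close to the residue of
  \<open>c\<close> must reach \<open>G\<close>, however far from 0 it lies.\<close>

definition class_hits :: "real \<Rightarrow> real \<Rightarrow> bool" where
  "class_hits c \<epsilon> \<longleftrightarrow> (\<forall>u\<in>lattice d. near c \<epsilon> u \<longrightarrow> hits G u)"

text \<open>The strict inequality leaves a slack that absorbs the error of one step, so \<epsilon>
  need not shrink from step to step. The free multiple \<open>k\<close> makes the default moves
  \<open>- m\<close> and \<open>q\<close> two instances of one statement.\<close>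

lemma near_perturb:
  assumes "near c \<epsilon> u"
  obtains \<delta> where "\<delta> > 0" "\<delta> \<le> \<epsilon>" "\<And>z y (k::int). \<bar>z - (u + y)\<bar> < \<delta> \<Longrightarrow> near (c + y + of_int k * (m + q)) \<epsilon> z"
proof -
  from assms obtain k :: int where k: "\<bar>u - c - of_int k * (m + q)\<bar> < \<epsilon>" by (auto simp: near_def)
  show ?thesis
  proof (rule that[of "\<epsilon> - \<bar>u - c - of_int k * (m + q)\<bar>"])
    fix z y and l :: int assume z: "\<bar>z - (u + y)\<bar> < \<epsilon> - \<bar>u - c - of_int k * (m + q)\<bar>"
    have "z - (c + y + of_int l * (m + q)) - of_int (k - l) * (m + q)
        = (z - (u + y)) + (u - c - of_int k * (m + q))" by (simp add: algebra_simps)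
    then show "near (c + y + of_int l * (m + q)) \<epsilon> z" unfolding near_def
      using z by (intro exI[of _ "k - l"]) linarith
  qed (use k in auto)
qed

lemma near_up:
  assumes "near (c - y) \<epsilon> u"
  obtains \<delta> where "\<delta> > 0" "\<delta> \<le> \<epsilon>" "\<And>z. \<bar>z - (u + y)\<bar> < \<delta> \<Longrightarrow> near c \<epsilon> z"
proof -
  obtain \<delta> where \<delta>: "\<delta> > 0" "\<delta> \<le> \<epsilon>"
    "\<And>z y' (k::int). \<bar>z - (u + y')\<bar> < \<delta> \<Longrightarrow> near (c - y + y' + of_int k * (m + q)) \<epsilon> z"
    using near_perturb[OF assms] by blast
  then show ?thesis using \<delta>(3)[of _ y 0] by (intro that[of \<delta>]) auto
qed

lemma near_rotate:
  assumes "near (c + m) \<epsilon> u"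
  obtains \<delta> where "\<delta> > 0" "\<delta> \<le> \<epsilon>" "\<And>z. \<bar>z - (u + - m)\<bar> < \<delta> \<Longrightarrow> near c \<epsilon> z"
    "\<And>z. \<bar>z - (u + q)\<bar> < \<delta> \<Longrightarrow> near c \<epsilon> z"
proof -
  obtain \<delta> where \<delta>: "\<delta> > 0" "\<delta> \<le> \<epsilon>"
    "\<And>z y (k::int). \<bar>z - (u + y)\<bar> < \<delta> \<Longrightarrow> near (c + m + y + of_int k * (m + q)) \<epsilon> z"
    using near_perturb[OF assms] by blast
  then show ?thesis using \<delta>(3)[of _ "-m" 0] \<delta>(3)[of _ q "-1"] by (intro that[of \<delta>]) auto
qed

lemma upper_or_lower: "((x::real) > 0 \<or> x = 0 \<and> \<alpha> > 0) \<or> (x < 0 \<or> x = 0 \<and> \<alpha> < 1)"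
  by (cases "\<alpha> > 0") auto

text \<open>A default move, whichever side of 0 it starts from, takes the class of
  \<open>c + m\<close> to that of \<open>c\<close>; hitting passes in the opposite
  direction.\<close>

lemma class_hits_rotate_back: "class_hits c \<epsilon> \<Longrightarrow> class_hits (c + real j * m) \<epsilon>"
proof (induction j)
  case (Suc j)
  show ?case unfolding class_hits_def
  proof (intro ballI impI)
    fix u assume u: "u \<in> lattice d" "near (c + real (Suc j) * m) \<epsilon> u"
    then have "near (c + real j * m + m) \<epsilon> u" by (simp add: algebra_simps)
    then obtain \<delta> where \<delta>: "\<delta> > 0" "\<And>z. \<bar>z - (u + - m)\<bar> < \<delta> \<Longrightarrow> near (c + real j * m) \<epsilon> z"
      "\<And>z. \<bar>z - (u + q)\<bar> < \<delta> \<Longrightarrow> near (c + real j * m) \<epsilon> z"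
      using near_rotate by metis
    from upper_or_lower[of u] show "hits G u"
    proof
      assume "u > 0 \<or> u = 0 \<and> \<alpha> > 0"
      then show ?thesis using \<delta> Suc mq by (intro hit.up[of u _ "-m" _ \<delta>]) (auto simp: class_hits_def)
    next
      assume "u < 0 \<or> u = 0 \<and> \<alpha> < 1"
      then show ?thesis using \<delta> Suc mq by (intro hit.down[of u _ q _ \<delta>]) (auto simp: class_hits_def)
    qed
  qed
qed simp

text \<open>For negative \<open>j\<close> recurrence replaces the missing inverse rotation: after a
  near-return time \<open>N\<close>, the class of \<open>c - n m\<close> is also that of
  \<open>c + (N - n) m\<close>, up to a small error.\<close>

lemma class_hits_rotate:
  assumes "class_hits c \<epsilon>"
  shows "class_hits (c + of_int j * m) \<epsilon>"
proof (cases "j \<ge> 0")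
  case True
  then show ?thesis using class_hits_rotate_back[OF assms, of "nat j"] by simp
next
  case False
  define n where "n = nat (- j)"
  have j: "of_int j = - real n" using False by (simp add: n_def)
  show ?thesis unfolding class_hits_def
  proof (intro ballI impI)
    fix u assume u: "u \<in> lattice d" "near (c + of_int j * m) \<epsilon> u"
    then obtain k1 :: int where k1: "\<bar>u - (c + of_int j * m) - of_int k1 * (m + q)\<bar> < \<epsilon>"
      by (auto simp: near_def)
    \<comment> \<open>The return may cost only the slack that this particular \<open>u\<close> has
      left, which keeps the total error below \<epsilon>; \<open>N\<close> depends on
      \<open>u\<close>, which is harmless.\<close>
    obtain N :: nat and k :: int where Nk: "N \<ge> n"
      "\<bar>real N * m - of_int k * (m + q)\<bar> < \<epsilon> - \<bar>u - (c + of_int j * m) - of_int k1 * (m + q)\<bar>"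
      using Dirichlet_multiple[of "m + q" "\<epsilon> - \<bar>u - (c + of_int j * m) - of_int k1 * (m + q)\<bar>" n m] mq k1
      by (metis add_pos_pos diff_gt_0_iff_gt)
    have "u - (c + real (N - n) * m) - of_int (k1 - k) * (m + q) =
      (u - (c + of_int j * m) - of_int k1 * (m + q)) - (real N * m - of_int k * (m + q))"
      using Nk(1) by (simp add: j of_nat_diff algebra_simps)
    then have "near (c + real (N - n) * m) \<epsilon> u"
      unfolding near_def using Nk(2) by (intro exI[of _ "k1 - k"]) linarith
    then show "hits G u" using class_hits_rotate_back[OF assms] u unfolding class_hits_def by blast
  qed
qed

text \<open>Above 0 a state simply takes the increment \<open>y\<close>. Below 0 it first climbs by
  default moves; these rotate its residue by multiples of \<open>m\<close>, which does no harm
  because all rotated classes hit as well.\<close>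

lemma class_hits_upper:
  assumes T: "class_hits c \<epsilon>" and y: "y \<in> A"
  shows "class_hits (c - y) \<epsilon>"
proof -
  \<comment> \<open>\<open>j\<close> records the rotation accumulated so far, and \<open>n\<close>
    bounds the climbing: moves with error below \<open>q / 2\<close> gain at least
    \<open>q / 2\<close> each.\<close>
  have *: "hits G u" if "u \<in> lattice d" "u > - real n * q / 2" "near (c - y + of_int j * m) \<epsilon> u" for n j u
    using that
  proof (induction n arbitrary: u j)
    case 0
    then have "near (c + of_int j * m - y) \<epsilon> u" by (simp add: algebra_simps)
    then obtain \<delta> where "\<delta> > 0" "\<And>z. \<bar>z - (u + y)\<bar> < \<delta> \<Longrightarrow> near (c + of_int j * m) \<epsilon> z"
      using near_up by metis
    then show ?case using 0 y class_hits_rotate[OF T]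
      by (intro hit.up[of u _ y _ \<delta>]) (auto simp: class_hits_def)
  next
    case (Suc n)
    from upper_or_lower[of u] show ?case
    proof
      assume u: "u > 0 \<or> u = 0 \<and> \<alpha> > 0"
      have "near (c + of_int j * m - y) \<epsilon> u" using Suc by (simp add: algebra_simps)
      then obtain \<delta> where "\<delta> > 0" "\<And>z. \<bar>z - (u + y)\<bar> < \<delta> \<Longrightarrow> near (c + of_int j * m) \<epsilon> z"
        using near_up by metis
      then show ?case using u y class_hits_rotate[OF T]
        by (intro hit.up[of u _ y _ \<delta>]) (auto simp: class_hits_def)
    next
      assume u: "u < 0 \<or> u = 0 \<and> \<alpha> < 1"
      have "near (c - y + of_int (j - 1) * m + m) \<epsilon> u" using Suc by (simp add: algebra_simps)
      then obtain \<delta> where \<delta>: "\<delta> > 0" "\<And>z. \<bar>z - (u + q)\<bar> < \<delta> \<Longrightarrow> near (c - y + of_int (j - 1) * m) \<epsilon> z"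
        using near_rotate by metis
      show ?case
      proof (rule hit.down[of u _ q _ "min \<delta> (q / 2)"])
        fix z assume z: "z \<in> lattice d" "\<bar>z - (u + q)\<bar> < min \<delta> (q / 2)"
        have "- real n * q / 2 < z" using z(2) Suc.prems(2) by (auto simp: field_simps abs_if split: if_splits)
        then show "hits G z" using z \<delta>(2) by (intro Suc.IH[of z "j - 1"]) auto
      qed (use u \<delta> mq in auto)
    qed
  qed
  show ?thesis unfolding class_hits_def
  proof (intro ballI impI)
    fix u assume u: "u \<in> lattice d" "near (c - y) \<epsilon> u"
    obtain n :: nat where "real n > 2 * \<bar>u\<bar> / q" using reals_Archimedean2 by auto
    then have "- real n * q / 2 < u" using mq by (auto simp: field_simps abs_if split: if_splits)
    then show "hits G u" using *[of u n 0] u by simp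
  qed
qed

text \<open>Mirror image of \<open>class_hits_upper\<close>: a state above 0 first descends by steps
  \<open>- m\<close>, losing at least \<open>m / 2\<close> each time.\<close>

lemma class_hits_lower:
  assumes T: "class_hits c \<epsilon>" and y: "y \<in> A'"
  shows "class_hits (c - y) \<epsilon>"
proof -
  have *: "hits G u" if "u \<in> lattice d" "u < real n * m / 2" "near (c - y + of_int j * m) \<epsilon> u" for n j u
    using that
  proof (induction n arbitrary: u j)
    case 0
    then have "near (c + of_int j * m - y) \<epsilon> u" by (simp add: algebra_simps)
    then obtain \<delta> where "\<delta> > 0" "\<And>z. \<bar>z - (u + y)\<bar> < \<delta> \<Longrightarrow> near (c + of_int j * m) \<epsilon> z"
      using near_up by metis
    then show ?case using 0 y class_hits_rotate[OF T]
      by (intro hit.down[of u _ y _ \<delta>]) (auto simp: class_hits_def)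
  next
    case (Suc n)
    from upper_or_lower[of u] show ?case
    proof
      assume u: "u < 0 \<or> u = 0 \<and> \<alpha> < 1"
      have "near (c + of_int j * m - y) \<epsilon> u" using Suc by (simp add: algebra_simps)
      then obtain \<delta> where "\<delta> > 0" "\<And>z. \<bar>z - (u + y)\<bar> < \<delta> \<Longrightarrow> near (c + of_int j * m) \<epsilon> z"
        using near_up by metis
      then show ?case using u y class_hits_rotate[OF T]
        by (intro hit.down[of u _ y _ \<delta>]) (auto simp: class_hits_def)
    next
      assume u: "u > 0 \<or> u = 0 \<and> \<alpha> > 0"
      have "near (c - y + of_int (j - 1) * m + m) \<epsilon> u" using Suc by (simp add: algebra_simps)
      then obtain \<delta> where \<delta>: "\<delta> > 0" "\<And>z. \<bar>z - (u + - m)\<bar> < \<delta> \<Longrightarrow> near (c - y + of_int (j - 1) * m) \<epsilon> z"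
        using near_rotate by metis
      show ?case
      proof (rule hit.up[of u _ "- m" _ "min \<delta> (m / 2)"])
        fix z assume z: "z \<in> lattice d" "\<bar>z - (u + - m)\<bar> < min \<delta> (m / 2)"
        have "z < real n * m / 2" using z(2) Suc.prems(2) by (auto simp: field_simps abs_if split: if_splits)
        then show "hits G z" using z \<delta>(2) by (intro Suc.IH[of z "j - 1"]) auto
      qed (use u \<delta> mq in auto)
    qed
  qed
  show ?thesis unfolding class_hits_def
  proof (intro ballI impI)
    fix u assume u: "u \<in> lattice d" "near (c - y) \<epsilon> u"
    obtain n :: nat where "real n > 2 * \<bar>u\<bar> / m" using reals_Archimedean2 by auto
    then have "u < real n * m / 2" using mq by (auto simp: field_simps abs_if split: if_splits)
    then show "hits G u" using *[of u n 0] u by simp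
  qed
qed

lemma class_hits_list: "class_hits c \<epsilon> \<Longrightarrow> set ys \<subseteq> A \<union> A' \<Longrightarrow> class_hits (c - sum_list ys) \<epsilon>"
proof (induction ys arbitrary: c)
  case (Cons y ys)
  then have "class_hits (c - y) \<epsilon>" using class_hits_upper class_hits_lower by auto
  then show ?case using Cons.IH[of "c - y"] Cons.prems by (simp add: algebra_simps)
qed simp

text \<open>From any height the default moves lead into the window, and there a state close to the
  class of \<open>w\<close> is close to \<open>w\<close> itself. So the class of \<open>w\<close>
  hits; since \<open>w - z\<close> is approximated by sums of increments,
  \<open>class_hits_list\<close> carries this over to the class of \<open>z\<close>.\<close>

lemma class_hits_window:
  assumes w: "w \<in> lattice d" "- m < w" "w < q"
    and "\<epsilon>0 > 0" and near_w: "\<And>u. u \<in> lattice d \<Longrightarrow> \<bar>u - w\<bar> < \<epsilon>0 \<Longrightarrow> hits G u"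
    and z: "z \<in> lattice d"
  shows "hits G z"
proof -
  \<comment> \<open>With margin \<open>2 * \<epsilon>\<close> at both ends, the representative of
    the class of \<open>w\<close> is unique even in the window enlarged by \<epsilon>.\<close>
  define \<epsilon> where "\<epsilon> = Min {\<epsilon>0, (w + m) / 2, (q - w) / 2}"
  have \<epsilon>: "\<epsilon> > 0" "\<epsilon> \<le> \<epsilon>0" "2 * \<epsilon> \<le> w + m" "2 * \<epsilon> \<le> q - w"
    using w assms(4) by (auto simp: \<epsilon>_def min_def)
  \<comment> \<open>\<open>n\<close> counts the default moves still to be made. A move from above 0
    lowers the upper bound by \<open>m\<close> and cannot pass below
    \<open>- m - \<epsilon>\<close>; a move from below 0 acts symmetrically. After \<open>n\<close>
    moves the state is in the enlarged window.\<close>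
  have window: "hits G u"
    if "u \<in> lattice d" "near (w + real n * m) \<epsilon> u" "- m - \<epsilon> - real n * q < u" "u < q + \<epsilon> + real n * m" for n u
    using that
  proof (induction n arbitrary: u)
    case 0
    then obtain k :: int where k: "\<bar>u - w - of_int k * (m + q)\<bar> < \<epsilon>" by (auto simp: near_def)
    have u: "- m - \<epsilon> < u" "u < q + \<epsilon>" using 0 by auto
    define K :: real where "K = of_int k * (m + q)"
    have K: "\<bar>u - w - K\<bar> < \<epsilon>" using k by (simp add: K_def)
    have "k = 0"
    proof (rule ccontr)
      assume "k \<noteq> 0"
      then consider "k \<ge> 1" | "k \<le> -1" by linarith
      then show False
      proof cases
        case 1
        then have "1 * (m + q) \<le> K" unfolding K_def using mq by (intro mult_right_mono) auto
        then have "m + q \<le> K" by simp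
        moreover have "w + K < u + \<epsilon>" using K by (simp add: abs_less_iff)
        ultimately show False using \<epsilon>(3) u(2) by linarith
      next
        case 2
        then have "K \<le> (-1) * (m + q)" unfolding K_def using mq by (intro mult_right_mono) linarith+
        then have "K \<le> - (m + q)" by simp
        moreover have "u < w + K + \<epsilon>" using K by (simp add: abs_less_iff)
        ultimately show False using \<epsilon>(4) u(1) by linarith
      qed
    qed
    then show ?case using k \<epsilon> 0 by (intro near_w) auto
  next
    case (Suc n)
    have "near (w + real n * m + m) \<epsilon> u" using Suc by (simp add: algebra_simps)
    then obtain \<delta> where \<delta>: "\<delta> > 0" "\<delta> \<le> \<epsilon>" "\<And>z. \<bar>z - (u + - m)\<bar> < \<delta> \<Longrightarrow> near (w + real n * m) \<epsilon> z"
       "\<And>z. \<bar>z - (u + q)\<bar> < \<delta> \<Longrightarrow> near (w + real n * m) \<epsilon> z"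
      using near_rotate by metis
    have nn: "0 \<le> real n * m" "0 \<le> real n * q" using mq by auto
    from upper_or_lower[of u] show ?case
    proof
      assume u: "u > 0 \<or> u = 0 \<and> \<alpha> > 0"
      define \<delta>' where "\<delta>' = min \<delta> (q + \<epsilon> + real (Suc n) * m - u)"
      have \<delta>': "\<delta>' > 0" "\<delta>' \<le> \<delta>" "\<delta>' \<le> q + \<epsilon> + real (Suc n) * m - u" using \<delta> Suc.prems by (auto simp: \<delta>'_def)
      show ?case
      proof (rule hit.up[of u _ "- m" _ \<delta>'])
        fix z assume z: "z \<in> lattice d" "\<bar>z - (u + - m)\<bar> < \<delta>'"
        have "- m - \<epsilon> - real n * q < z" "z < q + \<epsilon> + real n * m"
          using z(2) \<delta>' \<delta>(2) u nn by (auto simp: algebra_simps abs_if split: if_splits)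
        then show "hits G z" using z \<delta>(3) \<delta>' by (intro Suc.IH) auto
      qed (use u \<delta>' mq in auto)
    next
      assume u: "u < 0 \<or> u = 0 \<and> \<alpha> < 1"
      define \<delta>' where "\<delta>' = min \<delta> (u + m + \<epsilon> + real (Suc n) * q)"
      have \<delta>': "\<delta>' > 0" "\<delta>' \<le> \<delta>" "\<delta>' \<le> u + m + \<epsilon> + real (Suc n) * q" using \<delta> Suc.prems by (auto simp: \<delta>'_def)
      show ?case
      proof (rule hit.down[of u _ q _ \<delta>'])
        fix z assume z: "z \<in> lattice d" "\<bar>z - (u + q)\<bar> < \<delta>'"
        have "- m - \<epsilon> - real n * q < z" "z < q + \<epsilon> + real n * m"
          using z(2) \<delta>' \<delta>(2) u nn by (auto simp: algebra_simps abs_if split: if_splits)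
        then show "hits G z" using z \<delta>(4) \<delta>' by (intro Suc.IH) auto
      qed (use u \<delta>' mq in auto)
    qed
  qed
  have "class_hits w (\<epsilon> / 2)"
    unfolding class_hits_def
  proof (intro ballI impI)
    fix u assume u: "u \<in> lattice d" "near w (\<epsilon> / 2) u"
    then obtain k1 :: int where k1: "\<bar>u - w - of_int k1 * (m + q)\<bar> < \<epsilon> / 2" by (auto simp: near_def)
    \<comment> \<open>\<open>N\<close> has two duties: it must be large enough that \<open>u\<close>
      lies within reach of the window in \<open>N\<close> moves, and it must be a near-return so
      that the class of \<open>u\<close> is that of \<open>w + N * m\<close>.\<close>
    obtain N0 :: nat where N0: "real N0 > max (\<bar>u\<bar> / m) (\<bar>u\<bar> / q)" using reals_Archimedean2 by blast
    obtain N :: nat and k :: int where Nk: "N \<ge> N0" "\<bar>real N * m - of_int k * (m + q)\<bar> < \<epsilon> / 2"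
      using Dirichlet_multiple[of "m + q" "\<epsilon> / 2" N0 m] mq \<epsilon> by (metis add_pos_pos half_gt_zero)
    have "real N > \<bar>u\<bar> / m" "real N > \<bar>u\<bar> / q" using N0 Nk(1) by auto
    then have "\<bar>u\<bar> < real N * m" "\<bar>u\<bar> < real N * q" using mq by (auto simp: field_simps)
    moreover have "near (w + real N * m) \<epsilon> u"
      unfolding near_def
    proof (intro exI[of _ "k1 - k"])
      have "u - (w + real N * m) - of_int (k1 - k) * (m + q) =
        (u - w - of_int k1 * (m + q)) - (real N * m - of_int k * (m + q))" by (simp add: algebra_simps)
      then show "\<bar>u - (w + real N * m) - of_int (k1 - k) * (m + q)\<bar> < \<epsilon>" using k1 Nk(2) by linarith
    qed
    ultimately show "hits G u" using u mq \<epsilon> by (intro window[of u N]) auto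
  qed
  \<comment> \<open>The error \<open>\<epsilon> / 2\<close> of this approximation is exactly the
    tolerance of \<open>class_hits\<close>, so \<open>z\<close> belongs to the class of
    \<open>w - v\<close>.\<close>
  moreover have "w - z \<in> closure (additive_hull (A \<union> A'))" using hull w z lattice_diff by auto
  then obtain v where v: "v \<in> additive_hull (A \<union> A')" "dist v (w - z) < \<epsilon> / 2"
    using \<epsilon> by (metis closure_approachable half_gt_zero)
  then obtain ys where ys: "set ys \<subseteq> A \<union> A'" "v = sum_list ys" by (auto simp: additive_hull_def)
  ultimately have "class_hits (w - v) (\<epsilon> / 2)" using class_hits_list by blast
  moreover have "near (w - v) (\<epsilon> / 2) z" unfolding near_def
    using v(2) by (intro exI[of _ 0]) (auto simp: dist_real_def abs_if split: if_splits)
  ultimately show ?thesis using z by (auto simp: class_hits_def)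
qed

end

lemma (in switching_supports) hits_from_window:
  assumes "y \<in> A" "y < 0" "q \<in> A'" "q > 0" "w \<in> lattice d" "y < w" "w < q" "\<epsilon> > 0"
    "\<And>u. u \<in> lattice d \<Longrightarrow> \<bar>u - w\<bar> < \<epsilon> \<Longrightarrow> hits G u" "z \<in> lattice d"
  shows "hits G z"
proof -
  interpret switching_cycle \<alpha> d A A' "- y" q G
    using assms by unfold_locales auto
  show ?thesis
    by (rule class_hits_window[of w \<epsilon>]) (use assms(5-8,10) in simp_all, rule assms(9))
qed

text \<open>The support of \<open>\<nu>\<close> restricted to the upper half-line. The two cases differ because the endpoints \<open>0\<close> and
  \<open>max A'\<close> are atoms of the Haar measure only in the lattice case.\<close>

definition overshoot_range :: "real \<Rightarrow> real \<Rightarrow> real set \<Rightarrow> real set" where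
  "overshoot_range \<alpha> d A' = (if d = 0 then {t. 0 \<le> t \<and> (\<forall>\<epsilon>>0. \<exists>q\<in>A'. t < q + \<epsilon>)}
     else {t \<in> lattice d. 0 < t \<and> ((\<exists>q\<in>A'. t < q) \<or> \<alpha> < 1 \<and> t \<in> A') \<or> t = 0 \<and> \<alpha> > 0})"

text \<open>The future support of \<open>U_plus\<close> when \<open>A\<close> has a negative
  element. Without positive increments there is no strict ascending ladder height, and only the atom
  at 0 remains.\<close>

definition renewal_range :: "real set \<Rightarrow> real set" where
  "renewal_range A = (if \<exists>y\<in>A. y > 0 then closure (additive_hull A) \<inter> {0..} else {0})"

definition upper_range :: "real \<Rightarrow> real \<Rightarrow> real set \<Rightarrow> real set \<Rightarrow> real set" where
  "upper_range \<alpha> d A A' = overshoot_range \<alpha> d A' + renewal_range A"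

text \<open>Written as a reflection rather than with inequalities reversed, so that results on
  \<open>upper_range\<close> transfer without a second proof.\<close>

definition lower_range :: "real \<Rightarrow> real \<Rightarrow> real set \<Rightarrow> real set \<Rightarrow> real set" where
  "lower_range \<alpha> d A A' = uminus ` upper_range (1 - \<alpha>) d (uminus ` A') (uminus ` A)"

definition full_range :: "real \<Rightarrow> real \<Rightarrow> real set \<Rightarrow> real set \<Rightarrow> real set" where
  "full_range \<alpha> d A A' = upper_range \<alpha> d A A' \<union> lower_range \<alpha> d A A'"

section \<open>Elementary properties and closedness of the candidate support\<close>

lemma full_range_reflect:
  "full_range (1 - \<alpha>) d (uminus ` A') (uminus ` A) = uminus ` full_range \<alpha> d A A'"
  by (auto simp: full_range_def lower_range_def image_Un image_image)

lemma renewal_range_hull: "renewal_range A \<subseteq> closure (additive_hull A)"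
  using closure_subset[of "additive_hull A"] by (auto simp: renewal_range_def)

lemma zero_renewal_range [simp]: "0 \<in> renewal_range A"
  using closure_subset[of "additive_hull A"] by (auto simp: renewal_range_def)

lemma renewal_range_nonneg: "v \<in> renewal_range A \<Longrightarrow> v \<ge> 0"
  by (auto simp: renewal_range_def split: if_splits)

lemma overshoot_range_nonneg: "t \<in> overshoot_range \<alpha> d A' \<Longrightarrow> t \<ge> 0"
  by (auto simp: overshoot_range_def split: if_splits)

lemma overshoot_rangeD: "t \<in> overshoot_range \<alpha> 0 A' \<Longrightarrow> \<epsilon> > 0 \<Longrightarrow> \<exists>q\<in>A'. t < q + \<epsilon>"
  by (simp add: overshoot_range_def)

lemma overshoot_range_lattice: "overshoot_range \<alpha> d A' \<subseteq> lattice d"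
  by (auto simp: overshoot_range_def lattice_def)

lemma upper_range_nonneg: "x \<in> upper_range \<alpha> d A A' \<Longrightarrow> x \<ge> 0"
  unfolding upper_range_def by (auto elim!: set_plus_elim intro!: add_nonneg_nonneg intro: renewal_range_nonneg overshoot_range_nonneg)

lemma overshoot_subset_upper: "overshoot_range \<alpha> d A' \<subseteq> upper_range \<alpha> d A A'"
  unfolding upper_range_def using set_plus_intro[of _ "overshoot_range \<alpha> d A'" 0 "renewal_range A"] by auto

lemma overshoot_range_downward:
  assumes "t \<in> overshoot_range \<alpha> d A'" "0 < s" "s < t" "s \<in> lattice d"
  shows "s \<in> overshoot_range \<alpha> d A'"
  using assms by (auto simp: overshoot_range_def split: if_splits) (meson less_trans)+

text \<open>Sums of closed sets need not be closed. Here nonnegativity confines the summands of any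
  point below \<open>x + 1\<close> to the compact interval from 0 to \<open>x + 1\<close>. This
  removes the closure from the support of a convolution.\<close>

lemma closed_Plus_nonneg:
  fixes S T :: "real set"
  assumes "closed S" "closed T" and S: "\<And>x. x \<in> S \<Longrightarrow> x \<ge> 0" and T: "\<And>x. x \<in> T \<Longrightarrow> x \<ge> 0"
  shows "closed (S + T)"
proof -
  have "x \<in> S + T" if "x \<in> closure (S + T)" for x
  proof -
    define S' where "S' = S \<inter> {0..x + 1}"
    define T' where "T' = T \<inter> {0..x + 1}"
    have "compact S'" "compact T'"
      unfolding S'_def T'_def using assms by (auto intro: closed_Int_compact)
    then have "closed {a + b | a b. a \<in> S' \<and> b \<in> T'}"
      by (intro compact_imp_closed compact_sums)
    moreover have "{a + b | a b. a \<in> S' \<and> b \<in> T'} = S' + T'" by (auto simp: set_plus_def)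
    ultimately have cl: "closed (S' + T')" by simp
    have "x \<in> {..<x + 1} \<inter> closure (S + T)" using that by simp
    also have "\<dots> \<subseteq> closure ({..<x + 1} \<inter> (S + T))" by (intro open_Int_closure_subset) simp
    also have "\<dots> \<subseteq> closure (S' + T')"
    proof (intro closure_mono subsetI)
      fix y assume "y \<in> {..<x + 1} \<inter> (S + T)"
      then obtain a b where ab: "a \<in> S" "b \<in> T" "y = a + b" "y < x + 1" by (auto elim: set_plus_elim)
      then have "a \<in> S'" "b \<in> T'" using S[of a] T[of b] by (auto simp: S'_def T'_def)
      then show "y \<in> S' + T'" using ab by auto
    qed
    also have "\<dots> = S' + T'" using cl by simp
    also have "\<dots> \<subseteq> S + T" by (intro set_plus_mono2) (auto simp: S'_def T'_def)
    finally show ?thesis .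
  qed
  then show ?thesis by (metis closure_subset closure_subset_eq subsetI)
qed

lemma closed_overshoot_range:
  assumes "d \<ge> 0"
  shows "closed (overshoot_range \<alpha> d A')"
proof (cases "d = 0")
  case True
  have "x \<in> overshoot_range \<alpha> d A'" if x: "x \<in> closure (overshoot_range \<alpha> d A')" for x
  proof -
    have "x \<in> closure {0..}"
      using closure_mono[of "overshoot_range \<alpha> d A'" "{0..}"] overshoot_range_nonneg x by blast
    then have "x \<ge> 0" by simp
    moreover have "\<exists>q\<in>A'. x < q + \<epsilon>" if "\<epsilon> > 0" for \<epsilon>
    proof -
      obtain t where t: "t \<in> overshoot_range \<alpha> d A'" "dist t x < \<epsilon> / 2"
        using closure_approachable[THEN iffD1, rule_format, OF x, of "\<epsilon> / 2"] \<open>\<epsilon> > 0\<close> by (auto simp del: less_divide_eq_numeral1)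
      then obtain q where "q \<in> A'" "t < q + \<epsilon> / 2"
        using overshoot_rangeD[of t \<alpha> A' "\<epsilon> / 2"] True \<open>\<epsilon> > 0\<close> by (metis half_gt_zero)
      then show ?thesis using t by (intro bexI[of _ q]) (auto simp: dist_real_def abs_if split: if_splits)
    qed
    ultimately show ?thesis using True by (simp add: overshoot_range_def)
  qed
  then show ?thesis by (metis closure_subset closure_subset_eq subsetI)
next
  case False
  then have "d > 0" using assms by simp
  then show ?thesis
    using overshoot_range_lattice[of \<alpha> d A'] lattice_discrete[of d]
    by (intro discrete_imp_closed[of d]) (auto simp: dist_real_def)
qed

lemma closed_renewal_range: "closed (renewal_range A)"
  by (auto simp: renewal_range_def)

lemma closed_upper_range: "d \<ge> 0 \<Longrightarrow> closed (upper_range \<alpha> d A A')"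
  unfolding upper_range_def
  by (intro closed_Plus_nonneg closed_overshoot_range closed_renewal_range)
     (auto dest: overshoot_range_nonneg renewal_range_nonneg)

lemma closed_full_range: "d \<ge> 0 \<Longrightarrow> closed (full_range \<alpha> d A A')"
  unfolding full_range_def lower_range_def
  by (intro closed_Un closed_upper_range closed_negations) auto

section \<open>Reaching the candidate support and staying in it\<close>

context switching_supports
begin

text \<open>Write \<open>e = t + v\<close>: the walk is led through the window to \<open>t\<close>
  and then climbs by \<open>v\<close> with increments from \<open>A\<close>. If
  \<open>d = 0\<close>, then \<open>t\<close> may be an end of the window and is replaced by a
  nearby interior point. If \<open>d > 0\<close>, all approximations are exact, and an end
  \<open>t\<close> of the window is entered from 0.\<close>

lemma hits_from_overshoot:
  assumes "open G" "e \<in> G" "e \<in> upper_range \<alpha> d A A'" and z: "z \<in> lattice d"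
  shows "hits G z"
proof -
  obtain t v where tv: "e = t + v" "t \<in> overshoot_range \<alpha> d A'" "v \<in> renewal_range A"
    using assms(3) by (auto simp: upper_range_def elim: set_plus_elim)
  have t: "t \<ge> 0" "v \<ge> 0" using tv overshoot_range_nonneg renewal_range_nonneg by auto
  obtain r where r: "r > 0" "ball e r \<subseteq> G" using assms by (metis openE)
  obtain a where a: "a \<in> A" "a < 0" using neg by auto
  obtain q0 where q0: "q0 \<in> A'" "q0 > 0" using pos by auto
  have approx: "\<exists>ys. set ys \<subseteq> A \<and> sorted_wrt (\<ge>) ys \<and> \<bar>sum_list ys - v\<bar> < \<epsilon>" if "\<epsilon> > 0" for \<epsilon>
  proof -
    obtain u where u: "u \<in> additive_hull A" "dist u v < \<epsilon>"
      using closure_approachable[THEN iffD1, rule_format, OF subsetD[OF renewal_range_hull tv(3)] \<open>\<epsilon> > 0\<close>] by blast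
    then obtain ys where ys: "set ys \<subseteq> A" "u = sum_list ys" by (auto simp: additive_hull_def)
    have "sum_list (rev (sort ys)) = u"
      unfolding ys(2) sum_list_rev by (metis mset_sort sum_mset_sum_list)
    moreover have "sorted_wrt (\<ge>) (rev (sort ys))" by (simp add: sorted_wrt_rev)
    ultimately show ?thesis using ys u by (intro exI[of _ "rev (sort ys)"]) (auto simp: dist_real_def)
  qed
  show ?thesis
  proof (cases "d = 0")
    case True
    then obtain q1 where q1: "q1 \<in> A'" "t < q1 + r / 8" using overshoot_rangeD[of t \<alpha> A' "r / 8"] tv(2) r(1) by auto
    define q where "q = max q0 q1"
    have q: "q \<in> A'" "q > 0" "t < q + r / 8" using q0 q1 by (auto simp: q_def max_def)
    have "max 0 (t - r / 4) < min q (t + r / 4)" using q t r by auto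
    \<comment> \<open>Four errors of at most \<open>r / 4\<close> separate the final point from
      \<open>e\<close>: those of \<open>t'\<close>, of the window, of the approximation of
      \<open>v\<close>, and of the climb. The bound \<open>t' / 2\<close> on \<delta> keeps both the
      start and the end of the climb positive.\<close>
    then obtain t' where t': "max 0 (t - r / 4) < t'" "t' < min q (t + r / 4)" using dense by blast
    define \<delta> where "\<delta> = min (r / 4) (t' / 2)"
    have \<delta>: "\<delta> > 0" "\<delta> \<le> r / 4" "\<delta> \<le> t' / 2" using r t' by (auto simp: \<delta>_def)
    obtain ys where ys: "set ys \<subseteq> A" "sorted_wrt (\<ge>) ys" "\<bar>sum_list ys - v\<bar> < \<delta>"
      using approx \<delta> by blast
    show ?thesis
    proof (rule hits_from_window[OF a q(1,2), of t' \<delta>])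
      fix u assume u: "u \<in> lattice d" "\<bar>u - t'\<bar> < \<delta>"
      show "hits G u"
      proof (rule hits_up_list[of u ys "r / 4"])
        fix z assume "\<bar>z - (u + sum_list ys)\<bar> < r / 4"
        then have "z \<in> ball e r" using u ys \<delta> t' tv(1)
          by (auto simp: dist_real_def abs_if split: if_splits)
        then show "hits G z" using r by (intro hit.start) auto
      qed (use u ys r \<delta> t' t in \<open>auto simp: abs_if split: if_splits\<close>)
    qed (use t' \<delta> a z True in \<open>auto simp: lattice_def\<close>)
  next
    case False
    then have d0: "d > 0" using d by simp
    obtain ys where ys: "set ys \<subseteq> A" "sorted_wrt (\<ge>) ys" "\<bar>sum_list ys - v\<bar> < d"
      using approx d0 by blast
    have "v \<in> lattice d" using tv(3) renewal_range_hull closure_hull_subset by blast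
    moreover have "sum_list ys \<in> lattice d"
      using ys(1) closure_hull_subset closure_subset[of "additive_hull A"] by (auto simp: additive_hull_def)
    ultimately have v: "sum_list ys = v" using lattice_discrete[OF d0] ys by blast
    have tZ: "t \<in> lattice d" using tv overshoot_range_lattice by blast
    have t_upper: "t > 0 \<or> t = 0 \<and> \<alpha> > 0" using tv(2) False by (auto simp: overshoot_range_def)
    have eG: "hits G z" if "z \<in> lattice d" "\<bar>z - e\<bar> < r" for z
      using that r by (intro hit.start) (auto simp: dist_real_def)
    have ht: "hits G t"
    proof (cases "v = 0")
      case True
      then show ?thesis using eG[of t] tv(1) r tZ by auto
    next
      case False
      then show ?thesis using ys t v tZ t_upper r eG tv(1)
        by (intro hits_up_list[of t ys r]) auto
    qed
    have exact: "hits G u" if "hits G w" "w \<in> lattice d" "u \<in> lattice d" "\<bar>u - w\<bar> < d" for u w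
      using lattice_discrete[OF d0 that(3,2,4)] that by simp
    show ?thesis
    proof (cases "\<exists>q\<in>A'. t < q")
      case True
      then obtain q where "q \<in> A'" "t < q" by auto
      then show ?thesis
        using t a z d0 tZ by (rule_tac hits_from_window[OF a, of q t d]) (simp_all add: exact[OF ht tZ])
    next
      case False
      \<comment> \<open>No element of \<open>A'\<close> exceeds \<open>t\<close> here. Since
        \<open>A'\<close> has positive elements, \<open>t = 0\<close> is impossible, and
        \<open>t\<close> is the maximum of \<open>A'\<close>: the walk goes to 0, which is inside
        the window, and jumps to \<open>t\<close> with the weight 1 - \<alpha>.\<close>
      then consider "t = 0" | "\<alpha> < 1" "t \<in> A'" using tv(2) d0 by (auto simp: overshoot_range_def)
      then show ?thesis
      proof cases
        case 1
        then show ?thesis using q0 False by auto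
      next
        case 2
        have h0: "hits G 0"
          using exact[OF ht tZ] 2 d0 by (intro hit.down[of 0 _ t _ d]) auto
        show ?thesis
          using q0 a z d0 by (rule_tac hits_from_window[OF a q0, of 0 d]) (simp_all add: exact[OF h0])
      qed
    qed
  qed
qed

lemma zero_overshoot: "\<alpha> > 0 \<Longrightarrow> 0 \<in> overshoot_range \<alpha> d A'"
  using pos by (auto simp: overshoot_range_def) (metis add_pos_pos)

text \<open>A jump across 0 from \<open>x > 0\<close> ends at a depth strictly less than
  \<open>- y\<close>; from \<open>x = 0\<close> the depth equals \<open>- y\<close>, which the
  reflected \<open>overshoot_range\<close> admits because \<alpha> > 0. A jump that stays positive
  either leaves \<open>v + y\<close> nonnegative, a new renewal part, or ends below
  \<open>t\<close>, where \<open>overshoot_range\<close> is closed downwards.\<close>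

lemma upper_range_step:
  assumes x: "x \<in> lattice d" "x > 0 \<or> x = 0 \<and> \<alpha> > 0" and y: "y \<in> A"
  shows "x + y < 0 \<Longrightarrow> x + y \<in> lower_range \<alpha> d A A'"
    and "x \<in> upper_range \<alpha> d A A' \<Longrightarrow> x + y > 0 \<Longrightarrow> x + y \<in> upper_range \<alpha> d A A'"
proof -
  have yZ: "y \<in> lattice d" using y supports_subset by auto
  show "x + y \<in> lower_range \<alpha> d A A'" if xy: "x + y < 0"
  proof -
    have "- (x + y) \<in> overshoot_range (1 - \<alpha>) d (uminus ` A)"
    proof (cases "d = 0")
      case True
      have "\<exists>q\<in>uminus ` A. - (x + y) < q + \<epsilon>" if "\<epsilon> > 0" for \<epsilon>
        using x y that by (intro bexI[of _ "- y"]) auto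
      then show ?thesis using True xy by (auto simp: overshoot_range_def)
    next
      case False
      have "- (x + y) \<in> lattice d" using x yZ lattice_add by (simp del: minus_add_distrib)
      moreover have "(\<exists>q\<in>uminus ` A. - (x + y) < q) \<or> 1 - \<alpha> < 1 \<and> - (x + y) \<in> uminus ` A"
        using x y by (cases "x = 0") (auto intro!: bexI[of _ "y"])
      ultimately show ?thesis using False xy by (simp add: overshoot_range_def del: minus_add_distrib)
    qed
    then have "- (x + y) \<in> upper_range (1 - \<alpha>) d (uminus ` A') (uminus ` A)"
      using overshoot_subset_upper by blast
    then show ?thesis unfolding lower_range_def by (metis image_eqI minus_minus)
  qed
  show "x + y \<in> upper_range \<alpha> d A A'" if xE: "x \<in> upper_range \<alpha> d A A'" and xy: "x + y > 0"
  proof -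
    obtain t v where tv: "x = t + v" "t \<in> overshoot_range \<alpha> d A'" "v \<in> renewal_range A"
      using xE by (auto simp: upper_range_def elim: set_plus_elim)
    have nn: "t \<ge> 0" "v \<ge> 0" using tv overshoot_range_nonneg renewal_range_nonneg by auto
    show ?thesis
    proof (cases "v + y \<ge> 0")
      case True
      have "v + y \<in> renewal_range A"
      proof (cases "\<exists>y\<in>A. y > 0")
        case c: True
        have "y \<in> closure (additive_hull A)" using y additive_hull_superset closure_subset by blast
        then show ?thesis using c True closure_additive_hull_add[of v A y] tv(3)
          by (auto simp: renewal_range_def)
      next
        case False
        then show ?thesis using True tv(3) y by (force simp: renewal_range_def)
      qed
      then show ?thesis using tv unfolding upper_range_def by (auto simp: add.assoc)
    next
      case False
      then have "x + y \<in> overshoot_range \<alpha> d A'"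
        using tv xy x(1) yZ lattice_add by (intro overshoot_range_downward[OF tv(2)]) auto
      then show ?thesis using overshoot_subset_upper by blast
    qed
  qed
qed

end

context switching_supports
begin

interpretation refl: switching_supports "1 - \<alpha>" d "uminus ` A'" "uminus ` A"
  by (rule switching_supports_reflect) unfold_locales

lemma hits_full_range:
  assumes "open G" "e \<in> G" "e \<in> full_range \<alpha> d A A'" "z \<in> lattice d"
  shows "hits G z"
proof (cases "e \<in> upper_range \<alpha> d A A'")
  case False
  then have "- e \<in> upper_range (1 - \<alpha>) d (uminus ` A') (uminus ` A)"
    using assms(3) by (auto simp: full_range_def lower_range_def)
  moreover have "open (uminus ` G)" "- e \<in> uminus ` G" using assms open_negations by auto
  ultimately have "refl.hits (uminus ` G) (- z)"
    using assms(4) by (intro refl.hits_from_overshoot) auto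
  from hit_reflect[OF this] show ?thesis by (simp add: image_image)
qed (use assms hits_from_overshoot in blast)

lemma zero_full_range: "0 \<in> full_range \<alpha> d A A'"
proof (cases "\<alpha> > 0")
  case True
  then show ?thesis using subsetD[OF overshoot_subset_upper zero_overshoot] by (auto simp: full_range_def)
next
  case False
  then have "0 \<in> upper_range (1 - \<alpha>) d (uminus ` A') (uminus ` A)"
    using \<alpha> by (intro subsetD[OF overshoot_subset_upper refl.zero_overshoot]) auto
  then show ?thesis by (force simp: full_range_def lower_range_def)
qed

lemma full_range_lattice: "full_range \<alpha> d A A' \<subseteq> lattice d"
proof -
  have "upper_range \<alpha> d A A' \<subseteq> lattice d" if "switching_supports \<alpha> d A A'" for \<alpha> A A'
  proof -
    interpret S: switching_supports \<alpha> d A A' by fact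
    show ?thesis unfolding upper_range_def
      using overshoot_range_lattice[of \<alpha> d A'] S.closure_hull_subset renewal_range_hull[of A]
      by (auto elim!: set_plus_elim intro!: lattice_add)
  qed
  from this[of \<alpha> A A'] this[of "1 - \<alpha>" "uminus ` A'" "uminus ` A"]
  show ?thesis using refl.switching_supports_axioms switching_supports_axioms
    by (auto simp: full_range_def lower_range_def)
qed

text \<open>Here \<open>x\<close> may be any state, in the candidate support or not; this is what
  makes the walk enter the support at its first crossing of 0.\<close>

lemma exit_upper:
  assumes "x \<in> lattice d" "x > 0 \<or> x = 0 \<and> \<alpha> > 0" "y \<in> A" "x + y \<le> 0"
  shows "x + y \<in> full_range \<alpha> d A A'"
  using upper_range_step(1)[OF assms(1-3)] assms(4) zero_full_range
  by (cases "x + y = 0") (auto simp: full_range_def)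

lemma full_range_step_up:
  assumes "x \<in> full_range \<alpha> d A A'" "x > 0 \<or> x = 0 \<and> \<alpha> > 0" "y \<in> A"
  shows "x + y \<in> full_range \<alpha> d A A'"
proof -
  have xZ: "x \<in> lattice d" using assms full_range_lattice by auto
  have "x \<in> upper_range \<alpha> d A A'"
  proof (cases "x > 0")
    case True
    then have "x \<notin> lower_range \<alpha> d A A'" by (auto simp: lower_range_def dest: upper_range_nonneg)
    then show ?thesis using assms by (auto simp: full_range_def)
  next
    case False
    \<comment> \<open>Even if 0 was counted among the lower points, \<alpha> > 0 puts it into the
      upper part.\<close>
    then show ?thesis using assms(2) subsetD[OF overshoot_subset_upper zero_overshoot] by auto
  qed
  then show ?thesis using exit_upper[OF xZ assms(2,3)] upper_range_step(2)[OF xZ assms(2,3)]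
    by (cases "x + y > 0") (auto simp: full_range_def)
qed

end

context switching_supports
begin

interpretation refl: switching_supports "1 - \<alpha>" d "uminus ` A'" "uminus ` A"
  by (rule switching_supports_reflect) unfold_locales

lemma exit_lower:
  assumes "x \<in> lattice d" "x < 0 \<or> x = 0 \<and> \<alpha> < 1" "y \<in> A'" "x + y \<ge> 0"
  shows "x + y \<in> full_range \<alpha> d A A'"
proof -
  have "- x + - y \<in> full_range (1 - \<alpha>) d (uminus ` A') (uminus ` A)"
    using assms by (intro refl.exit_upper) auto
  then have "- (x + y) \<in> uminus ` full_range \<alpha> d A A'" by (simp add: full_range_reflect)
  then show ?thesis by (auto simp del: minus_add_distrib)
qed

lemma full_range_step_down:
  assumes "x \<in> full_range \<alpha> d A A'" "x < 0 \<or> x = 0 \<and> \<alpha> < 1" "y \<in> A'"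
  shows "x + y \<in> full_range \<alpha> d A A'"
proof -
  have "- x + - y \<in> full_range (1 - \<alpha>) d (uminus ` A') (uminus ` A)"
    using assms by (intro refl.full_range_step_up) (auto simp: full_range_reflect)
  then have "- (x + y) \<in> uminus ` full_range \<alpha> d A A'" by (simp add: full_range_reflect)
  then show ?thesis by (auto simp del: minus_add_distrib)
qed

end

section \<open>Supports of measures\<close>

lemma closed_msupp: "closed (msupp \<mu>)"
proof -
  have "- msupp \<mu> = \<Union>{G. open G \<and> \<not> emeasure \<mu> G > 0}"
    by (auto simp: msupp_def)
  then show ?thesis by (auto simp: closed_def intro!: open_Union)
qed

text \<open>The complement of the support is a union of null open sets, and by the Lindelof property
  countably many of them suffice.\<close>

lemma emeasure_Compl_msupp:
  assumes "sets \<mu> = sets borel"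
  shows "emeasure \<mu> (- msupp \<mu>) = 0"
proof -
  define \<F> where "\<F> = {G. open G \<and> emeasure \<mu> G = 0}"
  have eq: "- msupp \<mu> = \<Union>\<F>" by (auto simp: msupp_def \<F>_def)
  obtain \<F>' where \<F>': "\<F>' \<subseteq> \<F>" "countable \<F>'" "\<Union>\<F>' = \<Union>\<F>"
    using Lindelof[of \<F>] by (auto simp: \<F>_def)
  have "(\<Union>G\<in>\<F>'. G) \<in> null_sets \<mu>"
    using \<F>' assms by (intro null_sets_UN') (auto simp: \<F>_def null_sets_def)
  then show ?thesis using \<F>' eq by (auto simp: null_sets_def)
qed

lemma AE_msupp:
  assumes "sets \<mu> = sets borel"
  shows "AE x in \<mu>. x \<in> msupp \<mu>"
proof (rule AE_I')
  show "- msupp \<mu> \<in> null_sets \<mu>"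
    using emeasure_Compl_msupp[OF assms] closed_msupp[of \<mu>] assms by (auto simp: null_sets_def)
qed auto

lemma msupp_meets:
  assumes "sets \<mu> = sets borel" "emeasure \<mu> B > 0"
  obtains x where "x \<in> B" "x \<in> msupp \<mu>"
proof -
  have "\<exists>x. x \<in> B \<and> x \<in> msupp \<mu>"
  proof (rule ccontr)
    assume "\<nexists>x. x \<in> B \<and> x \<in> msupp \<mu>"
    then have "emeasure \<mu> B \<le> emeasure \<mu> (- msupp \<mu>)"
      using closed_msupp[of \<mu>] assms by (intro emeasure_mono) auto
    then show False using emeasure_Compl_msupp[OF assms(1)] assms(2) by simp
  qed
  then show ?thesis using that by blast
qed

lemma msupp_open: "x \<in> msupp \<mu> \<Longrightarrow> open G \<Longrightarrow> x \<in> G \<Longrightarrow> emeasure \<mu> G > 0"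
  by (auto simp: msupp_def)

lemma msupp_subset_closed:
  assumes "closed C" "emeasure \<mu> (- C) = 0"
  shows "msupp \<mu> \<subseteq> C"
  using assms msupp_open[of _ \<mu> "- C"] by (auto simp: closed_def)

lemma measure_eq_1_iff_msupp_subset:
  assumes "prob_space \<mu>" "sets \<mu> = sets borel" "closed C"
  shows "measure \<mu> C = 1 \<longleftrightarrow> msupp \<mu> \<subseteq> C"
proof -
  interpret prob_space \<mu> by fact
  have C: "C \<in> sets \<mu>" using assms by auto
  have "measure \<mu> C = 1 \<longleftrightarrow> (AE x in \<mu>. x \<in> C)"
    using prob_eq_1[OF C] by simp
  also have "\<dots> \<longleftrightarrow> msupp \<mu> \<subseteq> C"
  proof
    assume "AE x in \<mu>. x \<in> C"
    then have "emeasure \<mu> (- C) = 0" using C assms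
      by (subst (asm) AE_iff_measurable[OF _ refl]) (auto simp: Collect_neg_eq sets_eq_imp_space_eq[OF assms(2)])
    then show "msupp \<mu> \<subseteq> C" using msupp_subset_closed assms by blast
  next
    assume "msupp \<mu> \<subseteq> C"
    then show "AE x in \<mu>. x \<in> C" using AE_msupp[OF assms(2)] by (auto elim: AE_mp)
  qed
  finally show ?thesis .
qed

lemma msupp_add_measure:
  assumes "sets \<mu> = sets borel" "sets \<nu> = sets borel"
  shows "msupp (add_measure \<mu> \<nu>) = msupp \<mu> \<union> msupp \<nu>"
proof (intro set_eqI iffI)
  fix x assume x: "x \<in> msupp (add_measure \<mu> \<nu>)"
  show "x \<in> msupp \<mu> \<union> msupp \<nu>"
  proof (rule ccontr)
    assume "x \<notin> msupp \<mu> \<union> msupp \<nu>"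
    then obtain G H where GH: "open G" "x \<in> G" "emeasure \<mu> G = 0" "open H" "x \<in> H" "emeasure \<nu> H = 0"
      by (auto simp: msupp_def)
    have "emeasure \<mu> (G \<inter> H) \<le> emeasure \<mu> G" "emeasure \<nu> (G \<inter> H) \<le> emeasure \<nu> H"
      using GH(1,4) assms by (simp_all add: emeasure_mono)
    moreover have "emeasure (add_measure \<mu> \<nu>) (G \<inter> H) > 0"
      using x GH by (intro msupp_open[OF x]) auto
    ultimately show False using GH by (simp add: emeasure_add_measure[OF assms] open_Int)
  qed
next
  fix x assume "x \<in> msupp \<mu> \<union> msupp \<nu>"
  then show "x \<in> msupp (add_measure \<mu> \<nu>)"
    by (auto simp: msupp_def emeasure_add_measure[OF assms] add_pos_nonneg add_nonneg_pos)
qed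

text \<open>The inner integration is over \<open>N\<close>, so sigma-finiteness is asked of the
  second factor; the renewal measures will be placed first.\<close>

lemma emeasure_convolution_sigma_finite:
  fixes M N :: "real measure"
  assumes "sigma_finite_measure N" and [measurable_cong]: "sets M = sets borel" "sets N = sets borel"
    and [measurable]: "G \<in> sets borel"
  shows "emeasure (convolution M N) G = (\<integral>\<^sup>+x. emeasure N {y. x + y \<in> G} \<partial>M)"
proof -
  interpret N: sigma_finite_measure N by fact
  have sp: "space M = UNIV" "space N = UNIV" using assms(2,3) by (auto dest: sets_eq_imp_space_eq)
  have "(\<lambda>(x, y). x + y) -` G \<inter> space (M \<Otimes>\<^sub>M N) = {p \<in> space (M \<Otimes>\<^sub>M N). fst p + snd p \<in> G}"
    by auto
  also have "\<dots> \<in> sets (M \<Otimes>\<^sub>M N)" by measurable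
  finally have "(\<lambda>(x, y). x + y) -` G \<inter> space (M \<Otimes>\<^sub>M N) \<in> sets (M \<Otimes>\<^sub>M N)" .
  then show ?thesis unfolding convolution_def
    by (subst emeasure_distr) (auto simp: N.emeasure_pair_measure_alt sp space_pair_measure vimage_def)
qed

text \<open>Charged balls of radius \<open>r / 2\<close> around \<open>x\<close> and
  \<open>y\<close> charge the ball of radius \<open>r\<close> around \<open>x + y\<close>. The
  closure stands because a sum of two closed sets may fail to be closed.\<close>

lemma msupp_convolution:
  fixes M N :: "real measure"
  assumes "sigma_finite_measure N" and [measurable_cong]: "sets M = sets borel" "sets N = sets borel"
  shows "msupp (convolution M N) = closure (msupp M + msupp N)"
proof
  note conv = emeasure_convolution_sigma_finite[OF assms]
  have op: "open {y. x + y \<in> G}" if "open G" for G and x :: real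
    using continuous_open_vimage[of G "\<lambda>y. x + y"] that by (auto simp: vimage_def intro!: continuous_intros open_vimage[unfolded vimage_def])
  show "closure (msupp M + msupp N) \<subseteq> msupp (convolution M N)"
  proof (rule closure_minimal[OF _ closed_msupp], rule subsetI)
    fix z assume "z \<in> msupp M + msupp N"
    then obtain x y where xy: "x \<in> msupp M" "y \<in> msupp N" "z = x + y" by (auto elim: set_plus_elim)
    show "z \<in> msupp (convolution M N)"
      unfolding msupp_def
    proof (intro CollectI allI impI)
      fix G assume G: "open G" "z \<in> G"
      then obtain r where r: "r > 0" "ball z r \<subseteq> G" by (metis openE)
      define U V where "U = ball x (r / 2)" "V = ball y (r / 2)"
      have "0 < emeasure N V * emeasure M U"
        using xy r by (auto simp: U_V_def ennreal_zero_less_mult_iff intro!: msupp_open)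
      also have "\<dots> = (\<integral>\<^sup>+x. emeasure N V * indicator U x \<partial>M)"
        by (subst nn_integral_cmult_indicator) (auto simp: U_V_def assms)
      also have "\<dots> \<le> (\<integral>\<^sup>+x. emeasure N {y. x + y \<in> G} \<partial>M)"
      proof (intro nn_integral_mono)
        fix a
        have "V \<subseteq> {y. a + y \<in> G}" if "a \<in> U"
        proof
          fix b assume "b \<in> V"
          then have "a + b \<in> ball z r" using that
            by (auto simp: U_V_def xy(3) dist_real_def abs_if split: if_splits)
          then show "b \<in> {y. a + y \<in> G}" using r by auto
        qed
        then show "emeasure N V * indicator U a \<le> emeasure N {y. a + y \<in> G}"
          using op[OF G(1), of a] by (auto simp: indicator_def assms intro!: emeasure_mono)
      qed
      also have "\<dots> = emeasure (convolution M N) G" using G by (subst conv) auto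
      finally show "emeasure (convolution M N) G > 0" .
    qed
  qed
  show "msupp (convolution M N) \<subseteq> closure (msupp M + msupp N)"
  proof
    fix z assume z: "z \<in> msupp (convolution M N)"
    show "z \<in> closure (msupp M + msupp N)"
      unfolding closure_iff_nhds_not_empty
    proof (intro allI impI)
      fix S G assume G: "G \<subseteq> S" "open G" "z \<in> G"
      have "(msupp M + msupp N) \<inter> G \<noteq> {}"
      proof
        assume e: "(msupp M + msupp N) \<inter> G = {}"
        have "AE x in M. emeasure N {y. x + y \<in> G} = 0"
          using AE_msupp[OF assms(2)]
        proof eventually_elim
          case (elim x)
          show ?case
          proof (rule ccontr)
            assume "emeasure N {y. x + y \<in> G} \<noteq> 0"
            then have "emeasure N {y. x + y \<in> G} > 0" by (simp add: zero_less_iff_neq_zero)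
            then obtain y where "x + y \<in> G" "y \<in> msupp N" using msupp_meets[OF assms(3)] by blast
            then show False using e elim by auto
          qed
        qed
        then have "(\<integral>\<^sup>+x. emeasure N {y. x + y \<in> G} \<partial>M) = (\<integral>\<^sup>+x. 0 \<partial>M)" by (rule nn_integral_cong_AE)
        then show False using msupp_open[OF z G(2,3)] G by (subst (asm) conv) auto
      qed
      then show "(msupp M + msupp N) \<inter> S \<noteq> {}" using G by auto
    qed
  qed
qed

lemma finite_measure_conv_power:
  assumes "finite_measure F" "sets F = sets borel"
  shows "finite_measure (conv_power F n)"
proof (induction n)
  case 0
  then show ?case by (simp add: prob_space_return prob_space.finite_measure)
next
  case (Suc n)
  then show ?case using assms by (simp add: convolution_finite)
qed

lemma msupp_return: "msupp (return borel x) = {x :: real}"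
proof -
  have "y \<notin> msupp (return borel x)" if "y \<noteq> x" for y
    using that msupp_subset_closed[of "{x}" "return borel x"] by (auto simp: indicator_def)
  moreover have "x \<in> msupp (return borel x)" by (auto simp: msupp_def)
  ultimately show ?thesis by auto
qed

text \<open>Every convolution power lives on the closed submonoid generated by the support, and a
  sum of \<open>n\<close> support points lies in the support of the \<open>n\<close>-th power.
  \<open>F\<close> is only assumed finite, so defective laws are covered.\<close>

lemma msupp_renewal_measure:
  assumes "finite_measure F" "sets F = sets borel"
  shows "msupp (renewal_measure F) = closure (additive_hull (msupp F))"
proof
  have conv: "msupp (conv_power F (Suc n)) = closure (msupp F + msupp (conv_power F n))" for n
  proof -
    interpret finite_measure "conv_power F n" by (rule finite_measure_conv_power[OF assms])
    show ?thesis using assms by (simp add: msupp_convolution sigma_finite_measure_axioms)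
  qed
  have sub: "msupp (conv_power F n) \<subseteq> closure (additive_hull (msupp F))" for n
  proof (induction n)
    case 0
    then show ?case using closure_subset[of "additive_hull (msupp F)"] by (auto simp: msupp_return)
  next
    case (Suc n)
    have "msupp F \<subseteq> closure (additive_hull (msupp F))"
      using additive_hull_superset closure_subset by blast
    with Suc show ?case unfolding conv
      by (intro closure_minimal) (auto elim!: set_plus_elim intro!: closure_additive_hull_add)
  qed
  show "msupp (renewal_measure F) \<subseteq> closure (additive_hull (msupp F))"
  proof
    fix z assume z: "z \<in> msupp (renewal_measure F)"
    show "z \<in> closure (additive_hull (msupp F))"
    proof (rule ccontr)
      assume "z \<notin> closure (additive_hull (msupp F))"
      then have G: "open (- closure (additive_hull (msupp F)))" "z \<in> - closure (additive_hull (msupp F))"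
        by auto
      have pos: "(\<Sum>n. emeasure (conv_power F n) (- closure (additive_hull (msupp F)))) > 0"
        using msupp_open[OF z G] G by (simp add: emeasure_renewal_measure)
      obtain n where "emeasure (conv_power F n) (- closure (additive_hull (msupp F))) > 0"
      proof (rule ccontr)
        assume "\<not> thesis"
        then have "emeasure (conv_power F n) (- closure (additive_hull (msupp F))) = 0" for n
          using that not_gr_zero by blast
        then show False using pos by simp
      qed
      then show False using msupp_meets[of "conv_power F n"] sub[of n] by auto
    qed
  qed
  have conv_sub: "msupp (conv_power F n) \<subseteq> msupp (renewal_measure F)" for n
  proof
    fix x assume x: "x \<in> msupp (conv_power F n)"
    have "(\<Sum>n. emeasure (conv_power F n) G) > 0" if "open G" "x \<in> G" for G
    proof -
      have "emeasure (conv_power F n) G > 0" using msupp_open[OF x] that by auto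
      then show ?thesis using suminf_pos_iff[of "\<lambda>n. emeasure (conv_power F n) G"] by auto
    qed
    then show "x \<in> msupp (renewal_measure F)" by (simp add: msupp_def emeasure_renewal_measure)
  qed
  have "sum_list ys \<in> msupp (conv_power F (length ys))" if "set ys \<subseteq> msupp F" for ys
    using that
  proof (induction ys)
    case Nil
    then show ?case by (simp add: msupp_return)
  next
    case (Cons y ys)
    then have "y + sum_list ys \<in> msupp F + msupp (conv_power F (length ys))" by auto
    then show ?case unfolding length_Cons conv using closure_subset by auto
  qed
  then have "additive_hull (msupp F) \<subseteq> msupp (renewal_measure F)"
    using conv_sub by (fastforce simp: additive_hull_def)
  then show "closure (additive_hull (msupp F)) \<subseteq> msupp (renewal_measure F)"
    by (intro closure_minimal closed_msupp)
qed

section \<open>Haar measures and densities with respect to them\<close>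

lemma sets_haar [simp, measurable_cong]: "sets (haar d) = sets borel"
  by (simp add: haar_def)

lemma nn_integral_haar:
  assumes "d > 0" and [measurable]: "f \<in> borel_measurable borel"
  shows "(\<integral>\<^sup>+x. f x \<partial>haar d) = ennreal d * (\<integral>\<^sup>+k. f (d * of_int k) \<partial>count_space UNIV)"
  using assms by (simp add: haar_def nn_integral_scale_measure nn_integral_distr)

lemma sigma_finite_haar:
  assumes "d \<ge> 0"
  shows "sigma_finite_measure (haar d)"
proof (cases "d = 0")
  case True
  then show ?thesis by (simp add: haar_def sigma_finite_lborel)
next
  case False
  then have d: "d > 0" using assms by simp
  have L: "- lattice d \<in> sets borel" using closed_lattice[OF assms] by auto
  have em: "emeasure (haar d) B = ennreal d * emeasure (count_space UNIV) {k. d * of_int k \<in> B}"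
    if "B \<in> sets borel" for B
    using d that by (simp add: haar_def emeasure_distr vimage_def)
  show ?thesis
  proof (rule sigma_finite_measure.intro, intro exI conjI ballI)
    \<comment> \<open>\<open>haar d\<close> is a measure on the whole line, so the null set
      \<open>- lattice d\<close> has to join the atoms in the countable cover.\<close>
    let ?A = "insert (- lattice d) (range (\<lambda>k::int. {d * of_int k}))"
    show "countable ?A" by auto
    show "?A \<subseteq> sets (haar d)" using L by auto
    show "\<Union>?A = space (haar d)" using d by (auto simp: lattice_def sets_eq_imp_space_eq[OF sets_haar])
    fix a assume "a \<in> ?A"
    then consider "a = - lattice d" | k :: int where "a = {d * of_int k}" by auto
    then show "emeasure (haar d) a \<noteq> \<infinity>"
    proof cases
      case 1
      then have "{k. d * of_int k \<in> a} = {}" using d by (auto simp: lattice_def)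
      then show ?thesis using em[of a] L 1 by simp
    next
      case 2
      then have "{j. d * of_int j \<in> a} = {k}" using d by auto
      then show ?thesis using em[of a] 2 by (simp add: ennreal_mult_eq_top_iff)
    qed
  qed
qed

lemma nn_integral_haar_uminus:
  assumes "d \<ge> 0" and [measurable]: "f \<in> borel_measurable borel"
  shows "(\<integral>\<^sup>+x. f (- x) \<partial>haar d) = (\<integral>\<^sup>+x. f x \<partial>haar d)"
proof (cases "d = 0")
  case True
  have "(\<integral>\<^sup>+x. f x \<partial>distr lborel borel uminus) = (\<integral>\<^sup>+x. f (- x) \<partial>lborel)"
    by (rule nn_integral_distr) auto
  then show ?thesis using True by (simp add: haar_def lborel_distr_uminus)
next
  case False
  have "(\<integral>\<^sup>+k. f (d * of_int (- k)) \<partial>count_space UNIV) = (\<integral>\<^sup>+k. f (d * of_int k) \<partial>count_space UNIV)"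
    by (rule nn_integral_bij_count_space) (auto intro: bij_uminus)
  then show ?thesis using False assms by (simp add: nn_integral_haar)
qed

lemma msupp_uminusI:
  assumes "\<And>G. open G \<Longrightarrow> emeasure \<mu> G = emeasure \<nu> (uminus ` G)"
  shows "msupp \<mu> = uminus ` msupp \<nu>"
proof (rule uminus_image_eqI)
  show "uminus ` msupp \<nu> \<subseteq> msupp \<mu>"
  proof
    fix x assume "x \<in> uminus ` msupp \<nu>"
    then have x: "- x \<in> msupp \<nu>" by auto
    have "emeasure \<nu> (uminus ` G) > 0" if "open G" "x \<in> G" for G
      using that by (intro msupp_open[OF x] open_negations) auto
    then show "x \<in> msupp \<mu>" by (simp add: msupp_def assms)
  qed
  show "uminus ` msupp \<mu> \<subseteq> msupp \<nu>"
  proof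
    fix x assume "x \<in> uminus ` msupp \<mu>"
    then have x: "- x \<in> msupp \<mu>" by auto
    have "emeasure \<nu> G > 0" if "open G" "x \<in> G" for G
      using msupp_open[OF x open_negations[OF that(1)]] assms[OF open_negations[OF that(1)]] that(2)
      by (simp add: image_image)
    then show "x \<in> msupp \<nu>" by (simp add: msupp_def)
  qed
qed

lemma msupp_density_uminus:
  assumes "d \<ge> 0" and [measurable]: "f \<in> borel_measurable borel"
  shows "msupp (density (haar d) (\<lambda>x. f (- x))) = uminus ` msupp (density (haar d) f)"
proof (rule msupp_uminusI)
  fix G :: "real set" assume "open G"
  then have [measurable]: "G \<in> sets borel" "uminus ` G \<in> sets borel"
    using open_negations[of G] by (simp_all add: borel_open)
  have ind: "indicator (uminus ` G) (- x) = (indicator G x :: ennreal)" for x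
    by (auto simp: indicator_def)
  have "emeasure (density (haar d) (\<lambda>x. f (- x))) G = (\<integral>\<^sup>+x. f (- x) * indicator (uminus ` G) (- x) \<partial>haar d)"
    by (simp add: emeasure_density ind)
  also have "\<dots> = (\<integral>\<^sup>+x. f x * indicator (uminus ` G) x \<partial>haar d)"
    by (rule nn_integral_haar_uminus[OF assms(1), where f="\<lambda>x. f x * indicator (uminus ` G) x"]) simp
  also have "\<dots> = emeasure (density (haar d) f) (uminus ` G)" by (simp add: emeasure_density)
  finally show "emeasure (density (haar d) (\<lambda>x. f (- x))) G = emeasure (density (haar d) f) (uminus ` G)" .
qed

text \<open>The atoms are isolated: a ball of radius \<open>d\<close> around a lattice point
  contains no other one. Hence positivity of \<open>f\<close> at the point itself decides, and no
  closure appears.\<close>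

lemma msupp_density_haar_lattice:
  assumes d: "d > 0" and [measurable]: "f \<in> borel_measurable borel"
  shows "msupp (density (haar d) f) = {x \<in> lattice d. f x > 0}"
proof -
  have em: "emeasure (density (haar d) f) G > 0 \<longleftrightarrow> (\<exists>x\<in>lattice d \<inter> G. f x > 0)" if "open G" for G
  proof -
    have [measurable]: "G \<in> sets borel" using that by auto
    have "emeasure (density (haar d) f) G = ennreal d * (\<integral>\<^sup>+k. f (d * of_int k) * indicator G (d * of_int k) \<partial>count_space UNIV)"
      using d by (simp add: emeasure_density nn_integral_haar)
    then have "emeasure (density (haar d) f) G > 0 \<longleftrightarrow> (\<exists>k::int. f (d * of_int k) * indicator G (d * of_int k) \<noteq> 0)"
      using d by (simp add: ennreal_zero_less_mult_iff zero_less_iff_neq_zero nn_integral_0_iff_AE AE_count_space)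
    also have "\<dots> \<longleftrightarrow> (\<exists>x\<in>lattice d \<inter> G. f x > 0)"
      using d by (auto simp: lattice_def indicator_def zero_less_iff_neq_zero split: if_splits)
    finally show ?thesis .
  qed
  show ?thesis
  proof (intro set_eqI iffI)
    fix x assume x: "x \<in> msupp (density (haar d) f)"
    have "x \<in> lattice d"
    proof (rule ccontr)
      assume "x \<notin> lattice d"
      then have "emeasure (density (haar d) f) (- lattice d) > 0"
        using closed_lattice[of d] d by (intro msupp_open[OF x]) auto
      then show False using em[of "- lattice d"] open_Compl[OF closed_lattice[of d]] d by auto
    qed
    moreover obtain y where "y \<in> lattice d" "y \<in> ball x d" "f y > 0"
      using em[of "ball x d"] msupp_open[OF x, of "ball x d"] d by auto
    ultimately show "x \<in> {x \<in> lattice d. f x > 0}"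
      using lattice_discrete[OF d, of x y] by (auto simp: dist_real_def)
  next
    fix x assume "x \<in> {x \<in> lattice d. f x > 0}"
    then show "x \<in> msupp (density (haar d) f)" unfolding msupp_def using em by blast
  qed
qed

lemma msupp_distr_uminus:
  assumes [measurable]: "X \<in> borel_measurable M"
  shows "msupp (distr M borel (\<lambda>\<omega>. - X \<omega> :: real)) = uminus ` msupp (distr M borel X)"
proof (rule msupp_uminusI)
  fix G :: "real set" assume "open G"
  then have [measurable]: "G \<in> sets borel" "uminus ` G \<in> sets borel"
    using open_negations[of G] by (simp_all add: borel_open)
  have "(\<lambda>\<omega>. - X \<omega>) -` G = X -` (uminus ` G)" by (auto simp: image_iff) (metis minus_minus)
  then show "emeasure (distr M borel (\<lambda>\<omega>. - X \<omega>)) G = emeasure (distr M borel X) (uminus ` G)"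
    by (simp add: emeasure_distr)
qed

section \<open>Ladder heights and the supports of the renewal measures\<close>

text \<open>Joint independence is given for a family indexed by a sum type; this extracts the two
  sequences through \<open>Inl\<close> and \<open>Inr\<close>.\<close>

lemma (in prob_space) indep_vars_reindex_inj:
  assumes "indep_vars M' X (f ` I)" "inj_on f I"
  shows "indep_vars (\<lambda>i. M' (f i)) (\<lambda>i. X (f i)) I"
  unfolding indep_vars_def2
proof (intro conjI ballI)
  fix i assume "i \<in> I"
  then show "random_variable (M' (f i)) (X (f i))" using assms by (auto simp: indep_vars_def2)
next
  have ind: "indep_sets (\<lambda>i. {X i -` A \<inter> space M |A. A \<in> sets (M' i)}) (f ` I)"
    using assms by (auto simp: indep_vars_def2)
  show "indep_sets (\<lambda>i. {X (f i) -` A \<inter> space M |A. A \<in> sets (M' (f i))}) I"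
  proof (rule indep_setsI)
    fix i assume "i \<in> I"
    then show "{X (f i) -` A \<inter> space M |A. A \<in> sets (M' (f i))} \<subseteq> events"
      using ind by (auto simp: indep_sets_def)
  next
    fix A J assume J: "J \<noteq> {}" "J \<subseteq> I" "finite J"
      and A: "\<forall>j\<in>J. A j \<in> {X (f j) -` A \<inter> space M |A. A \<in> sets (M' (f j))}"
    define B where "B = A \<circ> inv_into I f"
    have inj: "inj_on f J" using assms J by (auto intro: inj_on_subset)
    have B: "B (f j) = A j" if "j \<in> J" for j
      using that assms J by (auto simp: B_def inv_into_f_f)
    have "prob (\<Inter>j\<in>f ` J. B j) = (\<Prod>j\<in>f ` J. prob (B j))"
      using J A B by (intro indep_setsD[OF ind]) auto
    then show "prob (\<Inter>j\<in>J. A j) = (\<Prod>j\<in>J. prob (A j))"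
      using B by (simp add: prod.reindex[OF inj])
  qed
qed

lemma walk_uminus: "walk (\<lambda>n \<omega>. - X n \<omega>) n \<omega> = - walk X n \<omega>"
  by (simp add: walk_def sum_negf)

lemma enters_uminus: "enters (\<lambda>n \<omega>. - X n \<omega>) (uminus ` B) \<omega> \<longleftrightarrow> enters X B \<omega>"
  by (auto simp: enters_def walk_uminus inj_image_mem_iff[OF inj_uminus])

lemma entrance_uminus: "entrance (\<lambda>n \<omega>. - X n \<omega>) (uminus ` B) \<omega> = - entrance X B \<omega>"
  by (simp add: entrance_def enters_uminus walk_uminus inj_image_mem_iff[OF inj_uminus])

lemma enters_first: "X 0 \<omega> \<in> B \<Longrightarrow> enters X B \<omega>"
  by (auto simp: enters_def walk_def intro!: exI[of _ 1])

lemma entrance_first: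
  assumes "X 0 \<omega> \<in> B"
  shows "entrance X B \<omega> = X 0 \<omega>"
proof -
  have "(LEAST k. k \<ge> 1 \<and> walk X k \<omega> \<in> B) = 1"
    using assms by (intro Least_equality) (auto simp: walk_def)
  then show ?thesis using enters_first[of X \<omega> B, OF assms] by (simp add: entrance_def walk_def)
qed

text \<open>The ladder epoch is \<open>Suc k\<close>, so \<open>X k\<close> is the increment that
  enters \<open>B\<close>. The alternative \<open>k = 0\<close> is there because weak ladder sets
  contain the starting value 0.\<close>

lemma entrance_last_step:
  assumes "enters X B \<omega>"
  obtains k where "walk X (Suc k) \<omega> \<in> B" "entrance X B \<omega> = walk X (Suc k) \<omega>"
    "k = 0 \<or> walk X k \<omega> \<notin> B" "\<And>n. n \<ge> 1 \<Longrightarrow> walk X n \<omega> \<in> B \<Longrightarrow> Suc k \<le> n"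
proof -
  define k where "k = (LEAST k. k \<ge> 1 \<and> walk X k \<omega> \<in> B)"
  have k: "k \<ge> 1 \<and> walk X k \<omega> \<in> B"
    unfolding k_def by (rule LeastI_ex) (use assms in \<open>auto simp: enters_def\<close>)
  have least: "k \<le> n" if "n \<ge> 1" "walk X n \<omega> \<in> B" for n
    unfolding k_def using that by (intro Least_le) auto
  have "k - 1 = 0 \<or> walk X (k - 1) \<omega> \<notin> B"
  proof (rule ccontr)
    assume "\<not> ?thesis"
    then have "k \<le> k - 1" by (intro least) auto
    then show False using k by linarith
  qed
  moreover have "entrance X B \<omega> = walk X k \<omega>" using assms unfolding entrance_def k_def by simp
  ultimately show ?thesis using k least by (intro that[of "k - 1"]) auto
qed

text \<open>Just before entering the walk is at most 0, so the overshoot does not exceed the last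
  increment. Ladder heights are thereby bounded by the support of the law.\<close>

lemma entrance_nonneg_le_increment:
  assumes "entrance X {0..} \<omega> > 0"
  obtains n where "entrance X {0..} \<omega> \<le> X n \<omega>"
proof -
  have "enters X {0..} \<omega>" using assms by (auto simp: entrance_def split: if_splits)
  then obtain k where k: "entrance X {0..} \<omega> = walk X (Suc k) \<omega>" "k = 0 \<or> walk X k \<omega> < 0"
    by (elim entrance_last_step) auto
  then have "entrance X {0..} \<omega> \<le> X k \<omega>" by (auto simp: walk_def)
  then show ?thesis by (rule that)
qed

lemma entrance_nonneg: "entrance X {0..} \<omega> \<ge> 0"
  using entrance_mem[of X "{0..}" \<omega>] by (cases "enters X {0..} \<omega>") (auto simp: entrance_def)

lemma uminus_image_atLeast_0: "uminus ` {0..} = {..0::real}"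
  by simp_all

lemma D_height_uminus: "D_height (\<lambda>n \<omega>. - X n \<omega>) \<omega> = - A_height X \<omega>"
  using entrance_uminus[of X "{0..}" \<omega>] by (simp add: D_height_def A_height_def uminus_image_atLeast_0)

lemma A_height_uminus: "A_height (\<lambda>n \<omega>. - X n \<omega>) \<omega> = - D_height X \<omega>"
  using D_height_uminus[of "\<lambda>n \<omega>. - X n \<omega>" \<omega>] by simp

locale iid_walk = prob_space M for M :: "'a measure" +
  fixes X :: "nat \<Rightarrow> 'a \<Rightarrow> real"
  assumes indep: "indep_vars (\<lambda>_. borel) X UNIV"
    and ident: "distr M borel (X n) = distr M borel (X 0)"
begin

abbreviation "law \<equiv> distr M borel (X 0)"

lemma increment_measurable [measurable]: "X n \<in> borel_measurable M"
  using indep by (auto simp: indep_vars_def)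

lemma walk_measurable [measurable]: "walk X n \<in> borel_measurable M"
  unfolding walk_def[abs_def] by measurable

lemma entrance_borel [measurable]: "B \<in> sets borel \<Longrightarrow> entrance X B \<in> borel_measurable M"
  by (rule measurable_entrance) auto

lemma enters_pred [measurable]:
  assumes [measurable]: "B \<in> sets borel"
  shows "Measurable.pred M (enters X B)"
  unfolding enters_def[abs_def] by measurable

lemma prob_space_law: "prob_space law"
  by (intro prob_space_distr) simp

lemma emeasure_increment:
  "B \<in> sets borel \<Longrightarrow> emeasure M {\<omega> \<in> space M. X n \<omega> \<in> B} = emeasure law B"
  by (subst ident[of n, symmetric], subst emeasure_distr) (auto intro!: arg_cong[where f="emeasure M"])

lemma AE_increments: "AE \<omega> in M. \<forall>n. X n \<omega> \<in> msupp law"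
  unfolding AE_all_countable
proof
  fix n
  have "AE x in distr M borel (X n). x \<in> msupp law" unfolding ident[of n] by (rule AE_msupp) simp
  then show "AE \<omega> in M. X n \<omega> \<in> msupp law"
    using borel_closed[OF closed_msupp] by (subst (asm) AE_distr_iff) auto
qed

lemma prob_increment_pos_iff:
  assumes "open G"
  shows "prob {\<omega> \<in> space M. X 0 \<omega> \<in> G} > 0 \<longleftrightarrow> (\<exists>y\<in>msupp law. y \<in> G)"
proof -
  have "prob {\<omega> \<in> space M. X 0 \<omega> \<in> G} > 0 \<longleftrightarrow> emeasure law G > 0"
    using assms by (simp add: emeasure_increment[of G 0, symmetric] emeasure_eq_measure borel_open)
  also have "\<dots> \<longleftrightarrow> (\<exists>y\<in>msupp law. y \<in> G)"
    using msupp_meets[of law G] msupp_open[OF _ assms] by (metis sets_distr)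
  finally show ?thesis .
qed

lemma prob_increments_pos:
  fixes n :: nat
  assumes "\<And>i. i < n \<Longrightarrow> open (B i)" "\<And>i. i < n \<Longrightarrow> b i \<in> B i" "\<And>i. i < n \<Longrightarrow> b i \<in> msupp law"
  shows "prob {\<omega> \<in> space M. \<forall>i<n. X i \<omega> \<in> B i} > 0"
proof (cases "n = 0")
  case True
  then show ?thesis by (simp add: prob_space)
next
  case False
  have pos: "prob (X i -` B i \<inter> space M) > 0" if "i < n" for i
  proof -
    have "emeasure law (B i) > 0" using assms that by (intro msupp_open[of "b i"]) auto
    also have "emeasure law (B i) = emeasure M (X i -` B i \<inter> space M)"
      using assms(1)[OF that] emeasure_increment[of "B i" i] by (simp add: Int_def vimage_def conj_commute borel_open)
    finally show ?thesis by (simp add: emeasure_eq_measure)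
  qed
  have "prob (\<Inter>i\<in>{..<n}. X i -` B i \<inter> space M) = (\<Prod>i\<in>{..<n}. prob (X i -` B i \<inter> space M))"
    using False assms(1) by (intro indep_varsD[OF indep]) (auto simp: borel_open)
  also have "\<dots> > 0" using pos by (intro prod_pos) auto
  also have "(\<Inter>i\<in>{..<n}. X i -` B i \<inter> space M) = {\<omega> \<in> space M. \<forall>i<n. X i \<omega> \<in> B i}"
    using False by auto
  finally show ?thesis .
qed

lemma emeasure_defective_law:
  assumes [measurable]: "C \<in> sets borel" "B \<in> sets borel"
  shows "emeasure (defective_law M X C) B = emeasure M {\<omega> \<in> space M. enters X C \<omega> \<and> entrance X C \<omega> \<in> B}"
proof -
  let ?\<Omega> = "{\<omega> \<in> space M. enters X C \<omega>}"
  have \<Omega>: "?\<Omega> \<inter> space M \<in> sets M" by measurable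
  have "emeasure (defective_law M X C) B = emeasure (restrict_space M ?\<Omega>) (entrance X C -` B \<inter> space (restrict_space M ?\<Omega>))"
    unfolding defective_law_def by (rule emeasure_distr) (auto intro: measurable_restrict_space1)
  also have "\<dots> = emeasure M (entrance X C -` B \<inter> space (restrict_space M ?\<Omega>))"
    using \<Omega> by (intro emeasure_restrict_space) (auto simp: space_restrict_space)
  also have "entrance X C -` B \<inter> space (restrict_space M ?\<Omega>) = {\<omega> \<in> space M. enters X C \<omega> \<and> entrance X C \<omega> \<in> B}"
    by (auto simp: space_restrict_space)
  finally show ?thesis .
qed

lemma finite_defective_law:
  assumes "C \<in> sets borel"
  shows "finite_measure (defective_law M X C)"
proof (rule finite_measureI)
  have "space (defective_law M X C) = UNIV" by (simp add: defective_law_def)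
  then show "emeasure (defective_law M X C) (space (defective_law M X C)) \<noteq> \<infinity>"
    using assms by (simp add: emeasure_defective_law)
qed

lemma sets_defective_law [simp]: "sets (defective_law M X C) = sets borel"
  by (simp add: defective_law_def)

lemma AE_walk_hull: "AE \<omega> in M. \<forall>n. walk X n \<omega> \<in> closure (additive_hull (msupp law))"
  using AE_increments
proof eventually_elim
  case (elim \<omega>)
  have sub: "msupp law \<subseteq> closure (additive_hull (msupp law))"
    using additive_hull_superset closure_subset by blast
  show ?case
  proof
    fix n
    show "walk X n \<omega> \<in> closure (additive_hull (msupp law))"
    proof (induction n)
      case 0
      then show ?case using closure_subset[of "additive_hull (msupp law)"] by (auto simp: walk_def)
    next
      case (Suc n)
      then show ?case using closure_additive_hull_add[OF Suc, of "X n \<omega>"] elim sub by (auto simp: walk_def)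
    qed
  qed
qed

text \<open>Arranging the increments in increasing order makes the walk first decrease and then increase, so that
  its first positive value is at most its final value.\<close>

lemma ladder_height_near:
  assumes ys: "set ys \<subseteq> msupp law" "sum_list ys > 0" "\<epsilon> > 0"
  shows "emeasure (defective_law M X {0<..}) {0<..<sum_list ys + \<epsilon>} > 0"
proof -
  define zs where "zs = sort ys"
  define n where "n = length zs"
  have zs: "set zs \<subseteq> msupp law" "sum_list zs = sum_list ys" "sorted zs"
    using ys(1) by (auto simp: zs_def) (metis mset_sort sum_mset_sum_list)
  \<comment> \<open>The final value differs from \<open>sum_list ys\<close> by at most
    \<open>n * \<delta>\<close>, and the first positive value exceeds the final one by at most
    \<open>2 * n * \<delta>\<close>; hence the 3. The minimum also keeps the final value
    positive.\<close>
  define \<delta> where "\<delta> = min (sum_list ys) \<epsilon> / (3 * real (Suc n))"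
  have \<delta>: "\<delta> > 0" "3 * real (Suc n) * \<delta> \<le> sum_list ys" "3 * real (Suc n) * \<delta> \<le> \<epsilon>"
    using ys by (auto simp: \<delta>_def)
  have "3 * real (Suc n) * \<delta> = 3 * (real n * \<delta>) + 3 * \<delta>" "0 \<le> real n * \<delta>"
    using \<delta>(1) by (simp_all add: algebra_simps)
  then have n\<delta>: "real n * \<delta> < sum_list ys" "3 * (real n * \<delta>) < \<epsilon>"
    using \<delta> by linarith+
  let ?E = "{\<omega> \<in> space M. \<forall>i<n. X i \<omega> \<in> ball (zs ! i) \<delta>}"
  have "0 < emeasure M ?E"
    using prob_increments_pos[of n "\<lambda>i. ball (zs ! i) \<delta>" "\<lambda>i. zs ! i"] \<delta> zs
    by (simp add: emeasure_eq_measure n_def subset_iff)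
  also have "\<dots> \<le> emeasure M {\<omega> \<in> space M. enters X {0<..} \<omega> \<and> entrance X {0<..} \<omega> \<in> {0<..<sum_list ys + \<epsilon>}}"
  proof (rule emeasure_mono)
    show "?E \<subseteq> {\<omega> \<in> space M. enters X {0<..} \<omega> \<and> entrance X {0<..} \<omega> \<in> {0<..<sum_list ys + \<epsilon>}}"
    proof safe
      fix \<omega> assume "\<omega> \<in> space M" and "\<forall>i<n. X i \<omega> \<in> ball (zs ! i) \<delta>"
      then have X: "\<bar>X i \<omega> - zs ! i\<bar> < \<delta>" if "i < n" for i
        using that by (auto simp: dist_real_def abs_minus_commute)
      have sum_zs: "sum_list ys = (\<Sum>i<n. zs ! i)"
        unfolding zs(2)[symmetric] by (simp add: sum_list_sum_nth[of zs] n_def atLeast0LessThan)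
      have "\<bar>walk X n \<omega> - sum_list ys\<bar> \<le> real n * \<delta>"
      proof -
        have "\<bar>walk X n \<omega> - sum_list ys\<bar> = \<bar>\<Sum>i<n. X i \<omega> - zs ! i\<bar>"
          by (simp add: walk_def sum_zs sum_subtractf)
        also have "\<dots> \<le> (\<Sum>i<n. \<bar>X i \<omega> - zs ! i\<bar>)" by (rule sum_abs)
        also have "\<dots> \<le> (\<Sum>i<n. \<delta>)" using X by (intro sum_mono) (auto intro: less_imp_le)
        finally show ?thesis by simp
      qed
      then have wn: "walk X n \<omega> > 0" "walk X n \<omega> \<le> sum_list ys + real n * \<delta>" using n\<delta> by auto
      then have "n \<ge> 1" by (cases n) (auto simp: walk_def)
      then show en: "enters X {0<..} \<omega>" using wn by (auto simp: enters_def)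
      obtain k where k: "walk X (Suc k) \<omega> > 0" "entrance X {0<..} \<omega> = walk X (Suc k) \<omega>"
        "k = 0 \<or> walk X k \<omega> \<le> 0" "Suc k \<le> n"
        using entrance_last_step[OF en] wn \<open>n \<ge> 1\<close> by (metis greaterThan_iff linorder_not_less)
      \<comment> \<open>The increment that enters the positive half-line is positive, so
        \<open>zs ! k > - \<delta>\<close>. By sorting, all later increments are above
        \<open>- 2 * \<delta>\<close>, and the walk can hardly fall after its ladder epoch.\<close>
      have "X k \<omega> > 0" using k by (cases "k = 0") (auto simp: walk_def)
      then have zk: "zs ! k > - \<delta>" using X[of k] k by auto
      have Xi: "X i \<omega> \<ge> - 2 * \<delta>" if "i \<in> {Suc k..<n}" for i
      proof -
        have "zs ! k \<le> zs ! i" using zs(3) that by (auto simp: sorted_iff_nth_mono n_def)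
        then show ?thesis using X[of i] zk that by auto
      qed
      have "walk X n \<omega> = walk X (Suc k) \<omega> + (\<Sum>i\<in>{Suc k..<n}. X i \<omega>)"
        unfolding walk_def using k(4) by (metis atLeast0LessThan sum.atLeastLessThan_concat zero_le)
      moreover have "(\<Sum>i\<in>{Suc k..<n}. X i \<omega>) \<ge> (\<Sum>i\<in>{Suc k..<n}. - 2 * \<delta>)" using Xi by (intro sum_mono)
      moreover have "(\<Sum>i\<in>{Suc k..<n}. - 2 * \<delta>) \<ge> real n * (- 2 * \<delta>)"
        using \<delta>(1) by (simp add: mult_right_mono)
      ultimately have "walk X (Suc k) \<omega> \<le> walk X n \<omega> + 2 * real n * \<delta>" by simp
      then show "entrance X {0<..} \<omega> \<in> {0<..<sum_list ys + \<epsilon>}" using k wn n\<delta> by auto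
    qed
  qed measurable
  also have "\<dots> = emeasure (defective_law M X {0<..}) {0<..<sum_list ys + \<epsilon>}"
    by (rule emeasure_defective_law[symmetric]) auto
  finally show ?thesis .
qed

lemma msupp_ladder_height: "msupp (defective_law M X {0<..}) \<subseteq> closure (additive_hull (msupp law)) \<inter> {0..}"
proof (rule msupp_subset_closed)
  show "closed (closure (additive_hull (msupp law)) \<inter> {0..})" by auto
  have [measurable]: "closure (additive_hull (msupp law)) \<in> sets borel" by auto
  have "AE \<omega> in M. \<not> (enters X {0<..} \<omega> \<and> entrance X {0<..} \<omega> \<in> - (closure (additive_hull (msupp law)) \<inter> {0..}))"
    using AE_walk_hull
  proof eventually_elim
    case (elim \<omega>)
    then show ?case using entrance_mem[of X "{0<..}" \<omega>] by (auto simp: entrance_def)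
  qed
  then have "emeasure M {\<omega> \<in> space M. enters X {0<..} \<omega> \<and> entrance X {0<..} \<omega> \<in> - (closure (additive_hull (msupp law)) \<inter> {0..})} = 0"
    by (subst (asm) AE_iff_measurable[OF _ refl]) simp_all
  then show "emeasure (defective_law M X {0<..}) (- (closure (additive_hull (msupp law)) \<inter> {0..})) = 0"
    by (subst emeasure_defective_law) auto
qed

text \<open>If increments of both signs occur, the hull is a lattice of span \<open>h\<close>, and
  ladder heights just above \<open>h\<close> exist. For \<open>h > 0\<close> a ladder height below
  \<open>2 * h\<close> must equal \<open>h\<close>, whose multiples exhaust the half-lattice; for
  \<open>h = 0\<close> multiples of arbitrarily small ladder heights are dense in the
  half-line.\<close>

lemma msupp_U_plus:
  assumes neg: "\<exists>y\<in>msupp law. y < 0"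
  shows "msupp (U_plus M X) = renewal_range (msupp law)"
proof -
  let ?L = "defective_law M X {0<..}"
  let ?H = "closure (additive_hull (msupp law))"
  have U: "msupp (U_plus M X) = closure (additive_hull (msupp ?L))"
    unfolding U_plus_def by (rule msupp_renewal_measure) (auto intro: finite_defective_law)
  show ?thesis
  proof (cases "\<exists>y\<in>msupp law. y > 0")
    case False
    have "AE \<omega> in M. \<not> (enters X {0<..} \<omega>)"
      using AE_increments
    proof eventually_elim
      case (elim \<omega>)
      have "walk X n \<omega> \<le> 0" for n unfolding walk_def
        using elim False by (intro sum_nonpos) (auto simp: not_less)
      then show ?case by (auto simp: enters_def not_less)
    qed
    then have "emeasure M {\<omega> \<in> space M. enters X {0<..} \<omega>} = 0"
      by (subst (asm) AE_iff_measurable[OF _ refl]) simp_all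
    then have "emeasure ?L (- {}) = 0" by (subst emeasure_defective_law) auto
    then have "msupp ?L = {}" using msupp_subset_closed[of "{}" ?L] by simp
    then have "closure (additive_hull (msupp ?L)) = {0}" by (simp add: additive_hull_def)
    then show ?thesis using U False by (simp add: renewal_range_def)
  next
    case True
    then obtain p m where pm: "p \<in> msupp law" "p > 0" "m \<in> msupp law" "m < 0" using neg by auto
    then obtain h where h: "h \<ge> 0" "?H = lattice h" using closure_additive_hull_lattice by metis
    have 1: "closure (additive_hull (msupp ?L)) \<subseteq> ?H \<inter> {0..}"
      using msupp_ladder_height closure_subset[of "additive_hull (msupp law)"]
      by (intro closure_minimal additive_hull_minimal) (auto intro: closure_additive_hull_add)
    have small: "\<exists>a\<in>msupp ?L. 0 < a \<and> a < h + \<epsilon>" if "\<epsilon> > 0" for \<epsilon>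
    proof -
      \<comment> \<open>\<open>v\<close> is a positive hull element near \<open>h\<close>:
        \<open>h\<close> itself, or a small number if the hull is the whole line. The bound
        \<open>r \<le> v\<close> keeps the approximating sum positive, and
        \<open>\<epsilon> / 2\<close> remains for the error in
        \<open>ladder_height_near\<close>.\<close>
      define v where "v = (if h = 0 then \<epsilon> / 4 else h)"
      define r where "r = (if h = 0 then \<epsilon> / 4 else min h (\<epsilon> / 4))"
      have vr: "v > 0" "r > 0" "r \<le> v" "v + r \<le> h + \<epsilon> / 2" using h that by (auto simp: v_def r_def)
      have "v \<in> ?H" unfolding h(2) v_def lattice_def by (auto intro: image_eqI[of _ _ 1])
      then obtain w where w: "w \<in> additive_hull (msupp law)" "dist w v < r"
        using vr(2) by (meson closure_approachable)
      then obtain ys where ys: "set ys \<subseteq> msupp law" "w = sum_list ys" by (auto simp: additive_hull_def)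
      have "sum_list ys > 0" "sum_list ys < v + r" using w ys vr by (auto simp: dist_real_def)
      then have "emeasure ?L {0<..<sum_list ys + \<epsilon> / 2} > 0" using ys that by (intro ladder_height_near) auto
      then obtain a where "a \<in> {0<..<sum_list ys + \<epsilon> / 2}" "a \<in> msupp ?L" using msupp_meets[of ?L "{0<..<sum_list ys + \<epsilon> / 2}"] by auto
      then show ?thesis using \<open>sum_list ys < v + r\<close> vr by (intro bexI[of _ a]) auto
    qed
    have 2: "v \<in> closure (additive_hull (msupp ?L))" if v: "v \<in> ?H" "v \<ge> 0" for v
      unfolding closure_approachable
    proof (intro allI impI)
      fix \<epsilon> :: real assume "\<epsilon> > 0"
      have mult: "real n * a \<in> additive_hull (msupp ?L)" if "a \<in> msupp ?L" for a n
        using that by (auto simp: additive_hull_def intro!: exI[of _ "replicate n a"] simp: sum_list_replicate)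
      show "\<exists>y\<in>additive_hull (msupp ?L). dist y v < \<epsilon>"
      proof (cases "h = 0")
        case True
        then obtain a where a: "a \<in> msupp ?L" "0 < a" "a < \<epsilon>" using small[OF \<open>\<epsilon> > 0\<close>] by auto
        define n where "n = nat \<lfloor>v / a\<rfloor>"
        have "real n = of_int \<lfloor>v / a\<rfloor>" using v a by (simp add: n_def)
        then have "real n * a \<le> v" "v < (real n + 1) * a"
          using a floor_divide_lower[of a v] floor_divide_upper[of a v] by auto
        then have "dist (real n * a) v < \<epsilon>" using a by (auto simp: dist_real_def algebra_simps)
        then show ?thesis using mult[OF a(1)] by blast
      next
        case False
        then have h0: "h > 0" using h by simp
        then obtain a where a: "a \<in> msupp ?L" "0 < a" "a < h + h" using small[of h] by auto
        have "a \<in> lattice h" using a msupp_ladder_height h by auto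
        then have "a = h" using lattice_discrete[OF h0, of a h] lattice_least_pos[OF h0, of a] a
          by (auto simp: lattice_def intro: image_eqI[of _ _ 1])
        obtain k :: int where k: "v = h * of_int k" using v h h0 by (auto simp: lattice_def)
        then have "k \<ge> 0" using v h0 by (simp add: zero_le_mult_iff)
        then have "v = real (nat k) * a" using k \<open>a = h\<close> by simp
        then show ?thesis using mult[OF a(1), of "nat k"] \<open>\<epsilon> > 0\<close> by (intro bexI[of _ v]) auto
      qed
    qed
    show ?thesis unfolding U using 1 2 True by (auto simp: renewal_range_def)
  qed
qed

lemma iid_walk_uminus: "iid_walk M (\<lambda>n \<omega>. - X n \<omega>)"
proof unfold_locales
  show "indep_vars (\<lambda>_. borel) (\<lambda>n \<omega>. - X n \<omega>) UNIV"
    by (rule indep_vars_compose2[OF indep, where Y="\<lambda>_. uminus"]) simp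
  fix n
  have "distr M borel (\<lambda>\<omega>. - X k \<omega>) = distr (distr M borel (X k)) borel uminus" for k
    by (subst distr_distr) (simp_all add: o_def)
  then show "distr M borel (\<lambda>\<omega>. - X n \<omega>) = distr M borel (\<lambda>\<omega>. - X 0 \<omega>)"
    using ident[of n] by simp
qed

lemma msupp_law_uminus: "msupp (distr M borel (\<lambda>\<omega>. - X 0 \<omega>)) = uminus ` msupp law"
  by (rule msupp_distr_uminus) simp

end

lemma (in iid_walk) msupp_U_minus:
  assumes pos: "\<exists>y\<in>msupp law. y > 0"
  shows "msupp (U_minus M X) = uminus ` renewal_range (uminus ` msupp law)"
proof -
  interpret R: iid_walk M "\<lambda>n \<omega>. - X n \<omega>" by (rule iid_walk_uminus)
  have "msupp (defective_law M X {..<0}) = uminus ` msupp (defective_law M (\<lambda>n \<omega>. - X n \<omega>) {0<..})"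
  proof (rule msupp_uminusI)
    fix G :: "real set" assume "open G"
    then have "G \<in> sets borel" "uminus ` G \<in> sets borel"
      using open_negations[of G] by (simp_all add: borel_open)
    moreover have "uminus ` {..<0} = ({0<..} :: real set)" by simp
    ultimately show "emeasure (defective_law M X {..<0}) G = emeasure (defective_law M (\<lambda>n \<omega>. - X n \<omega>) {0<..}) (uminus ` G)"
      using enters_uminus[of X "{..<0}"] entrance_uminus[of X "{..<0}"]
      by (simp add: emeasure_defective_law R.emeasure_defective_law inj_image_mem_iff[OF inj_uminus])
  qed
  then have "msupp (U_minus M X) = uminus ` closure (additive_hull (msupp (defective_law M (\<lambda>n \<omega>. - X n \<omega>) {0<..})))"
    unfolding U_minus_def
    by (subst msupp_renewal_measure) (simp_all add: finite_defective_law closure_additive_hull_uminus)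
  also have "\<dots> = uminus ` msupp (U_plus M (\<lambda>n \<omega>. - X n \<omega>))"
    unfolding U_plus_def by (subst msupp_renewal_measure) (simp_all add: R.finite_defective_law)
  also have "\<dots> = uminus ` renewal_range (uminus ` msupp law)"
    using pos by (subst R.msupp_U_plus) (auto simp: msupp_law_uminus)
  finally show ?thesis .
qed

section \<open>The support of the measure \<open>\<mu>\<close>\<close>

locale switching_walks = X: iid_walk M X + X': iid_walk M X'
  for M :: "'a measure" and X X' :: "nat \<Rightarrow> 'a \<Rightarrow> real" +
  fixes \<alpha> :: real
  assumes \<alpha>: "0 \<le> \<alpha>" "\<alpha> \<le> 1"
    and neg: "\<exists>y\<in>msupp X.law. y < 0" and pos: "\<exists>y\<in>msupp X'.law. y > 0"
begin

abbreviation "S \<equiv> msupp X.law"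
abbreviation "S' \<equiv> msupp X'.law"
definition d where "d = joint_span X.law X'.law"

lemma hull_lattice: "d \<ge> 0" "closure (additive_hull (S \<union> S')) = lattice d"
proof -
  obtain u where u: "u \<ge> 0" "closure (additive_hull (S \<union> S')) = lattice u"
    using neg pos closure_additive_hull_lattice[of _ "S \<union> S'"] by (metis UnCI)
  have "joint_span X.law X'.law = u"
    unfolding joint_span_def
  proof (rule lattice_greatest[OF u])
    fix v :: real assume "v \<ge> 0"
    interpret L: prob_space X.law by (rule X.prob_space_law)
    interpret L': prob_space X'.law by (rule X'.prob_space_law)
    have one: "x * y = 1 \<longleftrightarrow> x = 1 \<and> y = 1" if "0 \<le> x" "0 \<le> y" "x \<le> 1" "y \<le> 1" for x y :: real
      using that mult_left_le[of y x] mult_left_le[of x y] by (auto simp: mult.commute intro: antisym)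
    have "measure X.law (lattice v) * measure X'.law (lattice v) = 1 \<longleftrightarrow>
        measure X.law (lattice v) = 1 \<and> measure X'.law (lattice v) = 1"
      by (intro one) auto
    also have "\<dots> \<longleftrightarrow> S \<union> S' \<subseteq> lattice v"
      using \<open>v \<ge> 0\<close> by (simp add: measure_eq_1_iff_msupp_subset X.prob_space_law X'.prob_space_law)
    finally show "measure X.law (lattice v) * measure X'.law (lattice v) = 1 \<longleftrightarrow> S \<union> S' \<subseteq> lattice v" .
  qed
  then show "d \<ge> 0" "closure (additive_hull (S \<union> S')) = lattice d" using u by (auto simp: d_def)
qed

sublocale supports: switching_supports \<alpha> d S S'
  using \<alpha> neg pos hull_lattice by unfold_locales auto

lemma height_measurable [measurable]:
  "D_height X \<in> borel_measurable M" "A_height X' \<in> borel_measurable M"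
  unfolding D_height_def A_height_def by auto

lemma D_nonpos: "D_height X \<omega> \<le> 0"
  using entrance_nonneg[of "\<lambda>n \<omega>. - X n \<omega>" \<omega>] A_height_uminus[of X \<omega>] by (simp add: A_height_def)

lemma A_nonneg: "A_height X' \<omega> \<ge> 0"
  using entrance_nonneg[of X' \<omega>] by (simp add: A_height_def)

text \<open>A first increment of the right sign is already the ladder height. With both
  probabilities positive, the denominator in \<open>nu_coeff\<close> does not vanish.\<close>

lemma prob_heights_pos: "\<P>(\<omega> in M. D_height X \<omega> < 0) > 0" "\<P>(\<omega> in M. A_height X' \<omega> > 0) > 0"
proof -
  have "X.prob {\<omega> \<in> space M. X 0 \<omega> \<in> {..<0}} > 0"
    using neg by (subst X.prob_increment_pos_iff) auto
  also have "X.prob {\<omega> \<in> space M. X 0 \<omega> \<in> {..<0}} \<le> \<P>(\<omega> in M. D_height X \<omega> < 0)"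
    unfolding D_height_def
    by (intro X.finite_measure_mono) (auto simp: entrance_first)
  finally show "\<P>(\<omega> in M. D_height X \<omega> < 0) > 0" .
  have "X.prob {\<omega> \<in> space M. X' 0 \<omega> \<in> {0<..}} > 0"
    using pos by (subst X'.prob_increment_pos_iff) auto
  also have "X.prob {\<omega> \<in> space M. X' 0 \<omega> \<in> {0<..}} \<le> \<P>(\<omega> in M. A_height X' \<omega> > 0)"
    unfolding A_height_def
    by (intro X.finite_measure_mono) (auto simp: entrance_first)
  finally show "\<P>(\<omega> in M. A_height X' \<omega> > 0) > 0" .
qed

abbreviation "a \<equiv> nu_coeff M \<alpha> X X'"

text \<open>The coefficient attains 0 or 1 exactly when \<alpha> does, so supports may be expressed
  with \<alpha> in its place.\<close>

lemma nu_coeff: "0 \<le> a" "a \<le> 1" "a < 1 \<longleftrightarrow> \<alpha> < 1" "0 < a \<longleftrightarrow> 0 < \<alpha>"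
proof -
  define p where "p = \<P>(\<omega> in M. D_height X \<omega> < 0)"
  define p' where "p' = \<P>(\<omega> in M. A_height X' \<omega> > 0)"
  have p: "p > 0" "p' > 0" unfolding p_def p'_def by (rule prob_heights_pos)+
  define u v where "u = p * \<alpha>" "v = p' * (1 - \<alpha>)"
  have uv: "u \<ge> 0" "v \<ge> 0" "u > 0 \<longleftrightarrow> \<alpha> > 0" "v > 0 \<longleftrightarrow> \<alpha> < 1"
    using p \<alpha> by (auto simp: u_v_def zero_less_mult_iff)
  have "u + v > 0" using uv \<alpha> by (cases "\<alpha> > 0") (auto simp: add_pos_nonneg add_nonneg_pos)
  moreover have "a = u / (u + v)" by (simp add: nu_coeff_def Let_def u_v_def p_def p'_def)
  ultimately show "0 \<le> a" "a \<le> 1" "a < 1 \<longleftrightarrow> \<alpha> < 1" "0 < a \<longleftrightarrow> 0 < \<alpha>"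
    using uv by (auto simp: divide_less_eq divide_le_eq zero_less_divide_iff)
qed

abbreviation "f \<equiv> nu_density M \<alpha> X X'"

text \<open>The point masses are not monotone in \<open>x\<close>, but they are differences of two
  monotone distribution functions.\<close>

lemma nu_density_measurable [measurable]: "f \<in> borel_measurable borel"
proof -
  have mono: "(\<lambda>x. \<P>(\<omega> in M. D \<omega> < x)) \<in> borel_measurable borel" "(\<lambda>x. \<P>(\<omega> in M. D \<omega> \<le> x)) \<in> borel_measurable borel"
    if [measurable]: "D \<in> borel_measurable M" for D :: "'a \<Rightarrow> real"
    by (intro borel_measurable_mono monoI X.finite_measure_mono; force)+
  have eq: "(\<lambda>x. \<P>(\<omega> in M. D \<omega> = x)) = (\<lambda>x. \<P>(\<omega> in M. D \<omega> \<le> x) - \<P>(\<omega> in M. D \<omega> < x))"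
    if [measurable]: "D \<in> borel_measurable M" for D :: "'a \<Rightarrow> real"
  proof
    fix x
    have "{\<omega> \<in> space M. D \<omega> = x} = {\<omega> \<in> space M. D \<omega> \<le> x} - {\<omega> \<in> space M. D \<omega> < x}" by auto
    then show "\<P>(\<omega> in M. D \<omega> = x) = \<P>(\<omega> in M. D \<omega> \<le> x) - \<P>(\<omega> in M. D \<omega> < x)"
      by (simp add: X.finite_measure_Diff subset_iff)
  qed
  have gt: "(\<lambda>x. \<P>(\<omega> in M. x < D \<omega>)) = (\<lambda>x. 1 - \<P>(\<omega> in M. D \<omega> \<le> x))"
    if [measurable]: "D \<in> borel_measurable M" for D :: "'a \<Rightarrow> real"
  proof
    fix x
    have "{\<omega> \<in> space M. x < D \<omega>} = space M - {\<omega> \<in> space M. D \<omega> \<le> x}" by auto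
    then show "\<P>(\<omega> in M. x < D \<omega>) = 1 - \<P>(\<omega> in M. D \<omega> \<le> x)" by (simp add: X.prob_compl)
  qed
  note [measurable] = mono[OF height_measurable(1)] mono[OF height_measurable(2)]
  show ?thesis unfolding nu_density_def[abs_def] eq[OF height_measurable(1)] eq[OF height_measurable(2)] gt[OF height_measurable(2)]
    by measurable
qed

text \<open>Above 0 the first term equals 1 and cancels the \<open>- 1\<close>, since
  \<open>D_height\<close> is at most 0 everywhere. What remains is a tail of \<open>A_height\<close>
  plus a multiple of its atom.\<close>

lemma nu_density_positive_iff:
  assumes "x > 0"
  shows "f x > 0 \<longleftrightarrow> \<P>(\<omega> in M. A_height X' \<omega> > x) > 0 \<or> \<alpha> < 1 \<and> \<P>(\<omega> in M. A_height X' \<omega> = x) > 0"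
proof -
  have "D_height X \<omega> < x" for \<omega> using D_nonpos[of \<omega>] assms by simp
  moreover from this have "D_height X \<omega> \<noteq> x" for \<omega> by (metis less_irrefl)
  ultimately have "f x = \<P>(\<omega> in M. A_height X' \<omega> > x) + (1 - a) * \<P>(\<omega> in M. A_height X' \<omega> = x)"
    by (simp add: nu_density_def X.prob_space)
  moreover have "(1 - a) * \<P>(\<omega> in M. A_height X' \<omega> = x) > 0 \<longleftrightarrow> \<alpha> < 1 \<and> \<P>(\<omega> in M. A_height X' \<omega> = x) > 0"
    using nu_coeff by (auto simp: zero_less_mult_iff not_less)
  moreover have "(1 - a) * \<P>(\<omega> in M. A_height X' \<omega> = x) \<ge> 0" using nu_coeff by simp
  moreover have "\<P>(\<omega> in M. A_height X' \<omega> > x) \<ge> 0" by simp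
  ultimately show ?thesis by linarith
qed

text \<open>At 0 the density is the convex combination \<open>(1 - a) * p + a * p'\<close> of two
  positive numbers.\<close>

lemma nu_density_0: "f 0 > 0"
proof -
  define p where "p = \<P>(\<omega> in M. D_height X \<omega> < 0)"
  define p' where "p' = \<P>(\<omega> in M. A_height X' \<omega> > 0)"
  have p: "p > 0" "p' > 0" unfolding p_def p'_def by (rule prob_heights_pos)+
  have "{\<omega> \<in> space M. D_height X \<omega> = 0} = space M - {\<omega> \<in> space M. D_height X \<omega> < 0}"
    using D_nonpos by (auto simp: not_less intro: antisym)
  then have D: "\<P>(\<omega> in M. D_height X \<omega> = 0) = 1 - p" by (simp add: X.prob_compl p_def)
  have "{\<omega> \<in> space M. A_height X' \<omega> = 0} = space M - {\<omega> \<in> space M. A_height X' \<omega> > 0}"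
    using A_nonneg by (auto simp: not_less intro: antisym)
  then have A: "\<P>(\<omega> in M. A_height X' \<omega> = 0) = 1 - p'" by (simp add: X.prob_compl p'_def)
  have "f 0 = (1 - a) * p + a * p'"
    unfolding nu_density_def D A by (simp add: p_def[symmetric] p'_def[symmetric] algebra_simps)
  also have "\<dots> > 0"
    using p nu_coeff(1,2) by (cases "a = 0") (auto intro!: add_nonneg_pos)
  finally show ?thesis .
qed

text \<open>A first increment above \<open>x\<close> is itself the ladder height; conversely a
  ladder height is at most one of the increments, and these lie in the support almost
  surely.\<close>

lemma prob_A_height_gt_iff:
  assumes "x \<ge> 0"
  shows "\<P>(\<omega> in M. A_height X' \<omega> > x) > 0 \<longleftrightarrow> (\<exists>q\<in>S'. x < q)"
proof
  assume "\<exists>q\<in>S'. x < q"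
  then have "X.prob {\<omega> \<in> space M. X' 0 \<omega> \<in> {x<..}} > 0"
    by (subst X'.prob_increment_pos_iff) auto
  also have "X.prob {\<omega> \<in> space M. X' 0 \<omega> \<in> {x<..}} \<le> \<P>(\<omega> in M. A_height X' \<omega> > x)"
    unfolding A_height_def
  proof (intro X.finite_measure_mono subsetI CollectI)
    fix \<omega> assume \<omega>: "\<omega> \<in> {\<omega> \<in> space M. X' 0 \<omega> \<in> {x<..}}"
    then have "entrance X' {0..} \<omega> = X' 0 \<omega>" using assms by (intro entrance_first) auto
    then show "\<omega> \<in> space M \<and> x < entrance X' {0..} \<omega>" using \<omega> by auto
  qed measurable
  finally show "\<P>(\<omega> in M. A_height X' \<omega> > x) > 0" .
next
  assume P: "\<P>(\<omega> in M. A_height X' \<omega> > x) > 0"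
  show "\<exists>q\<in>S'. x < q"
  proof (rule ccontr)
    assume neg: "\<not> (\<exists>q\<in>S'. x < q)"
    have "AE \<omega> in M. \<not> A_height X' \<omega> > x"
      using X'.AE_increments
    proof eventually_elim
      case (elim \<omega>)
      show ?case
      proof
        assume "A_height X' \<omega> > x"
        then obtain n where "A_height X' \<omega> \<le> X' n \<omega>"
          using entrance_nonneg_le_increment[of X' \<omega>] assms by (auto simp: A_height_def)
        then have "x < X' n \<omega>" using \<open>A_height X' \<omega> > x\<close> by linarith
        then show False using elim neg by auto
      qed
    qed
    then have "\<P>(\<omega> in M. A_height X' \<omega> > x) = 0" by (subst X.prob_eq_0) auto
    then show False using P by simp
  qed
qed

lemma prob_A_height_eq_imp:
  assumes "x > 0" "\<P>(\<omega> in M. A_height X' \<omega> = x) > 0"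
  shows "\<exists>q\<in>S'. x \<le> q"
proof (rule ccontr)
  assume neg: "\<not> (\<exists>q\<in>S'. x \<le> q)"
  have "AE \<omega> in M. A_height X' \<omega> \<noteq> x"
    using X'.AE_increments
  proof eventually_elim
    case (elim \<omega>)
    show ?case
    proof
      assume A: "A_height X' \<omega> = x"
      then obtain n where "A_height X' \<omega> \<le> X' n \<omega>"
        using entrance_nonneg_le_increment[of X' \<omega>] assms by (auto simp: A_height_def)
      then show False using elim neg A by auto
    qed
  qed
  then have "\<P>(\<omega> in M. A_height X' \<omega> = x) = 0" by (subst X.prob_eq_0) auto
  then show False using assms by simp
qed

text \<open>In the lattice case a support point is an atom: almost surely an increment in the ball
  of radius \<open>d\<close> around \<open>x\<close> equals \<open>x\<close>.\<close>

lemma prob_A_height_eq_lattice: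
  assumes "d > 0" "x \<in> S'" "x > 0"
  shows "\<P>(\<omega> in M. A_height X' \<omega> = x) > 0"
proof -
  have "X.prob {\<omega> \<in> space M. X' 0 \<omega> \<in> ball x d} > 0"
    using assms by (subst X'.prob_increment_pos_iff) (auto intro!: bexI[of _ x])
  also have "X.prob {\<omega> \<in> space M. X' 0 \<omega> \<in> ball x d} \<le> \<P>(\<omega> in M. A_height X' \<omega> = x)"
  proof (rule X.finite_measure_mono_AE)
    show "AE \<omega> in M. \<omega> \<in> {\<omega> \<in> space M. X' 0 \<omega> \<in> ball x d} \<longrightarrow> \<omega> \<in> {\<omega> \<in> space M. A_height X' \<omega> = x}"
      using X'.AE_increments
    proof eventually_elim
      case (elim \<omega>)
      show ?case
      proof
        assume \<omega>: "\<omega> \<in> {\<omega> \<in> space M. X' 0 \<omega> \<in> ball x d}"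
        have "X' 0 \<omega> \<in> lattice d" "x \<in> lattice d" using elim assms supports.supports_subset by auto
        then have "X' 0 \<omega> = x" using \<omega> by (intro lattice_discrete[OF assms(1)]) (auto simp: dist_real_def)
        then have "entrance X' {0..} \<omega> = x" using assms(3) entrance_first[of X' \<omega> "{0..}"] by auto
        then show "\<omega> \<in> {\<omega> \<in> space M. A_height X' \<omega> = x}" using \<omega> by (simp add: A_height_def)
      qed
    qed
  qed measurable
  finally show ?thesis .
qed

abbreviation "plus_density \<equiv> (\<lambda>x. ennreal (f x) * (indicator {0<..} x + ennreal \<alpha> * indicator {0} x))"

lemma plus_part_density: "plus_part \<alpha> (nu M \<alpha> X X') = density (haar d) plus_density"
  unfolding plus_part_def nu_def d_def by (subst density_density_eq) auto

lemma plus_density_pos: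
  "plus_density x > 0 \<longleftrightarrow> x > 0 \<and> f x > 0 \<or> x = 0 \<and> \<alpha> > 0"
  using nu_density_0 by (cases x "0::real" rule: linorder_cases) (auto simp: ennreal_zero_less_mult_iff)

lemma msupp_plus_part: "msupp (plus_part \<alpha> (nu M \<alpha> X X')) = overshoot_range \<alpha> d S'"
proof (cases "d = 0")
  case False
  then have d: "d > 0" using hull_lattice by simp
  have "f x > 0 \<longleftrightarrow> (\<exists>q\<in>S'. x < q) \<or> \<alpha> < 1 \<and> x \<in> S'" if "x > 0" for x
  proof -
    have "\<P>(\<omega> in M. A_height X' \<omega> > x) > 0 \<longleftrightarrow> (\<exists>q\<in>S'. x < q)"
      using that by (intro prob_A_height_gt_iff) simp
    moreover have "(\<exists>q\<in>S'. x < q) \<or> x \<in> S'" if "\<P>(\<omega> in M. A_height X' \<omega> = x) > 0"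
      using prob_A_height_eq_imp[OF \<open>x > 0\<close> that] by (auto simp: le_less)
    moreover have "\<P>(\<omega> in M. A_height X' \<omega> = x) > 0" if "x \<in> S'"
      using prob_A_height_eq_lattice[OF d that \<open>x > 0\<close>] .
    ultimately show ?thesis unfolding nu_density_positive_iff[OF that] by blast
  qed
  then show ?thesis unfolding plus_part_density
    using d by (subst msupp_density_haar_lattice) (auto simp: overshoot_range_def plus_density_pos)
next
  case True
  have em: "emeasure (density lborel plus_density) G = (\<integral>\<^sup>+x. plus_density x * indicator G x \<partial>lborel)" if "open G" for G
    using that by (subst emeasure_density) auto
  show ?thesis unfolding plus_part_density True
  proof (intro set_eqI iffI)
    fix t assume t: "t \<in> msupp (density (haar 0) plus_density)"
    have "t \<ge> 0 \<and> (\<exists>q\<in>S'. t < q + \<epsilon>)" if "\<epsilon> > 0" for \<epsilon>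
    proof (rule ccontr)
      assume n: "\<not> (t \<ge> 0 \<and> (\<exists>q\<in>S'. t < q + \<epsilon>))"
      \<comment> \<open>An open set on which the density vanishes except possibly at 0, a Lebesgue
        null set: either \<open>G\<close> is the negative half-line, or no element of
        \<open>S'\<close> lies in \<open>G\<close>.\<close>
      define G where "G = (if t \<ge> 0 then {t - \<epsilon><..} else {..<0})"
      have G: "open G" "t \<in> G" using that by (auto simp: G_def)
      have "plus_density x * indicator G x = 0" if "x \<noteq> 0" for x
      proof (cases "x \<in> G \<and> x > 0")
        case c: True
        have "\<not> f x > 0"
        proof
          assume "f x > 0"
          then obtain q where "q \<in> S'" "x \<le> q"
            using prob_A_height_gt_iff[of x] prob_A_height_eq_imp[of x] c
            by (auto simp: nu_density_positive_iff intro: less_imp_le)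
          then show False using n c by (auto simp: G_def split: if_splits)
        qed
        then show ?thesis by (simp add: ennreal_neg)
      next
        case False
        then show ?thesis using that by (auto simp: indicator_def)
      qed
      then have "AE x in lborel. plus_density x * indicator G x = 0"
        using AE_lborel_singleton[of "0::real"] by (auto elim!: eventually_mono)
      then have "(\<integral>\<^sup>+x. plus_density x * indicator G x \<partial>lborel) = (\<integral>\<^sup>+x. 0 \<partial>(lborel :: real measure))" by (rule nn_integral_cong_AE)
      then show False using msupp_open[OF t G] em[OF G(1)] by (simp add: haar_def)
    qed
    from this this[of 1] show "t \<in> overshoot_range \<alpha> 0 S'" by (auto simp: overshoot_range_def)
  next
    fix t assume t: "t \<in> overshoot_range \<alpha> 0 S'"
    show "t \<in> msupp (density (haar 0) plus_density)"
      unfolding msupp_def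
    proof (intro CollectI allI impI)
      fix G assume G: "open G" "t \<in> G"
      then obtain r where r: "r > 0" "ball t r \<subseteq> G" by (metis openE)
      obtain q1 where q1: "q1 \<in> S'" "t < q1 + r" using overshoot_rangeD[OF t r(1)] by auto
      obtain q0 where q0: "q0 \<in> S'" "q0 > 0" using pos by auto
      define q where "q = max q0 q1"
      have q: "q \<in> S'" "q > 0" "t < q + r" using q0 q1 by (auto simp: q_def max_def)
      \<comment> \<open>An interval of positive length inside \<open>G\<close>, to the right of 0
        and below some \<open>q\<close> in \<open>S'\<close>, where the tail of
        \<open>A_height\<close> is positive. It exists even if \<open>t\<close> is 0 or the supremum
        of \<open>S'\<close>.\<close>
      define l u where "l = max 0 (t - r)" "u = min q (t + r)"
      have "l < u" using q r overshoot_range_nonneg[OF t] by (auto simp: l_u_def)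
      have pos: "plus_density x > 0" if "x \<in> {l<..<u}" for x
        using that q prob_A_height_gt_iff[of x] by (auto simp: plus_density_pos nu_density_positive_iff l_u_def)
      have sub: "{l<..<u} \<subseteq> G" using r by (auto simp: l_u_def subset_iff dist_real_def)
      have "emeasure (density lborel plus_density) G \<noteq> 0"
      proof
        assume "emeasure (density lborel plus_density) G = 0"
        then have "AE x in lborel. plus_density x * indicator G x = 0"
          using G(1) unfolding em[OF G(1)] by (subst (asm) nn_integral_0_iff_AE) auto
        then have "AE x in lborel. x \<notin> {l<..<u}"
          by eventually_elim (use pos sub in \<open>force simp: indicator_def\<close>)
        then have "emeasure lborel {x \<in> space lborel. \<not> x \<notin> {l<..<u}} = 0"
          by (subst (asm) AE_iff_measurable[OF _ refl]) auto
        also have "{x \<in> space lborel. \<not> x \<notin> {l<..<u}} = {l<..<u}" by auto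
        finally have "emeasure lborel {l<..<u} = 0" .
        then show False using \<open>l < u\<close> by simp
      qed
      then show "emeasure (density (haar 0) plus_density) G > 0" by (simp add: haar_def zero_less_iff_neq_zero)
    qed
  qed
qed

lemma sigma_finite_plus_part: "sigma_finite_measure (plus_part \<alpha> (nu M \<alpha> X X'))"
proof -
  interpret H: sigma_finite_measure "haar d" by (rule sigma_finite_haar[OF hull_lattice(1)])
  show ?thesis unfolding plus_part_density
    by (subst H.sigma_finite_iff_density_finite) (auto simp: ennreal_mult_eq_top_iff indicator_def)
qed

lemma switching_walks_reflect: "switching_walks M (\<lambda>n \<omega>. - X' n \<omega>) (\<lambda>n \<omega>. - X n \<omega>) (1 - \<alpha>)"
proof -
  interpret R: iid_walk M "\<lambda>n \<omega>. - X n \<omega>" by (rule X.iid_walk_uminus)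
  interpret R': iid_walk M "\<lambda>n \<omega>. - X' n \<omega>" by (rule X'.iid_walk_uminus)
  show ?thesis
    using \<alpha> neg pos by unfold_locales (auto simp: X.msupp_law_uminus X'.msupp_law_uminus)
qed

end

section \<open>Transfer to the lower half-line and the support of \<mu>\<close>

context switching_walks
begin

interpretation refl: switching_walks M "\<lambda>n \<omega>. - X' n \<omega>" "\<lambda>n \<omega>. - X n \<omega>" "1 - \<alpha>"
  by (rule switching_walks_reflect)

lemma refl_d: "refl.d = d"
proof -
  have "lattice refl.d = lattice d"
    using refl.hull_lattice(2)
      switching_supports.hull[OF switching_supports_reflect[OF supports.switching_supports_axioms]]
    by (simp add: X.msupp_law_uminus X'.msupp_law_uminus)
  then show ?thesis
    using lattice_subset_imp_le[OF hull_lattice(1) refl.hull_lattice(1)]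
      lattice_subset_imp_le[OF refl.hull_lattice(1) hull_lattice(1)] by (metis antisym order_refl)
qed

lemma nu_coeff_reflect: "refl.a = 1 - a"
proof -
  define p where "p = \<P>(\<omega> in M. D_height X \<omega> < 0)"
  define p' where "p' = \<P>(\<omega> in M. A_height X' \<omega> > 0)"
  have a: "a = p * \<alpha> / (p * \<alpha> + p' * (1 - \<alpha>))" by (simp add: nu_coeff_def p_def p'_def Let_def)
  have a': "refl.a = p' * (1 - \<alpha>) / (p' * (1 - \<alpha>) + p * \<alpha>)"
    unfolding nu_coeff_def Let_def D_height_uminus A_height_uminus p_def p'_def by simp
  have "p * \<alpha> + p' * (1 - \<alpha>) \<noteq> 0"
  proof
    assume "p * \<alpha> + p' * (1 - \<alpha>) = 0"
    \<comment> \<open>Division by zero yields 0, so both coefficients would vanish, although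
      \<alpha> or 1 - \<alpha> is positive.\<close>
    then have "a = 0" "refl.a = 0" unfolding a a' by (simp_all add: add.commute)
    then show False using nu_coeff(4) refl.nu_coeff(4) \<alpha> by linarith
  qed
  then have "(p * \<alpha> + p' * (1 - \<alpha>)) / (p * \<alpha> + p' * (1 - \<alpha>)) = 1" by simp
  then have "a + refl.a = 1" unfolding a a' add_divide_distrib by (simp add: add.commute)
  then show ?thesis by simp
qed

lemma nu_density_reflect: "refl.f x = f (- x)"
  unfolding nu_density_def nu_coeff_reflect D_height_uminus A_height_uminus
  by (simp add: minus_less_iff less_minus_iff equation_minus_iff minus_equation_iff eq_commute[of "- x"])

lemma minus_part_density: "minus_part \<alpha> (nu M \<alpha> X X') = density (haar d) (\<lambda>x. refl.plus_density (- x))"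
proof -
  have "minus_part \<alpha> (nu M \<alpha> X X') = density (haar d) (\<lambda>x. ennreal (f x) * (indicator {..<0} x + ennreal (1 - \<alpha>) * indicator {0} x))"
    unfolding minus_part_def nu_def d_def by (subst density_density_eq) auto
  also have "\<dots> = density (haar d) (\<lambda>x. refl.plus_density (- x))"
    by (intro arg_cong[where f="density (haar d)"] ext) (auto simp: nu_density_reflect indicator_def)
  finally show ?thesis .
qed

lemma sigma_finite_minus_part: "sigma_finite_measure (minus_part \<alpha> (nu M \<alpha> X X'))"
proof -
  interpret H: sigma_finite_measure "haar d" by (rule sigma_finite_haar[OF hull_lattice(1)])
  show ?thesis unfolding minus_part_density
    by (subst H.sigma_finite_iff_density_finite) (auto simp: ennreal_mult_eq_top_iff indicator_def)
qed

lemma msupp_minus_part: "msupp (minus_part \<alpha> (nu M \<alpha> X X')) = uminus ` overshoot_range (1 - \<alpha>) d (uminus ` S)"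
proof -
  have "msupp (minus_part \<alpha> (nu M \<alpha> X X')) = uminus ` msupp (density (haar d) refl.plus_density)"
    unfolding minus_part_density by (rule msupp_density_uminus) (auto simp: hull_lattice)
  also have "density (haar d) refl.plus_density = plus_part (1 - \<alpha>) (nu M (1 - \<alpha>) (\<lambda>n \<omega>. - X' n \<omega>) (\<lambda>n \<omega>. - X n \<omega>))"
    unfolding refl.plus_part_density refl_d ..
  also have "msupp \<dots> = overshoot_range (1 - \<alpha>) d (uminus ` S)"
    unfolding refl.msupp_plus_part by (simp add: refl_d X.msupp_law_uminus)
  finally show ?thesis .
qed

lemma msupp_mu: "msupp (mu M \<alpha> X X') = full_range \<alpha> d S S'"
proof -
  have sets: "sets (U_plus M X) = sets borel" "sets (U_minus M X') = sets borel"
    "sets (plus_part \<alpha> (nu M \<alpha> X X')) = sets borel" "sets (minus_part \<alpha> (nu M \<alpha> X X')) = sets borel"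
    by (auto simp: U_plus_def U_minus_def plus_part_def minus_part_def nu_def)
  have "msupp (mu M \<alpha> X X') = msupp (convolution (U_plus M X) (plus_part \<alpha> (nu M \<alpha> X X')))
      \<union> msupp (convolution (U_minus M X') (minus_part \<alpha> (nu M \<alpha> X X')))"
    unfolding mu_def by (rule msupp_add_measure) auto
  also have "msupp (convolution (U_plus M X) (plus_part \<alpha> (nu M \<alpha> X X'))) = closure (renewal_range S + overshoot_range \<alpha> d S')"
    using sets neg by (simp add: msupp_convolution sigma_finite_plus_part X.msupp_U_plus msupp_plus_part)
  also have "\<dots> = upper_range \<alpha> d S S'"
    using closed_upper_range[OF hull_lattice(1), of \<alpha> S S'] by (simp add: upper_range_def add.commute)
  also have "msupp (convolution (U_minus M X') (minus_part \<alpha> (nu M \<alpha> X X'))) =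
      closure (uminus ` renewal_range (uminus ` S') + uminus ` overshoot_range (1 - \<alpha>) d (uminus ` S))"
    using sets pos by (simp add: msupp_convolution sigma_finite_minus_part X'.msupp_U_minus msupp_minus_part)
  also have "\<dots> = closure (lower_range \<alpha> d S S')"
    by (simp add: lower_range_def upper_range_def uminus_image_plus add.commute)
  also have "\<dots> = lower_range \<alpha> d S S'"
    unfolding lower_range_def by (intro closure_closed closed_negations closed_upper_range hull_lattice)
  finally show ?thesis by (simp add: full_range_def)
qed

end

section \<open>Spans as generators of the closed hulls\<close>

lemma (in iid_walk) lattice_span_of:
  assumes "\<exists>y\<in>msupp law. y > 0" "\<exists>y\<in>msupp law. y < 0"
  shows "lattice (span_of law) = closure (additive_hull (msupp law))"
proof -
  obtain u where u: "u \<ge> 0" "closure (additive_hull (msupp law)) = lattice u"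
    using assms closure_additive_hull_lattice by metis
  have "span_of law = u"
    unfolding span_of_def
    by (rule lattice_greatest[OF u], rule measure_eq_1_iff_msupp_subset) (auto simp: prob_space_law)
  then show ?thesis using u by simp
qed

lemma (in iid_walk) renewal_range_law:
  assumes "\<exists>y\<in>msupp law. y < 0"
  shows "renewal_range (msupp law) = (if \<P>(\<omega> in M. X 0 \<omega> > 0) \<noteq> 0 then lattice_pos (span_of law) else {0})"
proof -
  have "\<P>(\<omega> in M. X 0 \<omega> > 0) \<noteq> 0 \<longleftrightarrow> \<P>(\<omega> in M. X 0 \<omega> > 0) > 0" by (simp add: zero_less_measure_iff)
  also have "\<dots> \<longleftrightarrow> (\<exists>y\<in>msupp law. y > 0)" using prob_increment_pos_iff[of "{0<..}"] by simp
  finally show ?thesis using lattice_span_of assms by (simp add: renewal_range_def lattice_pos_def)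
qed

lemma (in iid_walk) renewal_range_law_uminus:
  assumes "\<exists>y\<in>msupp law. y > 0"
  shows "uminus ` renewal_range (uminus ` msupp law) =
    (if \<P>(\<omega> in M. X 0 \<omega> < 0) \<noteq> 0 then lattice_neg (span_of law) else {0})"
proof -
  have "\<P>(\<omega> in M. X 0 \<omega> < 0) \<noteq> 0 \<longleftrightarrow> \<P>(\<omega> in M. X 0 \<omega> < 0) > 0" by (simp add: zero_less_measure_iff)
  also have "\<dots> \<longleftrightarrow> (\<exists>y\<in>msupp law. y < 0)" using prob_increment_pos_iff[of "{..<0}"] by simp
  finally have iff: "\<P>(\<omega> in M. X 0 \<omega> < 0) \<noteq> 0 \<longleftrightarrow> (\<exists>y\<in>msupp law. y < 0)" .
  show ?thesis
  proof (cases "\<exists>y\<in>msupp law. y < 0")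
    case True
    have "uminus ` (uminus ` lattice (span_of law) \<inter> {0..}) = lattice (span_of law) \<inter> {..0}"
      by (auto simp: image_iff) (metis add.inverse_inverse neg_le_0_iff_le lattice_uminus_iff atLeast_iff IntI)
    then show ?thesis
      unfolding iff using True assms lattice_span_of
      by (auto simp: renewal_range_def lattice_neg_def closure_additive_hull_uminus)
  next
    case False
    then show ?thesis unfolding iff by (auto simp: renewal_range_def)
  qed
qed

section \<open>Markov chains killed outside a set\<close>

locale markov_chain =
  fixes K :: "real \<Rightarrow> real measure" and \<eta> :: "real measure"
  assumes kernel: "K \<in> borel \<rightarrow>\<^sub>M prob_algebra borel"
    and initial: "prob_space \<eta>" "sets \<eta> = sets borel"
begin

abbreviation "chain \<equiv> chain_law K \<eta>"

lemma kernel_subprob [measurable]: "K \<in> borel \<rightarrow>\<^sub>M subprob_algebra borel"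
  using kernel by (rule measurable_prob_algebraD)

lemma sets_kernel [simp]: "sets (K x) = sets borel"
  using measurable_space[OF kernel, of x] by (simp add: space_prob_algebra)

lemma kernel_emeasure_measurable [measurable]:
  "B \<in> sets borel \<Longrightarrow> (\<lambda>x. emeasure (K x) B) \<in> borel_measurable borel"
  by (rule measurable_emeasure_kernel[OF kernel_subprob])

sublocale prob_space chain
  by (rule prob_space_chain_law(1)[OF kernel initial])

lemma sets_chain [measurable_cong]: "sets chain = sets (PiM UNIV (\<lambda>_. borel))"
  by (rule prob_space_chain_law(2)[OF kernel initial])

lemma space_chain [simp]: "space chain = UNIV"
  using sets_eq_imp_space_eq[OF sets_chain] by (simp add: space_PiM)

lemma coordinate_measurable [measurable]: "(\<lambda>\<omega>. \<omega> n) \<in> chain \<rightarrow>\<^sub>M borel"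
  using measurable_component_singleton[of n UNIV "\<lambda>_. borel"] measurable_cong_sets[OF sets_chain refl] by auto

lemma emeasure_initial:
  assumes "B \<in> sets borel"
  shows "emeasure chain {\<omega>. \<omega> 0 \<in> B} = emeasure \<eta> B"
proof -
  have "emeasure chain {\<omega>. restrict \<omega> {0..<0} \<in> space (PiM {0..<0} (\<lambda>_. borel)) \<and> \<omega> 0 \<in> B} =
      (\<integral>\<^sup>+\<omega>. indicator (space (PiM {0..<0} (\<lambda>_. borel))) (restrict \<omega> {0..<0}) * emeasure (chain_step K \<eta> 0 \<omega>) B \<partial>chain)"
    by (rule chain_law_Markov[OF kernel initial sets.top assms])
  moreover have "restrict \<omega> {} = (\<lambda>_. undefined)" for \<omega> :: "nat \<Rightarrow> real" by auto
  ultimately show ?thesis by (simp add: chain_step_def space_PiM emeasure_space_1[unfolded space_chain])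
qed

text \<open>The constraint \<open>U\<close> may vary with time, so one statement covers a condition
  at a single instant, at all instants, or none at all.\<close>

lemma emeasure_step:
  fixes U :: "nat \<Rightarrow> real set"
  assumes [measurable]: "\<And>k. U k \<in> sets borel" "B \<in> sets borel"
  shows "emeasure chain {\<omega>. (\<forall>k\<le>n. \<omega> k \<in> U k) \<and> \<omega> (Suc n) \<in> B} =
    (\<integral>\<^sup>+\<omega>. indicator {\<omega>. \<forall>k\<le>n. \<omega> k \<in> U k} \<omega> * emeasure (K (\<omega> n)) B \<partial>chain)"
proof -
  let ?P = "PiM {0..<Suc n} (\<lambda>_. borel :: real measure)"
  define A where "A = {\<omega> \<in> space ?P. \<forall>k\<in>{..n}. \<omega> k \<in> U k}"
  have A: "A \<in> sets ?P" unfolding A_def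
  proof (rule sets.sets_Collect_finite_All')
    fix k assume "k \<in> {..n}"
    then have [measurable]: "(\<lambda>\<omega>. \<omega> k) \<in> ?P \<rightarrow>\<^sub>M borel" by (intro measurable_component_singleton) auto
    show "{\<omega> \<in> space ?P. \<omega> k \<in> U k} \<in> sets ?P" by measurable
  qed auto
  have mem: "restrict \<omega> {0..<Suc n} \<in> A \<longleftrightarrow> (\<forall>k\<le>n. \<omega> k \<in> U k)" for \<omega>
    by (auto simp: A_def space_PiM)
  have "emeasure chain {\<omega>. restrict \<omega> {0..<Suc n} \<in> A \<and> \<omega> (Suc n) \<in> B} =
      (\<integral>\<^sup>+\<omega>. indicator A (restrict \<omega> {0..<Suc n}) * emeasure (chain_step K \<eta> (Suc n) \<omega>) B \<partial>chain)"
    by (rule chain_law_Markov[OF kernel initial A assms(2)])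
  then show ?thesis by (simp add: mem chain_step_def indicator_def)
qed

lemma AE_initial:
  assumes "B \<in> sets borel" "emeasure \<eta> (- B) = 0"
  shows "AE \<omega> in chain. \<omega> 0 \<in> B"
proof (subst AE_iff_measurable[OF _ refl])
  show "{\<omega> \<in> space chain. \<omega> 0 \<notin> B} \<in> sets chain" using assms(1) by measurable
  show "emeasure chain {\<omega> \<in> space chain. \<omega> 0 \<notin> B} = 0"
    using emeasure_initial[of "- B"] assms by simp
qed

lemma AE_step:
  assumes [measurable]: "U \<in> sets borel" "B \<in> sets borel" and null: "\<And>x. x \<in> U \<Longrightarrow> emeasure (K x) (- B) = 0"
  shows "AE \<omega> in chain. \<omega> n \<in> U \<longrightarrow> \<omega> (Suc n) \<in> B"
proof (subst AE_iff_measurable[OF _ refl])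
  show "{\<omega> \<in> space chain. \<not> (\<omega> n \<in> U \<longrightarrow> \<omega> (Suc n) \<in> B)} \<in> sets chain" by measurable
  let ?U = "\<lambda>k. if k = n then U else UNIV"
  have "emeasure chain {\<omega>. (\<forall>k\<le>n. \<omega> k \<in> ?U k) \<and> \<omega> (Suc n) \<in> - B} =
      (\<integral>\<^sup>+\<omega>. indicator {\<omega>. \<forall>k\<le>n. \<omega> k \<in> ?U k} \<omega> * emeasure (K (\<omega> n)) (- B) \<partial>chain)"
    by (rule emeasure_step) auto
  also have "\<dots> = (\<integral>\<^sup>+\<omega>. 0 \<partial>chain)"
    by (intro nn_integral_cong) (auto simp: indicator_def null)
  also have "{\<omega>. (\<forall>k\<le>n. \<omega> k \<in> ?U k) \<and> \<omega> (Suc n) \<in> - B} = {\<omega> \<in> space chain. \<not> (\<omega> n \<in> U \<longrightarrow> \<omega> (Suc n) \<in> B)}"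
    by auto
  finally show "emeasure chain {\<omega> \<in> space chain. \<not> (\<omega> n \<in> U \<longrightarrow> \<omega> (Suc n) \<in> B)} = 0" by simp
qed

text \<open>The states from which \<open>G\<close> is hit with positive probability at exactly the
  n-th step, expressed by the kernel alone and hence free of the initial law.\<close>

primrec reaches :: "real set \<Rightarrow> nat \<Rightarrow> real set" where
  "reaches G 0 = G"
| "reaches G (Suc n) = {x. emeasure (K x) (reaches G n) > 0}"

lemma reaches_measurable: "G \<in> sets borel \<Longrightarrow> reaches G n \<in> sets borel"
proof (induction n)
  case (Suc n)
  note [measurable] = Suc.IH[OF Suc.prems]
  have "{x \<in> space borel. 0 < emeasure (K x) (reaches G n)} \<in> sets borel" by measurable
  then show ?case by simp
qed simp

text \<open>Points of a charged set may need different numbers of steps to reach \<open>G\<close>.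
  Since countable unions of null sets are null, one number of steps serves a charged part of the
  set.\<close>

lemma reaches_union:
  assumes "G \<in> sets borel" "B \<in> sets borel" "B \<subseteq> (\<Union>n. reaches G n)" "emeasure (K x) B > 0"
  obtains n where "x \<in> reaches G (Suc n)"
proof (rule ccontr)
  assume "\<not> thesis"
  then have "emeasure (K x) (reaches G n) = 0" for n
    using that[of n] by (auto simp: zero_less_iff_neq_zero)
  then have "(\<Union>n. reaches G n) \<in> null_sets (K x)"
    using reaches_measurable[OF assms(1)] by (intro null_sets_UN) (auto simp: null_sets_def)
  then have "emeasure (K x) B = 0"
    using assms(2,3) null_sets_subset[of "\<Union>n. reaches G n" "K x" B] by (auto simp: null_sets_def)
  then show False using assms(4) by simp
qed

lemma reaches_imp_prob_pos:
  assumes G: "G \<in> sets borel" and "emeasure chain {\<omega>. \<omega> k \<in> reaches G n} > 0"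
  shows "emeasure chain {\<omega>. \<omega> (k + n) \<in> G} > 0"
  using assms(2)
proof (induction n arbitrary: k)
  case (Suc n)
  note [measurable] = reaches_measurable[OF G]
  have "emeasure chain {\<omega>. (\<forall>j\<le>k. \<omega> j \<in> UNIV) \<and> \<omega> (Suc k) \<in> reaches G n} =
      (\<integral>\<^sup>+\<omega>. indicator {\<omega>. \<forall>j\<le>k. \<omega> j \<in> UNIV} \<omega> * emeasure (K (\<omega> k)) (reaches G n) \<partial>chain)"
    by (rule emeasure_step) auto
  then have eq: "emeasure chain {\<omega>. \<omega> (Suc k) \<in> reaches G n} = (\<integral>\<^sup>+\<omega>. emeasure (K (\<omega> k)) (reaches G n) \<partial>chain)"
    by simp
  have "emeasure chain {\<omega>. \<omega> (Suc k) \<in> reaches G n} \<noteq> 0"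
  proof
    assume "emeasure chain {\<omega>. \<omega> (Suc k) \<in> reaches G n} = 0"
    then have "AE \<omega> in chain. emeasure (K (\<omega> k)) (reaches G n) = 0"
      unfolding eq by (subst (asm) nn_integral_0_iff_AE) auto
    then have "AE \<omega> in chain. \<omega> k \<notin> reaches G (Suc n)" by eventually_elim auto
    then have "emeasure chain {\<omega> \<in> space chain. \<not> \<omega> k \<notin> reaches G (Suc n)} = 0"
      by (subst (asm) AE_iff_measurable[OF _ refl]) (use reaches_measurable[OF G, of "Suc n"] in measurable)
    then show False using Suc.prems by (simp add: zero_less_iff_neq_zero)
  qed
  then have "emeasure chain {\<omega>. \<omega> (Suc k + n) \<in> G} > 0" by (intro Suc.IH) (simp add: zero_less_iff_neq_zero)
  then show ?case by simp
qed simp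

text \<open>The Markov property for functions, obtained as an identity of measures: with
  \<open>Q\<close> the chain law restricted to paths in \<open>U\<close> up to time
  \<open>n\<close>, the law of the next state under \<open>Q\<close> is \<open>Q\<close> bound with
  the kernel.\<close>

lemma nn_integral_step:
  assumes [measurable]: "U \<in> sets borel" "g \<in> borel_measurable borel"
  shows "(\<integral>\<^sup>+\<omega>. indicator {\<omega>. \<forall>k\<le>n. \<omega> k \<in> U} \<omega> * g (\<omega> (Suc n)) \<partial>chain) =
    (\<integral>\<^sup>+\<omega>. indicator {\<omega>. \<forall>k\<le>n. \<omega> k \<in> U} \<omega> * (\<integral>\<^sup>+y. g y \<partial>K (\<omega> n)) \<partial>chain)"
proof -
  let ?C = "{\<omega> :: nat \<Rightarrow> real. \<forall>k\<le>n. \<omega> k \<in> U}"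
  have "{\<omega> \<in> space chain. \<forall>k\<le>n. \<omega> k \<in> U} \<in> sets chain" by measurable
  then have [measurable]: "?C \<in> sets chain" by simp
  define Q where "Q = density chain (indicator ?C)"
  have [measurable_cong]: "sets Q = sets chain" by (simp add: Q_def)
  have Ks [measurable]: "(\<lambda>\<omega>. K (\<omega> n)) \<in> Q \<rightarrow>\<^sub>M subprob_algebra borel" by measurable
  have "distr Q borel (\<lambda>\<omega>. \<omega> (Suc n)) = Q \<bind> (\<lambda>\<omega>. K (\<omega> n))"
  proof (rule measure_eqI)
    show "sets (distr Q borel (\<lambda>\<omega>. \<omega> (Suc n))) = sets (Q \<bind> (\<lambda>\<omega>. K (\<omega> n)))"
      by (subst sets_bind[where N=borel]) (auto simp: Q_def)
  next
    fix B assume "B \<in> sets (distr Q borel (\<lambda>\<omega>. \<omega> (Suc n)))"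
    then have [measurable]: "B \<in> sets borel" by simp
    have meas: "{\<omega>. \<omega> (Suc n) \<in> B} \<in> sets chain"
    proof -
      have "{\<omega> \<in> space chain. \<omega> (Suc n) \<in> B} \<in> sets chain" by measurable
      then show ?thesis by simp
    qed
    have "emeasure (distr Q borel (\<lambda>\<omega>. \<omega> (Suc n))) B = emeasure Q {\<omega>. \<omega> (Suc n) \<in> B}"
      by (subst emeasure_distr) (auto simp: Q_def vimage_def)
    also have "\<dots> = emeasure chain (?C \<inter> {\<omega>. \<omega> (Suc n) \<in> B})"
      unfolding Q_def using meas by (subst emeasure_density) (auto simp: indicator_inter_arith[symmetric])
    also have "?C \<inter> {\<omega>. \<omega> (Suc n) \<in> B} = {\<omega>. (\<forall>k\<le>n. \<omega> k \<in> U) \<and> \<omega> (Suc n) \<in> B}" by auto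
    also have "emeasure chain \<dots> = (\<integral>\<^sup>+\<omega>. indicator ?C \<omega> * emeasure (K (\<omega> n)) B \<partial>chain)"
      by (rule emeasure_step) auto
    also have "\<dots> = (\<integral>\<^sup>+\<omega>. emeasure (K (\<omega> n)) B \<partial>Q)"
      unfolding Q_def by (subst nn_integral_density) auto
    also have "\<dots> = emeasure (Q \<bind> (\<lambda>\<omega>. K (\<omega> n))) B"
      by (rule emeasure_bind[symmetric, where N=borel]) (auto simp: Q_def)
    finally show "emeasure (distr Q borel (\<lambda>\<omega>. \<omega> (Suc n))) B = emeasure (Q \<bind> (\<lambda>\<omega>. K (\<omega> n))) B" .
  qed
  then have "(\<integral>\<^sup>+y. g y \<partial>distr Q borel (\<lambda>\<omega>. \<omega> (Suc n))) = (\<integral>\<^sup>+y. g y \<partial>(Q \<bind> (\<lambda>\<omega>. K (\<omega> n))))" by simp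
  also have "\<dots> = (\<integral>\<^sup>+\<omega>. \<integral>\<^sup>+y. g y \<partial>K (\<omega> n) \<partial>Q)"
    by (rule nn_integral_bind[where B=borel]) auto
  also have "\<dots> = (\<integral>\<^sup>+\<omega>. indicator ?C \<omega> * (\<integral>\<^sup>+y. g y \<partial>K (\<omega> n)) \<partial>chain)"
    unfolding Q_def by (subst nn_integral_density) auto
  also have "(\<integral>\<^sup>+y. g y \<partial>distr Q borel (\<lambda>\<omega>. \<omega> (Suc n))) = (\<integral>\<^sup>+\<omega>. g (\<omega> (Suc n)) \<partial>Q)"
    by (rule nn_integral_distr) auto
  also have "\<dots> = (\<integral>\<^sup>+\<omega>. indicator ?C \<omega> * g (\<omega> (Suc n)) \<partial>chain)"
    unfolding Q_def by (subst nn_integral_density) auto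
  finally show ?thesis .
qed

end

text \<open>The probability that a walk with increment law \<open>F\<close> started at
  \<open>x\<close> stays in \<open>U\<close> up to time \<open>n\<close>. It depends on the law
  only, so processes on different probability spaces can be compared through it.\<close>

primrec survival :: "real measure \<Rightarrow> real set \<Rightarrow> nat \<Rightarrow> real \<Rightarrow> ennreal" where
  "survival F U 0 x = indicator U x"
| "survival F U (Suc n) x = indicator U x * (\<integral>\<^sup>+y. survival F U n (x + y) \<partial>F)"

lemma survival_measurable:
  assumes "sigma_finite_measure F" and [measurable_cong]: "sets F = sets borel" and [measurable]: "U \<in> sets borel"
  shows "survival F U n \<in> borel_measurable borel"
proof (induction n)
  case 0
  have "survival F U 0 = indicator U" by (auto simp: fun_eq_iff)
  then show ?case by simp
next
  case (Suc n)
  interpret sigma_finite_measure F by fact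
  note [measurable] = Suc
  have "survival F U (Suc n) = (\<lambda>x. indicator U x * (\<integral>\<^sup>+y. survival F U n (x + y) \<partial>F))" by (auto simp: fun_eq_iff)
  also have "\<dots> \<in> borel_measurable borel" by measurable
  finally show ?case .
qed

text \<open>Used for both the random walk and the switching chain: the step relation is required
  only on paths that have stayed in \<open>U\<close>. By this relation the integral in
  \<open>*\<close> depends on \<open>m + j\<close> alone, which moves the whole survival requirement
  to time 0.\<close>

lemma survival_process:
  fixes V :: "nat \<Rightarrow> 'b \<Rightarrow> real"
  assumes F: "sigma_finite_measure F" "sets F = sets borel" and U [measurable]: "U \<in> sets borel"
    and V [measurable]: "\<And>n. V n \<in> borel_measurable Q"
    and step: "\<And>n g. g \<in> borel_measurable borel \<Longrightarrow>
      (\<integral>\<^sup>+\<omega>. indicator {\<omega>. \<forall>k\<le>n. V k \<omega> \<in> U} \<omega> * g (V (Suc n) \<omega>) \<partial>Q) =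
      (\<integral>\<^sup>+\<omega>. indicator {\<omega>. \<forall>k\<le>n. V k \<omega> \<in> U} \<omega> * (\<integral>\<^sup>+y. g (V n \<omega> + y) \<partial>F) \<partial>Q)"
  shows "emeasure Q {\<omega> \<in> space Q. \<forall>k\<le>n. V k \<omega> \<in> U} = (\<integral>\<^sup>+\<omega>. survival F U n (V 0 \<omega>) \<partial>Q)"
proof -
  let ?I = "\<lambda>n \<omega>. indicator {\<omega>. \<forall>k\<le>n. V k \<omega> \<in> U} \<omega> :: ennreal"
  have *: "(\<integral>\<^sup>+\<omega>. ?I m \<omega> * survival F U j (V m \<omega>) \<partial>Q) = (\<integral>\<^sup>+\<omega>. survival F U (m + j) (V 0 \<omega>) \<partial>Q)" for m j
  proof (induction m arbitrary: j)
    case 0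
    have "?I 0 \<omega> * survival F U j (V 0 \<omega>) = survival F U j (V 0 \<omega>)" for \<omega>
      by (cases j) (auto simp: indicator_def)
    then show ?case by simp
  next
    case (Suc m)
    have "?I (Suc m) \<omega> * survival F U j (V (Suc m) \<omega>) = ?I m \<omega> * survival F U j (V (Suc m) \<omega>)" for \<omega>
      by (cases j) (auto simp: indicator_def le_Suc_eq)
    then have "(\<integral>\<^sup>+\<omega>. ?I (Suc m) \<omega> * survival F U j (V (Suc m) \<omega>) \<partial>Q) =
      (\<integral>\<^sup>+\<omega>. ?I m \<omega> * survival F U j (V (Suc m) \<omega>) \<partial>Q)" by simp
    also have "\<dots> = (\<integral>\<^sup>+\<omega>. ?I m \<omega> * (\<integral>\<^sup>+y. survival F U j (V m \<omega> + y) \<partial>F) \<partial>Q)"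
      by (rule step) (rule survival_measurable[OF F U])
    also have "\<dots> = (\<integral>\<^sup>+\<omega>. ?I m \<omega> * survival F U (Suc j) (V m \<omega>) \<partial>Q)"
      by (intro nn_integral_cong) (auto simp: indicator_def)
    also have "\<dots> = (\<integral>\<^sup>+\<omega>. survival F U (Suc m + j) (V 0 \<omega>) \<partial>Q)"
      using Suc.IH[of "Suc j"] by (simp del: survival.simps)
    finally show ?case .
  qed
  have [measurable]: "{\<omega> \<in> space Q. \<forall>k\<le>n. V k \<omega> \<in> U} \<in> sets Q" by measurable
  have "emeasure Q {\<omega> \<in> space Q. \<forall>k\<le>n. V k \<omega> \<in> U} = (\<integral>\<^sup>+\<omega>. indicator {\<omega> \<in> space Q. \<forall>k\<le>n. V k \<omega> \<in> U} \<omega> \<partial>Q)"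
    by simp
  also have "\<dots> = (\<integral>\<^sup>+\<omega>. ?I n \<omega> * survival F U 0 (V n \<omega>) \<partial>Q)"
    by (intro nn_integral_cong) (auto simp: indicator_def)
  finally show ?thesis using *[of n 0] by (simp del: survival.simps)
qed

context iid_walk
begin

text \<open>The past up to time \<open>n\<close> is a function of the first \<open>n\<close>
  increments, which are independent of \<open>X n\<close>; the integral over the product law then
  splits.\<close>

lemma nn_integral_walk_step:
  assumes [measurable]: "U \<in> sets borel" "g \<in> borel_measurable borel"
  shows "(\<integral>\<^sup>+\<omega>. indicator {\<omega>. \<forall>k\<le>n. x + walk X k \<omega> \<in> U} \<omega> * g (x + walk X (Suc n) \<omega>) \<partial>M) =
    (\<integral>\<^sup>+\<omega>. indicator {\<omega>. \<forall>k\<le>n. x + walk X k \<omega> \<in> U} \<omega> * (\<integral>\<^sup>+y. g (x + walk X n \<omega> + y) \<partial>law) \<partial>M)"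
proof -
  let ?P = "PiM {..<n} (\<lambda>_. borel :: real measure)"
  define R where "R = (\<lambda>\<omega>. restrict (\<lambda>i. X i \<omega>) {..<n})"
  define s where "s k r = (\<Sum>i<k. r i)" for k and r :: "nat \<Rightarrow> real"
  have s: "walk X k \<omega> = s k (R \<omega>)" if "k \<le> n" for k \<omega>
    using that by (auto simp: s_def R_def walk_def intro!: sum.cong)
  have s_meas [measurable]: "s k \<in> borel_measurable ?P" if "k \<in> {..n}" for k
  proof -
    have "(\<lambda>r. \<Sum>i<k. r i) \<in> borel_measurable ?P"
      using that by (intro borel_measurable_sum measurable_component_singleton) auto
    then show ?thesis by (simp add: s_def[abs_def])
  qed
  define I where "I r = (if \<forall>k\<in>{..n}. x + s k r \<in> U then 1 else 0 :: ennreal)" for r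
  have [measurable]: "I \<in> borel_measurable ?P"
  proof -
    have "{r \<in> space ?P. \<forall>k\<in>{..n}. x + s k r \<in> U} \<in> sets ?P"
    proof (rule sets.sets_Collect_finite_All')
      fix k assume "k \<in> {..n}"
      note [measurable] = s_meas[OF this]
      show "{r \<in> space ?P. x + s k r \<in> U} \<in> sets ?P" by measurable
    qed auto
    then have "(\<lambda>r. if \<forall>k\<in>{..n}. x + s k r \<in> U then 1 else 0 :: ennreal) \<in> borel_measurable ?P"
      by (intro measurable_If) auto
    then show ?thesis by (simp add: I_def[abs_def])
  qed
  have sn [measurable]: "s n \<in> borel_measurable ?P" by (rule s_meas) simp
  let ?P1 = "PiM {n} (\<lambda>_. borel :: real measure)"
  \<comment> \<open>\<open>X n\<close> is wrapped as a family with one coordinate, so that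
    independence of disjoint blocks applies.\<close>
  define R1 where "R1 = (\<lambda>\<omega>. restrict (\<lambda>i. X i \<omega>) {n})"
  have ind: "indep_var ?P R ?P1 R1"
    unfolding R_def R1_def by (rule indep_var_restrict[OF indep]) auto
  then have [measurable]: "R \<in> M \<rightarrow>\<^sub>M ?P" "R1 \<in> M \<rightarrow>\<^sub>M ?P1"
    by (auto dest: indep_var_rv1 indep_var_rv2)
  have prod: "distr M (?P \<Otimes>\<^sub>M ?P1) (\<lambda>\<omega>. (R \<omega>, R1 \<omega>)) = distr M ?P R \<Otimes>\<^sub>M distr M ?P1 R1"
    using ind unfolding indep_var_distribution_eq by simp
  have [measurable]: "(\<lambda>y. y n) \<in> ?P1 \<rightarrow>\<^sub>M borel" by (intro measurable_component_singleton) auto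
  interpret L: prob_space "distr M ?P1 R1" by (rule prob_space_distr) simp
  interpret law: prob_space law by (rule prob_space_law)
  let ?h = "\<lambda>(r, y). I r * g (x + s n r + y n)"
  have ind_I: "indicator {\<omega>. \<forall>k\<le>n. x + walk X k \<omega> \<in> U} \<omega> = I (R \<omega>)" for \<omega>
    using s by (auto simp: I_def indicator_def)
  have walk_Suc: "walk X (Suc n) \<omega> = walk X n \<omega> + X n \<omega>" for \<omega> by (simp add: walk_def)
  have inner: "(\<integral>\<^sup>+y. g (z + y n) \<partial>distr M ?P1 R1) = (\<integral>\<^sup>+y. g (z + y) \<partial>law)" for z
  proof -
    have "(\<integral>\<^sup>+y. g (z + y n) \<partial>distr M ?P1 R1) = (\<integral>\<^sup>+\<omega>. g (z + X n \<omega>) \<partial>M)"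
      by (subst nn_integral_distr) (auto simp: R1_def)
    also have "\<dots> = (\<integral>\<^sup>+y. g (z + y) \<partial>distr M borel (X n))"
      by (subst nn_integral_distr) auto
    finally show ?thesis by (simp only: ident[of n])
  qed
  have "(\<integral>\<^sup>+\<omega>. indicator {\<omega>. \<forall>k\<le>n. x + walk X k \<omega> \<in> U} \<omega> * g (x + walk X (Suc n) \<omega>) \<partial>M) =
      (\<integral>\<^sup>+\<omega>. ?h (R \<omega>, R1 \<omega>) \<partial>M)"
    unfolding ind_I by (simp add: walk_Suc s add.assoc R1_def)
  also have "\<dots> = (\<integral>\<^sup>+p. ?h p \<partial>distr M (?P \<Otimes>\<^sub>M ?P1) (\<lambda>\<omega>. (R \<omega>, R1 \<omega>)))"
    by (subst nn_integral_distr) auto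
  also have "\<dots> = (\<integral>\<^sup>+r. \<integral>\<^sup>+y. ?h (r, y) \<partial>distr M ?P1 R1 \<partial>distr M ?P R)"
    unfolding prod by (subst L.nn_integral_fst[symmetric]) auto
  also have "\<dots> = (\<integral>\<^sup>+r. I r * (\<integral>\<^sup>+y. g (x + s n r + y) \<partial>law) \<partial>distr M ?P R)"
    by (simp add: nn_integral_cmult inner)
  also have "\<dots> = (\<integral>\<^sup>+\<omega>. I (R \<omega>) * (\<integral>\<^sup>+y. g (x + s n (R \<omega>) + y) \<partial>law) \<partial>M)"
    by (subst nn_integral_distr) auto
  finally show ?thesis unfolding ind_I by (simp add: s)
qed

lemma survival_walk:
  assumes "U \<in> sets borel"
  shows "survival law U n x = emeasure M {\<omega> \<in> space M. \<forall>k\<le>n. x + walk X k \<omega> \<in> U}"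
proof -
  interpret L: prob_space law by (rule prob_space_law)
  have "emeasure M {\<omega> \<in> space M. \<forall>k\<le>n. x + walk X k \<omega> \<in> U} = (\<integral>\<^sup>+\<omega>. survival law U n (x + walk X 0 \<omega>) \<partial>M)"
    using assms by (intro survival_process nn_integral_walk_step) (auto simp: L.sigma_finite_measure_axioms)
  then show ?thesis by (simp add: walk_def emeasure_space_1)
qed

lemma survival_tendsto_0:
  assumes [measurable]: "U \<in> sets borel" and "AE \<omega> in M. \<exists>k. x + walk X k \<omega> \<notin> U"
  shows "(\<lambda>n. survival law U n x) \<longlonglongrightarrow> 0"
proof -
  have "(\<lambda>n. emeasure M {\<omega> \<in> space M. \<forall>k\<le>n. x + walk X k \<omega> \<in> U}) \<longlonglongrightarrow>
      emeasure M (\<Inter>n. {\<omega> \<in> space M. \<forall>k\<le>n. x + walk X k \<omega> \<in> U})"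
    by (intro Lim_emeasure_decseq) (auto simp: decseq_def)
  also have "(\<Inter>n. {\<omega> \<in> space M. \<forall>k\<le>n. x + walk X k \<omega> \<in> U}) = {\<omega> \<in> space M. \<not> (\<exists>k. x + walk X k \<omega> \<notin> U)}"
    by auto
  also have "emeasure M \<dots> = 0"
    using assms(2) by (subst (asm) AE_iff_measurable[OF _ refl]) auto
  finally show ?thesis using survival_walk[OF assms(1)] by simp
qed

end

text \<open>Inside \<open>U\<close> the chain moves like the walk, so both have the same survival
  function. It tends to 0 at every starting point, and dominated convergence integrates this over
  the initial law.\<close>

lemma (in markov_chain) AE_leaves:
  assumes "iid_walk M X" and U [measurable]: "U \<in> sets borel"
    and K_U: "\<And>x. x \<in> U \<Longrightarrow> K x = distr (distr M borel (X 0)) borel (\<lambda>y. x + y)"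
    and exit: "\<And>x. AE \<omega> in M. \<exists>k. x + walk X k \<omega> \<notin> U"
  shows "AE \<omega> in chain. \<exists>k. \<omega> k \<notin> U"
proof -
  interpret W: iid_walk M X by fact
  interpret L: prob_space W.law by (rule W.prob_space_law)
  note [measurable] = survival_measurable[OF L.sigma_finite_measure_axioms sets_distr U]
  have surv: "emeasure chain {\<omega> \<in> space chain. \<forall>k\<le>n. \<omega> k \<in> U} = (\<integral>\<^sup>+\<omega>. survival W.law U n (\<omega> 0) \<partial>chain)" for n
  proof (rule survival_process)
    fix n :: nat and g :: "real \<Rightarrow> ennreal" assume [measurable]: "g \<in> borel_measurable borel"
    have "indicator {\<omega>. \<forall>k\<le>n. \<omega> k \<in> U} \<omega> * (\<integral>\<^sup>+y. g y \<partial>K (\<omega> n)) =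
        indicator {\<omega>. \<forall>k\<le>n. \<omega> k \<in> U} \<omega> * (\<integral>\<^sup>+y. g (\<omega> n + y) \<partial>W.law)" for \<omega>
    proof (cases "\<omega> n \<in> U")
      case True
      then show ?thesis by (subst K_U) (auto simp: nn_integral_distr)
    next
      case False
      then have "\<omega> \<notin> {\<omega>. \<forall>k\<le>n. \<omega> k \<in> U}" by (auto intro!: exI[of _ n])
      then have "indicator {\<omega>. \<forall>k\<le>n. \<omega> k \<in> U} \<omega> = (0 :: ennreal)" by (rule indicator_simps)
      then show ?thesis by (simp only: mult_zero_left)
    qed
    then show "(\<integral>\<^sup>+\<omega>. indicator {\<omega>. \<forall>k\<le>n. \<omega> k \<in> U} \<omega> * g (\<omega> (Suc n)) \<partial>chain) =
        (\<integral>\<^sup>+\<omega>. indicator {\<omega>. \<forall>k\<le>n. \<omega> k \<in> U} \<omega> * (\<integral>\<^sup>+y. g (\<omega> n + y) \<partial>W.law) \<partial>chain)"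
      by (simp add: nn_integral_step)
  qed (auto simp: L.sigma_finite_measure_axioms)
  have "(\<lambda>n. \<integral>\<^sup>+\<omega>. survival W.law U n (\<omega> 0) \<partial>chain) \<longlonglongrightarrow> (\<integral>\<^sup>+\<omega>. 0 \<partial>chain)"
  proof (rule nn_integral_dominated_convergence[where w="\<lambda>_. 1"])
    show "AE \<omega> in chain. survival W.law U n (\<omega> 0) \<le> 1" for n
      by (simp add: W.survival_walk W.measure_le_1 W.emeasure_le_1)
    show "AE \<omega> in chain. (\<lambda>n. survival W.law U n (\<omega> 0)) \<longlonglongrightarrow> 0"
      using W.survival_tendsto_0[OF U exit] by simp
    show "(\<integral>\<^sup>+\<omega>. 1 \<partial>chain) < \<infinity>" by (simp add: emeasure_space_1[unfolded space_chain])
  qed auto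
  then have lim: "(\<lambda>n. emeasure chain {\<omega> \<in> space chain. \<forall>k\<le>n. \<omega> k \<in> U}) \<longlonglongrightarrow> 0"
    unfolding surv by simp
  have "emeasure chain {\<omega> \<in> space chain. \<not> (\<exists>k. \<omega> k \<notin> U)} \<le> 0"
  proof (rule LIMSEQ_le_const[OF lim], intro exI[of _ 0] allI impI emeasure_mono)
    show "{\<omega> \<in> space chain. \<forall>k\<le>n. \<omega> k \<in> U} \<in> sets chain" for n by measurable
  qed auto
  then have null: "emeasure chain {\<omega> \<in> space chain. \<not> (\<exists>k. \<omega> k \<notin> U)} = 0" by simp
  show ?thesis by (rule AE_iff_measurable[OF _ refl, THEN iffD2, OF _ null]) measurable
qed

section \<open>The switching random walk\<close>

context switching_walks
begin

abbreviation "K \<equiv> switching_kernel \<alpha> X.law X'.law"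
abbreviation "E \<equiv> full_range \<alpha> d S S'"

lemma kernel: "K \<in> borel \<rightarrow>\<^sub>M prob_algebra borel"
  using \<alpha> by (intro prob_kernel_switching_kernel X.prob_space_law X'.prob_space_law) auto

lemma emeasure_kernel:
  assumes [measurable]: "B \<in> sets borel"
  shows "emeasure (K x) B = (if x > 0 then emeasure X.law {y. x + y \<in> B} else if x < 0 then emeasure X'.law {y. x + y \<in> B}
    else ennreal \<alpha> * emeasure X.law B + ennreal (1 - \<alpha>) * emeasure X'.law B)"
  by (auto simp: switching_kernel_def emeasure_distr[of _ X.law] emeasure_distr[of _ X'.law] vimage_def emeasure_add_measure)

text \<open>Reduces almost sure statements about a step to pointwise ones about the supports. At 0 a
  law of weight zero imposes no condition, which matches the case distinction in
  \<open>hit\<close>.\<close>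

lemma kernel_null:
  assumes B [measurable]: "B \<in> sets borel"
    and up: "x > 0 \<or> x = 0 \<and> \<alpha> > 0 \<Longrightarrow> \<forall>y\<in>S. x + y \<notin> B"
    and down: "x < 0 \<or> x = 0 \<and> \<alpha> < 1 \<Longrightarrow> \<forall>y\<in>S'. x + y \<notin> B"
  shows "emeasure (K x) B = 0"
proof -
  have B': "{y. x + y \<in> B} \<in> sets borel"
  proof -
    have "{y \<in> space borel. x + y \<in> B} \<in> sets borel" by measurable
    then show ?thesis by simp
  qed
  have *: "emeasure \<mu> {y. x + y \<in> B} = 0" if "\<forall>y\<in>msupp \<mu>. x + y \<notin> B" "sets \<mu> = sets borel" for \<mu>
    using msupp_meets[OF that(2), of "{y. x + y \<in> B}"] that(1) by (auto simp: zero_less_iff_neq_zero)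
  consider "x > 0" | "x < 0" | "x = 0" by linarith
  then show ?thesis
  proof cases
    case 1
    then show ?thesis using *[of X.law] up by (simp add: emeasure_kernel)
  next
    case 2
    then show ?thesis using *[of X'.law] down by (simp add: emeasure_kernel)
  next
    case 3
    then have "\<alpha> > 0 \<Longrightarrow> emeasure X.law B = 0" "\<alpha> < 1 \<Longrightarrow> emeasure X'.law B = 0"
      using *[of X.law] *[of X'.law] up down by auto
    then have "ennreal \<alpha> * emeasure X.law B = 0" "ennreal (1 - \<alpha>) * emeasure X'.law B = 0"
      using \<alpha> by (auto simp: ennreal_eq_0_iff le_less)
    then show ?thesis using 3 emeasure_kernel[OF B, of x] by simp
  qed
qed

lemma law_lattice_pos:
  assumes \<mu>: "sets \<mu> = sets borel" "msupp \<mu> \<subseteq> lattice d" and x: "x \<in> lattice d" and y: "y \<in> msupp \<mu>" and "\<epsilon> > 0"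
  shows "emeasure \<mu> {z. x + z \<in> ball (x + y) \<epsilon> \<inter> lattice d} > 0"
proof -
  have "0 < emeasure \<mu> (ball y \<epsilon>)" using assms by (intro msupp_open[OF y]) auto
  also have "\<dots> = emeasure \<mu> (ball y \<epsilon> \<inter> lattice d)"
  proof (rule emeasure_eq_AE)
    show "AE z in \<mu>. z \<in> ball y \<epsilon> \<longleftrightarrow> z \<in> ball y \<epsilon> \<inter> lattice d"
      using AE_msupp[OF \<mu>(1)] by eventually_elim (use \<mu>(2) in auto)
  qed (use \<mu> closed_lattice[OF hull_lattice(1)] in auto)
  also have "ball y \<epsilon> \<inter> lattice d = {z. x + z \<in> ball (x + y) \<epsilon> \<inter> lattice d}"
    using x lattice_diff[of "x + _" d x] by (auto simp: dist_real_def intro: lattice_add)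
  finally show ?thesis .
qed

lemma kernel_pos:
  assumes x: "x \<in> lattice d" and "\<epsilon> > 0"
    and "(x > 0 \<or> x = 0 \<and> \<alpha> > 0) \<and> y \<in> S \<or> (x < 0 \<or> x = 0 \<and> \<alpha> < 1) \<and> y \<in> S'"
  shows "emeasure (K x) (ball (x + y) \<epsilon> \<inter> lattice d) > 0"
proof -
  define B where "B = ball (x + y) \<epsilon> \<inter> lattice d"
  have B: "B \<in> sets borel"
    unfolding B_def using closed_lattice[OF hull_lattice(1)] by auto
  have "y \<in> S \<Longrightarrow> emeasure X.law {z. x + z \<in> B} > 0" "y \<in> S' \<Longrightarrow> emeasure X'.law {z. x + z \<in> B} > 0"
    unfolding B_def using supports.supports_subset assms by (intro law_lattice_pos; simp)+
  then have "emeasure (K x) B > 0" using assms(3)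
    by (auto simp: emeasure_kernel[OF B] add_pos_nonneg add_nonneg_pos ennreal_zero_less_mult_iff)
  then show ?thesis by (simp add: B_def)
qed

end

locale switching_chain = switching_walks M X X' \<alpha> + markov_chain "switching_kernel \<alpha> (distr M borel (X 0)) (distr M borel (X' 0))" \<eta>
  for M :: "'a measure" and X X' \<alpha> \<eta>
begin

text \<open>The bridge from topology to probability: each neighbourhood required by
  \<open>hit\<close> is charged by the kernel, and \<open>reaches_union\<close> selects a number of
  steps.\<close>

lemma hits_imp_reaches:
  assumes "supports.hits G x" "open G" "x \<in> lattice d"
  shows "x \<in> (\<Union>n. reaches (lattice d \<inter> G) n)"
proof -
  have Z [measurable]: "lattice d \<in> sets borel" using closed_lattice[OF hull_lattice(1)] by auto
  have G: "lattice d \<inter> G \<in> sets borel" using assms(2) Z by auto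
  show ?thesis using assms(1,3)
  proof induction
    case (start x)
    then show ?case by (intro UN_I[of 0]) auto
  next
    case (up x y \<epsilon>)
    have "emeasure (K x) (ball (x + y) \<epsilon> \<inter> lattice d) > 0" using up by (intro kernel_pos) auto
    moreover have "ball (x + y) \<epsilon> \<inter> lattice d \<subseteq> (\<Union>n. reaches (lattice d \<inter> G) n)"
      using up(5) by (auto simp: dist_real_def abs_minus_commute)
    ultimately obtain n where "x \<in> reaches (lattice d \<inter> G) (Suc n)"
      using reaches_union[OF G, of "ball (x + y) \<epsilon> \<inter> lattice d" x] Z by auto
    then show ?case by blast
  next
    case (down x y \<epsilon>)
    have "emeasure (K x) (ball (x + y) \<epsilon> \<inter> lattice d) > 0" using down by (intro kernel_pos) auto
    moreover have "ball (x + y) \<epsilon> \<inter> lattice d \<subseteq> (\<Union>n. reaches (lattice d \<inter> G) n)"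
      using down(5) by (auto simp: dist_real_def abs_minus_commute)
    ultimately obtain n where "x \<in> reaches (lattice d \<inter> G) (Suc n)"
      using reaches_union[OF G, of "ball (x + y) \<epsilon> \<inter> lattice d" x] Z by auto
    then show ?case by blast
  qed
qed

lemma E_borel [measurable]: "E \<in> sets borel"
  using closed_full_range[OF hull_lattice(1)] by auto

lemma lattice_borel [measurable]: "lattice d \<in> sets borel"
  using closed_lattice[OF hull_lattice(1)] by auto

lemma kernel_absorbing: "x \<in> E \<Longrightarrow> emeasure (K x) (- E) = 0"
  by (rule kernel_null) (auto simp: supports.full_range_step_up supports.full_range_step_down)

lemma kernel_lattice: "x \<in> lattice d \<Longrightarrow> emeasure (K x) (- lattice d) = 0"
  using supports.supports_subset by (intro kernel_null) (auto intro!: lattice_add)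

lemma kernel_exit_up: "x \<in> lattice d \<inter> {0<..} \<Longrightarrow> emeasure (K x) (- ({0<..} \<union> E)) = 0"
  by (rule kernel_null) (use supports.exit_upper[of x] in force)+

lemma kernel_exit_down: "x \<in> lattice d \<inter> {..<0} \<Longrightarrow> emeasure (K x) (- ({..<0} \<union> E)) = 0"
  by (rule kernel_null) (use supports.exit_lower[of x] in force)+

text \<open>A path that avoids \<open>E\<close> can never leave its initial open half-line, because
  the step out of it would end in \<open>E\<close>; but the oscillation assumptions force it to
  leave. A start at 0 is already in \<open>E\<close>.\<close>

lemma AE_hits_E:
  assumes \<eta>Z: "measure \<eta> (lattice d) = 1"
    and "AE \<omega> in M. liminf (\<lambda>n. ereal (walk X n \<omega>)) = - \<infinity>"
    and "AE \<omega> in M. limsup (\<lambda>n. ereal (walk X' n \<omega>)) = \<infinity>"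
  shows "AE \<omega> in chain. \<exists>n. \<omega> n \<in> E"
proof -
  interpret \<eta>: prob_space \<eta> by (rule initial)
  have "AE x in \<eta>. x \<in> lattice d" using \<eta>Z initial(2) by (subst \<eta>.prob_eq_1[symmetric]) auto
  then have "emeasure \<eta> {x \<in> space \<eta>. x \<notin> lattice d} = 0"
    using initial(2) by (subst (asm) AE_iff_measurable[OF _ refl]) auto
  moreover have "{x \<in> space \<eta>. x \<notin> lattice d} = - lattice d"
    using sets_eq_imp_space_eq[OF initial(2)] by auto
  ultimately have start: "AE \<omega> in chain. \<omega> 0 \<in> lattice d" by (intro AE_initial) auto
  have Z: "AE \<omega> in chain. \<forall>n. \<omega> n \<in> lattice d \<longrightarrow> \<omega> (Suc n) \<in> lattice d"
    unfolding AE_all_countable by (intro allI AE_step kernel_lattice) auto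
  have up: "AE \<omega> in chain. \<forall>n. \<omega> n \<in> lattice d \<inter> {0<..} \<longrightarrow> \<omega> (Suc n) \<in> {0<..} \<union> E"
    unfolding AE_all_countable by (intro allI AE_step kernel_exit_up) auto
  have down: "AE \<omega> in chain. \<forall>n. \<omega> n \<in> lattice d \<inter> {..<0} \<longrightarrow> \<omega> (Suc n) \<in> {..<0} \<union> E"
    unfolding AE_all_countable by (intro allI AE_step kernel_exit_down) auto
  have leave_up: "AE \<omega> in chain. \<exists>k. \<omega> k \<notin> {0<..}"
  proof (rule AE_leaves[OF X.iid_walk_axioms])
    fix x
    show "AE \<omega> in M. \<exists>k. x + walk X k \<omega> \<notin> {0<..}"
      using assms(2)
    proof eventually_elim
      case (elim \<omega>)
      show ?case
      proof (rule ccontr)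
        assume "\<nexists>k. x + walk X k \<omega> \<notin> {0<..}"
        then have pos: "0 < x + walk X k \<omega>" for k by auto
        have "- x \<le> walk X k \<omega>" for k using pos[of k] by linarith
        then have "ereal (- x) \<le> liminf (\<lambda>n. ereal (walk X n \<omega>))" by (intro Liminf_bounded) auto
        then show False using elim by simp
      qed
    qed
  qed (auto simp: switching_kernel_def)
  have leave_down: "AE \<omega> in chain. \<exists>k. \<omega> k \<notin> {..<0}"
  proof (rule AE_leaves[OF X'.iid_walk_axioms])
    fix x
    show "AE \<omega> in M. \<exists>k. x + walk X' k \<omega> \<notin> {..<0}"
      using assms(3)
    proof eventually_elim
      case (elim \<omega>)
      show ?case
      proof (rule ccontr)
        assume "\<nexists>k. x + walk X' k \<omega> \<notin> {..<0}"
        then have neg: "x + walk X' k \<omega> < 0" for k by auto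
        have "walk X' k \<omega> \<le> - x" for k using neg[of k] by linarith
        then have "limsup (\<lambda>n. ereal (walk X' n \<omega>)) \<le> ereal (- x)" by (intro Limsup_bounded) auto
        then show False using elim by simp
      qed
    qed
  qed (auto simp: switching_kernel_def)
  show ?thesis using start Z up down leave_up leave_down
  proof eventually_elim
    case (elim \<omega>)
    have \<omega>Z: "\<omega> n \<in> lattice d" for n by (induction n) (use elim(1,2) in auto)
    have first: "\<exists>n. \<omega> n \<in> E" if "\<omega> 0 \<in> U" "\<exists>k. \<omega> k \<notin> U" "\<forall>n. \<omega> n \<in> lattice d \<inter> U \<longrightarrow> \<omega> (Suc n) \<in> U \<union> E" for U
    proof (rule ccontr)
      assume "\<nexists>n. \<omega> n \<in> E"
      then have "\<omega> n \<in> U" for n by (induction n) (use that \<omega>Z in auto)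
      then show False using that(2) by auto
    qed
    consider "\<omega> 0 \<in> {0<..}" | "\<omega> 0 \<in> {..<0}" | "\<omega> 0 = 0" by fastforce
    then show ?case
    proof cases
      case 1
      then show ?thesis using first elim(3,5) by blast
    next
      case 2
      then show ?thesis using first elim(4,6) by blast
    next
      case 3
      then show ?thesis using supports.zero_full_range by metis
    qed
  qed
qed

end

section \<open>Absorption, irreducibility and the theorem\<close>

lemma (in switching_walks) switching_chainI:
  "prob_space \<eta> \<Longrightarrow> sets \<eta> = sets borel \<Longrightarrow> switching_chain M X X' \<alpha> \<eta>"
  by (intro switching_chain.intro switching_walks_axioms markov_chain.intro kernel)

lemma (in switching_walks) absorbing_full_range: "absorbing K (lattice d) E"
  unfolding absorbing_def
proof (intro conjI ballI)
  show "E \<in> sets borel" using closed_full_range[OF hull_lattice(1)] by auto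
  show "E \<subseteq> lattice d" by (rule supports.full_range_lattice)
  fix x assume x: "x \<in> E"
  interpret C: switching_chain M X X' \<alpha> "return borel x"
    by (rule switching_chainI) (auto intro: prob_space_return)
  have "AE \<omega> in C.chain. \<omega> 0 \<in> E" using x by (intro C.AE_initial) auto
  moreover have "AE \<omega> in C.chain. \<omega> 0 \<in> E \<longrightarrow> \<omega> (Suc 0) \<in> E"
    by (intro C.AE_step C.kernel_absorbing) auto
  ultimately have "AE \<omega> in C.chain. \<omega> 1 \<in> E" by eventually_elim auto
  then show "\<P>(\<omega> in C.chain. \<omega> 1 \<in> E) = 1" by (rule C.prob_Collect_eq_1[THEN iffD2, rotated]) measurable
qed

lemma (in switching_walks) irreducible_full_range: "topologically_irreducible_on K (lattice d) E"
  unfolding topologically_irreducible_on_def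
proof (intro ballI allI impI)
  fix x G assume x: "x \<in> E" and "openin (top_of_set (lattice d)) G" and GE: "G \<inter> E \<noteq> {}"
  then obtain T where T: "open T" "G = lattice d \<inter> T" by (auto simp: openin_open)
  then obtain e where e: "e \<in> T" "e \<in> E" using GE by auto
  interpret C: switching_chain M X X' \<alpha> "return borel x"
    by (rule switching_chainI) (auto intro: prob_space_return)
  have G [measurable]: "G \<in> sets borel" using T C.lattice_borel by auto
  \<comment> \<open>Every state reaches \<open>G\<close>, not only those in
    \<open>E\<close>.\<close>
  have sub: "lattice d \<subseteq> (\<Union>n. C.reaches G n)"
    unfolding T(2) using C.hits_imp_reaches supports.hits_full_range T e by blast
  have xZ: "x \<in> lattice d" using x supports.full_range_lattice by auto
  \<comment> \<open>At least one step must be made even if \<open>x\<close> already lies in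
    \<open>G\<close>. So the covering \<open>sub\<close> is applied after the first step, which
    stays in the lattice almost surely.\<close>
  have "emeasure (K x) (lattice d) > 0"
  proof -
    interpret Kx: prob_space "K x" using measurable_space[OF kernel, of x] by (simp add: space_prob_algebra)
    have "emeasure (K x) (- lattice d) = 0" by (rule C.kernel_lattice[OF xZ])
    moreover have "emeasure (K x) (lattice d \<union> - lattice d) \<le> emeasure (K x) (lattice d) + emeasure (K x) (- lattice d)"
      by (rule emeasure_subadditive) auto
    moreover have "emeasure (K x) (lattice d \<union> - lattice d) = 1"
      using Kx.emeasure_space_1 sets_eq_imp_space_eq[of "K x" borel] by simp
    ultimately show ?thesis by (auto simp: zero_less_iff_neq_zero)
  qed
  then obtain n where n: "x \<in> C.reaches G (Suc n)" using C.reaches_union[OF G _ sub] by auto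
  have "emeasure C.chain {\<omega>. \<omega> 0 \<in> C.reaches G (Suc n)} > 0"
    using n C.reaches_measurable[OF G, of "Suc n"] by (subst C.emeasure_initial) (auto simp del: C.reaches.simps)
  then have "emeasure C.chain {\<omega>. \<omega> (0 + Suc n) \<in> G} > 0" by (rule C.reaches_imp_prob_pos[OF G])
  then have "\<P>(\<omega> in C.chain. \<omega> (Suc n) \<in> G) > 0" by (simp add: C.emeasure_eq_measure)
  then show "\<exists>n\<ge>1. \<P>(\<omega> in C.chain. \<omega> n \<in> G) > 0" by (intro exI[of _ "Suc n"]) auto
qed

theorem theorem2:
  fixes M :: "'a measure" and X X' :: "nat \<Rightarrow> 'a \<Rightarrow> real" and \<alpha> :: real
  assumes "prob_space M"
    and "0 \<le> \<alpha>" and "\<alpha> \<le> 1"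
    and "prob_space.indep_vars M (\<lambda>_. borel) (case_sum X X') UNIV"
    and "\<And>n. distr M borel (X n) = distr M borel (X 0)"
    and "\<And>n. distr M borel (X' n) = distr M borel (X' 0)"
    and "\<P>(\<omega> in M. X 0 \<omega> \<noteq> 0) > 0" and "\<P>(\<omega> in M. X' 0 \<omega> \<noteq> 0) > 0"
    and "\<P>(\<omega> in M. X 0 \<omega> < 0) > 0" and "\<P>(\<omega> in M. X' 0 \<omega> > 0) > 0"
  shows "let F = distr M borel (X 0); F' = distr M borel (X' 0);
           Z = state_space F F'; K = switching_kernel \<alpha> F F';
           \<nu> = nu M \<alpha> X X'; \<mu> = mu M \<alpha> X X'
         in
           absorbing K Z (msupp \<mu>) \<and>
           topologically_irreducible_on K Z (msupp \<mu>) \<and>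
           msupp \<mu> =
             (msupp (plus_part \<alpha> \<nu>)
                + (if \<P>(\<omega> in M. X 0 \<omega> > 0) \<noteq> 0 then lattice_pos (span_of F) else {0}))
             \<union> (msupp (minus_part \<alpha> \<nu>)
                + (if \<P>(\<omega> in M. X' 0 \<omega> < 0) \<noteq> 0 then lattice_neg (span_of F') else {0})) \<and>
           ((AE \<omega> in M. liminf (\<lambda>n. ereal (walk X n \<omega>)) = - \<infinity>) \<and>
            (AE \<omega> in M. limsup (\<lambda>n. ereal (walk X' n \<omega>)) = \<infinity>) \<longrightarrow>
            (\<forall>\<eta>. prob_space \<eta> \<and> sets \<eta> = sets borel \<and> measure \<eta> Z = 1 \<longrightarrow>
               \<P>(\<omega> in chain_law K \<eta>. \<exists>n. \<omega> n \<in> msupp \<mu>) = 1))"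
proof -
  interpret prob_space M by fact
  have indep: "indep_vars (\<lambda>_. borel) X UNIV" "indep_vars (\<lambda>_. borel) X' UNIV"
    using indep_vars_reindex_inj[OF indep_vars_subset[OF assms(4)], of Inl UNIV]
      indep_vars_reindex_inj[OF indep_vars_subset[OF assms(4)], of Inr UNIV] by auto
  interpret X: iid_walk M X by unfold_locales (fact indep(1), fact assms(5))
  interpret X': iid_walk M X' by unfold_locales (fact indep(2), fact assms(6))
  interpret switching_walks M X X' \<alpha>
  proof unfold_locales
    show "\<exists>y\<in>msupp X.law. y < 0" using assms(9) X.prob_increment_pos_iff[of "{..<0}"] by auto
    show "\<exists>y\<in>msupp X'.law. y > 0" using assms(10) X'.prob_increment_pos_iff[of "{0<..}"] by auto
  qed (use assms in auto)
  have Z: "state_space X.law X'.law = lattice d" by (simp add: state_space_def d_def)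
  have supp: "msupp (mu M \<alpha> X X') =
      (msupp (plus_part \<alpha> (nu M \<alpha> X X'))
         + (if \<P>(\<omega> in M. X 0 \<omega> > 0) \<noteq> 0 then lattice_pos (span_of X.law) else {0}))
      \<union> (msupp (minus_part \<alpha> (nu M \<alpha> X X'))
         + (if \<P>(\<omega> in M. X' 0 \<omega> < 0) \<noteq> 0 then lattice_neg (span_of X'.law) else {0}))"
    unfolding msupp_mu X.renewal_range_law[OF neg, symmetric] X'.renewal_range_law_uminus[OF pos, symmetric]
      msupp_plus_part msupp_minus_part uminus_image_plus[symmetric]
    by (simp add: full_range_def upper_range_def lower_range_def)
  have hit: "\<P>(\<omega> in chain_law K \<eta>. \<exists>n. \<omega> n \<in> E) = 1"
    if "AE \<omega> in M. liminf (\<lambda>n. ereal (walk X n \<omega>)) = - \<infinity>"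
      "AE \<omega> in M. limsup (\<lambda>n. ereal (walk X' n \<omega>)) = \<infinity>"
      and \<eta>: "prob_space \<eta>" "sets \<eta> = sets borel" "measure \<eta> (lattice d) = 1" for \<eta>
  proof -
    interpret C: switching_chain M X X' \<alpha> \<eta> by (rule switching_chainI) fact+
    show ?thesis
      by (rule C.prob_Collect_eq_1[THEN iffD2, OF _ C.AE_hits_E[OF \<eta>(3) that(1,2)]]) measurable
  qed
  show ?thesis
    unfolding Let_def Z using absorbing_full_range irreducible_full_range supp hit
    by (auto simp only: msupp_mu)
qed

end
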